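(* Fix an integer $m\ge1$. Let $T_N$, $N\in\mathbb N$, be the $mN\times mN$ real symmetric random block Toeplitz band matrices with bandwidth $b_N$ described in the context, where $b_N=o(N)$ but $b_N\to\infty$ as $N\to\infty$, and let $$X_N=T_N/\sqrt{2mb_N}.$$ Then, as $N\to\infty$, the eigenvalue distribution $\mu_{X_N}$ converges weakly to a probability distribution $\gamma^{(m)}$ on $\mathbb R$ whose odd moments vanish and which is determined by its even moments: for every integer $k\ge1$, $$m_{2k}(\gamma^{(m)})=\sum_{\pi\in\mathcal P_2(2k)}m^{k-1-f(\pi)} .$$ In addition, if there exist positive constants $\epsilon_0$ and $C$ such that $b_N\ge C\cdot N^{\frac12+\epsilon_0}$, then the empirical eigenvalue distribution $\widehat\mu_{X_N}$ converges weakly, almost surely, to $\gamma^{(m)}$.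
   Context: Random matrix model. For $m,N\in\mathbb N$ and an integer $b_N<N$ (the bandwidth), $T_N=(A_{i-j})_{i,j=1}^N$ is the $mN\times mN$ block matrix whose $(i,j)$ block is $A_{i-j}$, where $A_s=(a_{ij}(s))_{i,j=1}^m$ are $m\times m$ matrices, $A_s=0$ when $|s|>b_N$, and for $|s|\le b_N$ the entries of $A_s$ are real random variables (the entries may depend on $N$ and $m$; all random variables are defined on a common probability space). Assume: (i) $A_{-s}=(A_s)^T$ for all $s$ (so $T_N$ is symmetric; in particular $A_0$ is symmetric); (ii) for each $N$ and $m$, apart from the identities forced by (i), the entries are independent, i.e. the family $\{a_{ij}(s):1\le s\le b_N,\,1\le i,j\le m\}\cup\{a_{ij}(0):1\le i\le j\le m\}$ is independent; (iii) $E(a_{ij}(s))=0$ and $E(|a_{ij}(s)|^2)=1$ for all $|s|\le b_N$, $1\le i,j\le m$; (iv) for every $k\in\mathbb N$, $C_{k,m}:=\sup\{E|a_{ij}(s)|^k: N\in\mathbb N,\ |s|\le b_N,\ 1\le i,j\le m\}<+\infty$ and $\sup_{m\in\mathbb N}C_{k,m}=C_k<+\infty$. Eigenvalue distributions. For a real symmetric $n\times n$ random matrix $A$ on a probability space $(\Omega,P)$ with eigenvalues $\lambda_1(\omega),\dots,\lambda_n(\omega)$, $\mu_A=\frac1n\int_\Omega\sum_{j=1}^n\delta_{\lambda_j(\omega)}\,dP(\omega)$ is the (averaged) eigenvalue distribution and $\widehat\mu_A=\frac1n\sum_{j=1}^n\delta_{\lambda_j(\omega)}$ is the (random) empirical eigenvalue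 distribution. Partitions. $\mathcal P_2(2k)$ is the set of partitions $\pi=\{V_1,\dots,V_k\}$ of $\{1,\dots,2k\}$ all of whose blocks have exactly two elements. For such $\pi$ with $V_r=\{a_r,b_r\}$, $f(\pi)$ is the number of linearly independent equations (the rank) of the linear system in the unknowns $t_1,\dots,t_{2k}$ (with $t_{2k+1}=t_1$): $t_{a_i}=t_{b_i+1}$ and $t_{b_i}=t_{a_i+1}$ for $1\le i\le k$. $m_{2k}(\gamma)=\int x^{2k}\,d\gamma$. *)

theory Defs
  imports
    "HOL-Probability.Probability"
    "HOL-Library.Landau_Symbols"
    "HOL-Library.Disjoint_Sets"
    "Jordan_Normal_Form.Char_Poly"
    "Jordan_Normal_Form.DL_Rank"
begin

section \<open>The random matrix model\<close>

text \<open>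
  \<open>b N\<close> is the bandwidth and \<open>a m N s i j\<close> is the entry \<open>(i,j)\<close> of the block \<open>A\<^sub>s\<close> for the block
  size \<open>m\<close> and the number of blocks \<open>N\<close>. Entries inside a block are indexed by \<open>{..<m}\<close> instead
  of \<open>{1..m}\<close>. The parameters \<open>m\<close> and \<open>N\<close> are positive.
\<close>

definition abs_moment_sup ::
    "'a measure \<Rightarrow> (nat \<Rightarrow> nat) \<Rightarrow> (nat \<Rightarrow> nat \<Rightarrow> int \<Rightarrow> nat \<Rightarrow> nat \<Rightarrow> 'a \<Rightarrow> real) \<Rightarrow> nat \<Rightarrow> nat \<Rightarrow> ennreal"
  where
  "abs_moment_sup P b a k m =
     (SUP (N, s, i, j) \<in> {(N, s, i, j). 1 \<le> N \<and> \<bar>s\<bar> \<le> int (b N) \<and> i < m \<and> j < m}.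
        \<integral>\<^sup>+\<omega>. ennreal (\<bar>a m N s i j \<omega>\<bar> ^ k) \<partial>P)"

locale block_toeplitz_band_model = prob_space P
  for P :: "'a measure" +
  fixes b :: "nat \<Rightarrow> nat"
    and a :: "nat \<Rightarrow> nat \<Rightarrow> int \<Rightarrow> nat \<Rightarrow> nat \<Rightarrow> 'a \<Rightarrow> real"
  assumes bandwidth_less: "1 \<le> N \<Longrightarrow> b N < N"
    and entry_outside_band:
      "\<lbrakk>1 \<le> m; 1 \<le> N; int (b N) < \<bar>s\<bar>; i < m; j < m; \<omega> \<in> space P\<rbrakk> \<Longrightarrow> a m N s i j \<omega> = 0"
    and entry_random_variable:
      "\<lbrakk>1 \<le> m; 1 \<le> N; \<bar>s\<bar> \<le> int (b N); i < m; j < m\<rbrakk> \<Longrightarrow> random_variable borel (a m N s i j)"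
    and entry_transpose:
      "\<lbrakk>1 \<le> m; 1 \<le> N; i < m; j < m; \<omega> \<in> space P\<rbrakk> \<Longrightarrow> a m N (- s) i j \<omega> = a m N s j i \<omega>"
    and entries_independent:
      "\<lbrakk>1 \<le> m; 1 \<le> N\<rbrakk> \<Longrightarrow>
         indep_vars (\<lambda>_. borel) (\<lambda>(s, i, j). a m N s i j)
           ({(s, i, j). 1 \<le> s \<and> s \<le> int (b N) \<and> i < m \<and> j < m} \<union>
            {(s, i, j). s = 0 \<and> i \<le> j \<and> j < m})"
    and entry_mean:
      "\<lbrakk>1 \<le> m; 1 \<le> N; \<bar>s\<bar> \<le> int (b N); i < m; j < m\<rbrakk> \<Longrightarrow> expectation (a m N s i j) = 0"
    and entry_second_moment:
      "\<lbrakk>1 \<le> m; 1 \<le> N; \<bar>s\<bar> \<le> int (b N); i < m; j < m\<rbrakk> \<Longrightarrow>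
         expectation (\<lambda>\<omega>. \<bar>a m N s i j \<omega>\<bar> ^ 2) = 1"
    and abs_moments_finite: "1 \<le> m \<Longrightarrow> abs_moment_sup P b a k m < \<infinity>"
    and abs_moments_bounded: "(SUP m \<in> {1..}. abs_moment_sup P b a k m) < \<infinity>"

definition block_toeplitz_mat :: "nat \<Rightarrow> nat \<Rightarrow> (int \<Rightarrow> nat \<Rightarrow> nat \<Rightarrow> real) \<Rightarrow> real mat" where
  "block_toeplitz_mat m N A =
     mat (m * N) (m * N)
       (\<lambda>(p, q). A (int (p div m) - int (q div m)) (p mod m) (q mod m))"

definition normalized_toeplitz ::
    "(nat \<Rightarrow> nat) \<Rightarrow> (nat \<Rightarrow> nat \<Rightarrow> int \<Rightarrow> nat \<Rightarrow> nat \<Rightarrow> 'a \<Rightarrow> real) \<Rightarrow> nat \<Rightarrow> nat \<Rightarrow> 'a \<Rightarrow> real mat"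
  where
  "normalized_toeplitz b a m N \<omega> =
     (1 / sqrt (2 * real m * real (b N))) \<cdot>\<^sub>m block_toeplitz_mat m N (\<lambda>s i j. a m N s i j \<omega>)"

section \<open>Eigenvalue distributions\<close>

text \<open>
  For a real symmetric matrix the multiset of real roots of the characteristic polynomial
  consists of all eigenvalues, repeated according to multiplicity.
\<close>

definition empirical_eigenvalue_distr :: "real mat \<Rightarrow> real measure" where
  "empirical_eigenvalue_distr A =
     measure_of UNIV (sets borel)
       (\<lambda>B. (\<Sum>x\<in>#proots (char_poly A). emeasure (return borel x) B) / of_nat (dim_row A))"

definition mean_eigenvalue_distr :: "'a measure \<Rightarrow> nat \<Rightarrow> ('a \<Rightarrow> real mat) \<Rightarrow> real measure" where
  "mean_eigenvalue_distr P n A =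
     measure_of UNIV (sets borel)
       (\<lambda>B. (\<integral>\<^sup>+\<omega>. (\<Sum>x\<in>#proots (char_poly (A \<omega>)). emeasure (return borel x) B) \<partial>P) / of_nat n)"

section \<open>Pair partitions\<close>

text \<open>The points \<open>1, \<dots>, 2k\<close> and the unknowns \<open>t\<^sub>1, \<dots>, t\<^sub>2\<^sub>k\<close> are indexed by \<open>{..<2 * k}\<close>.\<close>

definition pair_partitions :: "nat \<Rightarrow> nat set set set" where
  "pair_partitions n = {\<pi>. partition_on {..<n} \<pi> \<and> (\<forall>V\<in>\<pi>. card V = 2)}"

definition partner :: "nat set set \<Rightarrow> nat \<Rightarrow> nat" where
  "partner \<pi> p = (THE q. q \<noteq> p \<and> {p, q} \<in> \<pi>)"

text \<open>
  The two equations of a block \<open>{p, q}\<close> are \<open>t\<^sub>p - t\<^sub>q\<^sub>+\<^sub>1 = 0\<close> and \<open>t\<^sub>q - t\<^sub>p\<^sub>+\<^sub>1 = 0\<close> (indices modulo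
  \<open>2k\<close>), so there is one equation for every point. Column \<open>p\<close> holds the coefficients of the
  equation of the point \<open>p\<close>. The two indicators cancel if the equation is trivial.
\<close>

definition pairing_system :: "nat \<Rightarrow> nat set set \<Rightarrow> real mat" where
  "pairing_system k \<pi> =
     mat (2 * k) (2 * k)
       (\<lambda>(t, p). of_bool (t = p) - of_bool (t = (partner \<pi> p + 1) mod (2 * k)))"

definition pairing_rank :: "nat \<Rightarrow> nat set set \<Rightarrow> nat" where
  "pairing_rank k \<pi> = vec_space.rank (2 * k) (pairing_system k \<pi>)"

section \<open>The limit distribution\<close>

text \<open>
  The exponent \<open>k - 1 - f \<pi>\<close> may be negative, hence the integer power.
\<close>

definition has_limit_moments :: "nat \<Rightarrow> real measure \<Rightarrow> bool" where
  "has_limit_moments m \<gamma> \<longleftrightarrow>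
     (\<forall>n. integrable \<gamma> (\<lambda>x. x ^ n)) \<and>
     (\<forall>n. odd n \<longrightarrow> (\<integral>x. x ^ n \<partial>\<gamma>) = 0) \<and>
     (\<forall>k\<ge>1. (\<integral>x. x ^ (2 * k) \<partial>\<gamma>) =
        (\<Sum>\<pi>\<in>pair_partitions (2 * k). real m powi (int k - 1 - int (pairing_rank k \<pi>))))"

end

theory Submission
  imports Defs "Jordan_Normal_Form.Schur_Decomposition"
begin

text \<open>
  The proof is the method of moments, organised around words. Fix \<open>m\<close> and \<open>n \<ge> 1\<close>. Expanding the trace of
  the \<open>n\<close>-th power of the Toeplitz matrix gives a sum over closed walks on the block indices together
  with labels \<open>j\<close> inside the blocks. The expectation of a term depends only on the labels and on the
  word \<open>s\<close> of the \<open>n\<close> steps of the walk, and each word with step sum zero is realised by at most \<open>N\<close>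
  walks and by at least \<open>N - 2 n b\<^sub>N\<close> of them (\<open>trace_power_block_toeplitz\<close>, \<open>walk_count_le\<close>,
  \<open>walk_count_ge\<close>); as \<open>b\<^sub>N\<close> is \<open>o(N)\<close>, this is \<open>N\<close> up to lower order.

  The entries are centred and independent, so a word contributes only if every absolute value occurs at
  least twice in it. Words in which the letters cancel in opposite pairs have \<open>n div 2\<close> free letters,
  hence there are about \<open>(2 b\<^sub>N)\<close> to the power \<open>n div 2\<close> of them for each pairing; all other contributing
  words satisfy one more coincidence or one more linear relation and are negligible
  (\<open>card_unpaired_words_le\<close>). For a word that follows the pairing \<open>\<pi>\<close>, the expectation is \<open>1\<close> exactly if
  the labels solve the linear system of \<open>\<pi>\<close>, and \<open>0\<close> otherwise (\<open>sum_expectation_paired_word\<close>). That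
  system equates labels along the orbits of a map, so it has \<open>m\<close> to the power \<open>2 k - f(\<pi>)\<close> solutions
  (\<open>rank_of_differences\<close>). After normalisation this is the sum over pairings in the theorem
  (\<open>mean_moment_tendsto\<close>).

  There are at most \<open>2\<^sup>k k!\<close> pairings of \<open>2 k\<close> points, so the limit moments grow slowly enough for the
  Taylor polynomials of the characteristic function to converge to it. Hence the moments determine the
  distribution and convergence of moments implies weak convergence; the limit itself exists because the
  second moments make the sequence tight (\<open>exists_distribution_with_limit_moments\<close>).

  For almost sure convergence a variance bound does not suffice: the variance of an empirical moment is
  of order \<open>1 / b\<^sub>N\<close>, and this need not be summable. A high central moment is small enough. In its
  expansion only tuples of words survive in which each word shares an absolute value with another one,
  and then two of the conditions "the steps add up to zero" are independent linear relations between
  the free letters (\<open>card_linked_words_le\<close>). This gives \<open>O(1 / b\<^sub>N\<^sup>2)\<close>, which is summable if \<open>b\<^sub>N\<close> grows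
  faster than \<open>N\<close> to a power larger than \<open>1/2\<close>. The twelfth central moment is used because with twelve
  words the two relations can be exhibited by counting alone.
\<close>

section \<open>The method of moments\<close>

text \<open>
  A Taylor polynomial of even order approximates a characteristic function up to a multiple of the moment
  of that order. The polynomials converge because their coefficients are moments, and by the growth
  condition the remainders are small for the limit and thus eventually for the sequence. Levy's continuity theorem then applies.
\<close>

lemma moment_convergence_imp_weak_conv:
  fixes \<mu> :: "nat \<Rightarrow> real measure"
  assumes \<mu>: "\<And>N. real_distribution (\<mu> N)" and \<gamma>: "real_distribution \<gamma>"
    and int: "\<And>N n. integrable (\<mu> N) (\<lambda>x. x ^ n)" "\<And>n. integrable \<gamma> (\<lambda>x. x ^ n)"
    and conv: "\<And>n. (\<lambda>N. \<integral>x. x ^ n \<partial>\<mu> N) \<longlonglongrightarrow> (\<integral>x. x ^ n \<partial>\<gamma>)"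
    and growth: "\<And>t::real. (\<lambda>k. t ^ (2 * k) / fact (2 * k) * (\<integral>x. x ^ (2 * k) \<partial>\<gamma>)) \<longlonglongrightarrow> 0"
  shows "weak_conv_m \<mu> \<gamma>"
proof (rule levy_continuity[OF \<mu> \<gamma>])
  fix t :: real
  define S :: "real measure \<Rightarrow> nat \<Rightarrow> complex"
    where "S M k = (\<Sum>j \<le> 2*k. ((\<i> * t)^j / fact j) * of_real (\<integral>x. x ^ j \<partial>M))" for M k
  define R where "R M k = 2 * (t ^ (2*k) / fact (2*k) * (\<integral>x. x ^ (2*k) \<partial>M))" for M k
  have apx: "cmod (char M t - S M k) \<le> R M k"
    if "real_distribution M" "\<And>n. integrable M (\<lambda>x. x ^ n)" for M k
    using real_distribution.char_approx1[OF that(1), of "2*k" t] that(2)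
    by (simp add: S_def R_def power_even_abs)
  show "(\<lambda>N. char (\<mu> N) t) \<longlonglongrightarrow> char \<gamma> t"
  proof (rule tendstoI)
    fix e :: real assume e: "e > 0"
    have "(\<lambda>k. R \<gamma> k) \<longlonglongrightarrow> 2 * 0"
      unfolding R_def by (intro tendsto_mult growth tendsto_const)
    hence "\<forall>\<^sub>F k in sequentially. R \<gamma> k < e / 4"
      by (rule order_tendstoD) (use e in auto)
    then obtain k where k: "R \<gamma> k < e / 4" by (auto simp: eventually_sequentially)
    have "(\<lambda>N. R (\<mu> N) k) \<longlonglongrightarrow> R \<gamma> k"
      unfolding R_def by (intro tendsto_intros conv)
    hence ev1: "\<forall>\<^sub>F N in sequentially. R (\<mu> N) k < e / 4"
      using k by (rule order_tendstoD)
    have "(\<lambda>N. S (\<mu> N) k) \<longlonglongrightarrow> S \<gamma> k"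
      unfolding S_def by (intro tendsto_intros tendsto_of_real conv)
    hence ev2: "\<forall>\<^sub>F N in sequentially. dist (S (\<mu> N) k) (S \<gamma> k) < e / 4"
      by (rule tendstoD) (use e in auto)
    show "\<forall>\<^sub>F N in sequentially. dist (char (\<mu> N) t) (char \<gamma> t) < e"
      using ev1 ev2
    proof eventually_elim
      case (elim N)
      have "dist (char (\<mu> N) t) (char \<gamma> t) \<le> dist (char (\<mu> N) t) (S (\<mu> N) k)
          + (dist (S (\<mu> N) k) (S \<gamma> k) + dist (char \<gamma> t) (S \<gamma> k))"
        by (metis dist_commute dist_triangle add_left_mono order_trans)
      moreover have "dist (char (\<mu> N) t) (S (\<mu> N) k) < e / 4"
        using apx[OF \<mu> int(1), of N k] elim(1) by (simp add: dist_norm)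
      moreover have "dist (char \<gamma> t) (S \<gamma> k) < e / 4"
        using apx[OF \<gamma> int(2), of k] k by (simp add: dist_norm)
      ultimately show ?case using elim(2) e by linarith
    qed
  qed
qed

text \<open>
  The constant sequence \<open>\<nu>\<close> has convergent moments, so it converges weakly to \<open>\<gamma>\<close>.
\<close>

lemma moments_determine_distribution:
  assumes \<gamma>: "real_distribution \<gamma>" and \<nu>: "real_distribution \<nu>"
    and int: "\<And>n. integrable \<gamma> (\<lambda>x. x ^ n)" "\<And>n. integrable \<nu> (\<lambda>x. x ^ n)"
    and eq: "\<And>n. (\<integral>x. x ^ n \<partial>\<gamma>) = (\<integral>x. x ^ n \<partial>\<nu>)"
    and growth: "\<And>t::real. (\<lambda>k. t ^ (2 * k) / fact (2 * k) * (\<integral>x. x ^ (2 * k) \<partial>\<gamma>)) \<longlonglongrightarrow> 0"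
  shows "\<nu> = \<gamma>"
proof (rule Levy_uniqueness[OF \<nu> \<gamma>], rule ext)
  fix t
  have "weak_conv_m (\<lambda>_. \<nu>) \<gamma>"
    by (rule moment_convergence_imp_weak_conv[OF \<nu> \<gamma> int(2,1) _ growth]) (simp add: eq)
  from levy_continuity1[OF \<nu> \<gamma> this, of t] show "char \<nu> t = char \<gamma> t" by (simp add: LIMSEQ_const_iff)
qed

lemma two_abs_power_le:
  fixes x :: real
  shows "2 * \<bar>x ^ k\<bar> \<le> 1 + x ^ (2 * k)"
proof -
  have "0 \<le> (\<bar>x ^ k\<bar> - 1)\<^sup>2" by simp
  thus ?thesis by (simp add: power2_diff power_mult[symmetric] mult.commute)
qed

text \<open>
  Truncation changes a power only where \<open>\<bar>x\<bar> > R\<close>, and there the power is dominated by a higher one.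
\<close>

lemma abs_power_clamp_diff_le:
  fixes x R :: real
  assumes R: "R \<ge> 1"
  shows "\<bar>x ^ n - (max (- R) (min R x)) ^ n\<bar> \<le> x ^ (2 * n) / R ^ n"
proof (cases "\<bar>x\<bar> \<le> R")
  case True
  hence "max (- R) (min R x) = x" using R by auto
  thus ?thesis using R by simp
next
  case False
  define c where "c = R / \<bar>x\<bar>"
  have c: "0 \<le> c" "c \<le> 1" "max (- R) (min R x) = c * x"
    using False R by (auto simp: c_def abs_if max_def min_def field_simps split: if_splits)
  have "0 \<le> c ^ n" "c ^ n \<le> 1" using c by (auto simp: power_le_one)
  hence "\<bar>1 - c ^ n\<bar> \<le> 1" by auto
  hence "\<bar>x ^ n\<bar> * \<bar>1 - c ^ n\<bar> \<le> \<bar>x\<bar> ^ n * 1"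
    by (intro mult_mono) (auto simp: power_abs)
  moreover have "\<bar>x ^ n - (max (- R) (min R x)) ^ n\<bar> = \<bar>x ^ n\<bar> * \<bar>1 - c ^ n\<bar>"
    unfolding c(3) abs_mult[symmetric] by (simp add: algebra_simps power_mult_distrib)
  moreover have "\<bar>x\<bar> ^ n \<le> x ^ (2 * n) / R ^ n"
  proof -
    have "R ^ n * \<bar>x\<bar> ^ n \<le> \<bar>x\<bar> ^ n * \<bar>x\<bar> ^ n"
      using False R by (intro mult_right_mono power_mono) auto
    also have "\<dots> = x ^ (2 * n)" by (simp add: power_mult_distrib[symmetric] power_mult power2_eq_square)
    finally show ?thesis using R by (simp add: field_simps)
  qed
  ultimately show ?thesis by linarith
qed

text \<open>
  Powers are unbounded, so weak convergence does not give convergence of moments directly. It does for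
  the truncated powers, and the error of the truncation is bounded, uniformly in the sequence, by an even
  moment divided by a power of the truncation level. Integrability for the limit comes from monotone
  convergence of the truncated even powers.
\<close>

lemma weak_limit_moments:
  fixes \<mu> :: "nat \<Rightarrow> real measure"
  assumes \<mu>: "\<And>N. real_distribution (\<mu> N)" and \<gamma>: "real_distribution \<gamma>"
    and int: "\<And>N n. integrable (\<mu> N) (\<lambda>x. x ^ n)"
    and conv: "\<And>n. (\<lambda>N. \<integral>x. x ^ n \<partial>\<mu> N) \<longlonglongrightarrow> M n"
    and wc: "weak_conv_m \<mu> \<gamma>"
  shows "integrable \<gamma> (\<lambda>x. x ^ n)" "(\<integral>x. x ^ n \<partial>\<gamma>) = M n"
proof -
  interpret \<gamma>: real_distribution \<gamma> by (rule \<gamma>)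
  interpret \<mu>: real_distribution "\<mu> N" for N by (rule \<mu>)
  define g where "g R x = max (- R) (min R x)" for R x :: real
  have g_le: "\<bar>g R x\<bar> \<le> R" if "R \<ge> 0" for R x using that by (auto simp: g_def)
  have g_bd: "\<bar>g R x ^ n\<bar> \<le> R ^ n" if "R \<ge> 0" for R x n
    using g_le[OF that, of x] by (simp add: power_abs power_mono)
  have g_cont: "isCont (\<lambda>x. g R x ^ n) x" for R x n unfolding g_def by (intro continuous_intros)
  have [measurable]: "g R \<in> borel_measurable borel" for R unfolding g_def by measurable
  have lim: "(\<lambda>N. \<integral>x. g R x ^ n \<partial>\<mu> N) \<longlonglongrightarrow> (\<integral>x. g R x ^ n \<partial>\<gamma>)" if "R \<ge> 0" for R n
    using g_bd[OF that] by (intro weak_conv_imp_integral_bdd_continuous_conv[OF \<mu> \<gamma> wc g_cont]) auto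
  have intg: "integrable \<gamma> (\<lambda>x. g R x ^ n)" "integrable (\<mu> N) (\<lambda>x. g R x ^ n)" if "R \<ge> 0" for R N n
    using g_bd[OF that]
    by (intro \<gamma>.integrable_const_bound[where B="R^n"] \<mu>.integrable_const_bound[where B="R^n"], auto)+
  \<comment> \<open>For even exponents truncation decreases the power, so the bound survives the limit.\<close>
  have even_le: "(\<integral>x. g R x ^ (2 * n) \<partial>\<gamma>) \<le> M (2 * n)" if R: "R \<ge> 0" for R n
  proof (rule LIMSEQ_le[OF lim[OF R] conv])
    have "(\<integral>x. g R x ^ (2 * n) \<partial>\<mu> N) \<le> (\<integral>x. x ^ (2 * n) \<partial>\<mu> N)" for N
    proof (rule integral_mono[OF intg(2)[OF R] int])
      fix x
      have "\<bar>g R x\<bar> \<le> \<bar>x\<bar>" using R by (auto simp: g_def)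
      hence "\<bar>g R x\<bar> ^ (2*n) \<le> \<bar>x\<bar> ^ (2*n)" by (intro power_mono) auto
      thus "g R x ^ (2 * n) \<le> x ^ (2 * n)" by (simp add: power_even_abs)
    qed
    thus "\<exists>N. \<forall>k\<ge>N. (\<integral>x. g R x ^ (2 * n) \<partial>\<mu> k) \<le> (\<integral>x. x ^ (2 * n) \<partial>\<mu> k)" by blast
  qed
  have even: "integrable \<gamma> (\<lambda>x. x ^ (2 * n))" "(\<integral>x. x ^ (2 * n) \<partial>\<gamma>) \<le> M (2 * n)" for n
  proof -
    have gm: "(g (real i) x) ^ (2*n) \<le> (g (real j) x) ^ (2*n)" if "i \<le> j" for i j x
    proof -
      have "\<bar>g (real i) x\<bar> \<le> \<bar>g (real j) x\<bar>" using that by (auto simp: g_def)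
      hence "\<bar>g (real i) x\<bar> ^ (2*n) \<le> \<bar>g (real j) x\<bar> ^ (2*n)" by (intro power_mono) auto
      thus ?thesis by (simp add: power_even_abs)
    qed
    have gl: "(\<lambda>i. (g (real i) x) ^ (2*n)) \<longlonglongrightarrow> x ^ (2 * n)" for x
    proof (rule tendsto_eventually)
      obtain i0 :: nat where i0: "\<bar>x\<bar> \<le> real i0" using real_arch_simple by blast
      have "g (real i) x = x" if "i \<ge> i0" for i using that i0 by (auto simp: g_def)
      thus "\<forall>\<^sub>F i in sequentially. g (real i) x ^ (2 * n) = x ^ (2 * n)"
        by (auto simp: eventually_sequentially intro!: exI[of _ i0])
    qed
    have inc: "incseq (\<lambda>i. \<integral>x. (g (real i) x) ^ (2*n) \<partial>\<gamma>)"
      by (intro incseq_SucI integral_mono intg gm) auto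
    have ub: "\<forall>i. (\<integral>x. (g (real i) x) ^ (2*n) \<partial>\<gamma>) \<le> M (2 * n)" by (simp add: even_le)
    obtain L where L: "(\<lambda>i. \<integral>x. (g (real i) x) ^ (2*n) \<partial>\<gamma>) \<longlonglongrightarrow> L"
      using incseq_convergent[OF inc ub] by blast
    have "L \<le> M (2*n)" by (rule LIMSEQ_le_const2[OF L]) (use even_le in auto)
    moreover have "has_bochner_integral \<gamma> (\<lambda>x. x ^ (2 * n)) L"
      by (rule has_bochner_integral_monotone_convergence[OF _ _ _ L])
         (auto intro!: intg AE_I2 gl monoI gm)
    ultimately show "integrable \<gamma> (\<lambda>x. x ^ (2 * n))" "(\<integral>x. x ^ (2 * n) \<partial>\<gamma>) \<le> M (2 * n)"
      by (auto simp: has_bochner_integral_iff)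
  qed
  show int\<gamma>: "integrable \<gamma> (\<lambda>x. x ^ n)" for n
  proof (rule Bochner_Integration.integrable_bound)
    show "integrable \<gamma> (\<lambda>x. 1 + x ^ (2 * n))" using even(1)[of n] by simp
    show "AE x in \<gamma>. norm (x ^ n) \<le> norm (1 + x ^ (2 * n))"
    proof (rule AE_I2)
      fix x :: real
      show "norm (x ^ n) \<le> norm (1 + x ^ (2 * n))" using two_abs_power_le[of x n] by simp
    qed
  qed simp
  show "(\<integral>x. x ^ n \<partial>\<gamma>) = M n"
  proof (cases "n = 0")
    case True
    have "(\<lambda>N. 1 :: real) \<longlonglongrightarrow> M 0" using conv[of 0] \<mu>.prob_space by simp
    thus ?thesis using True \<gamma>.prob_space by (simp add: LIMSEQ_const_iff)
  next
    case False
    have tail: "\<bar>(\<integral>x. x ^ n \<partial>Q) - (\<integral>x. g R x ^ n \<partial>Q)\<bar> \<le> (\<integral>x. x ^ (2 * n) \<partial>Q) / R ^ n"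
      if i: "\<And>n. integrable Q (\<lambda>x. x ^ n)" "integrable Q (\<lambda>x. g R x ^ n)" and R: "R \<ge> 1" for Q R
    proof -
      have "\<bar>(\<integral>x. x ^ n \<partial>Q) - (\<integral>x. g R x ^ n \<partial>Q)\<bar> = \<bar>\<integral>x. x ^ n - g R x ^ n \<partial>Q\<bar>"
        using i by simp
      also have "\<dots> \<le> (\<integral>x. \<bar>x ^ n - g R x ^ n\<bar> \<partial>Q)" by (rule integral_abs_bound)
      also have "\<dots> \<le> (\<integral>x. x ^ (2 * n) / R ^ n \<partial>Q)"
        using i abs_power_clamp_diff_le[OF R] unfolding g_def by (intro integral_mono) auto
      finally show ?thesis by simp
    qed
    have close: "\<bar>(\<integral>x. x ^ n \<partial>\<gamma>) - M n\<bar> \<le> 2 * M (2 * n) / R ^ n" if R: "R \<ge> 1" for R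
    proof -
      have "(\<lambda>N. \<bar>(\<integral>x. x ^ n \<partial>\<mu> N) - (\<integral>x. g R x ^ n \<partial>\<mu> N)\<bar>) \<longlonglongrightarrow> \<bar>M n - (\<integral>x. g R x ^ n \<partial>\<gamma>)\<bar>"
        using R by (intro tendsto_intros conv lim) auto
      moreover have "(\<lambda>N. (\<integral>x. x ^ (2 * n) \<partial>\<mu> N) / R ^ n) \<longlonglongrightarrow> M (2 * n) / R ^ n"
        using R by (intro tendsto_intros conv) auto
      ultimately have 1: "\<bar>M n - (\<integral>x. g R x ^ n \<partial>\<gamma>)\<bar> \<le> M (2 * n) / R ^ n"
        by (rule LIMSEQ_le) (use tail[OF int] intg R in auto)
      have "\<bar>(\<integral>x. x ^ n \<partial>\<gamma>) - (\<integral>x. g R x ^ n \<partial>\<gamma>)\<bar> \<le> (\<integral>x. x ^ (2 * n) \<partial>\<gamma>) / R ^ n"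
        using R intg by (intro tail int\<gamma>) auto
      also have "\<dots> \<le> M (2 * n) / R ^ n" using even(2)[of n] R by (simp add: divide_right_mono)
      finally show ?thesis using 1 by linarith
    qed
    have "(\<lambda>j. 2 * M (2 * n) / real (Suc j) ^ n) \<longlonglongrightarrow> 0"
    proof (rule tendsto_divide_0[OF tendsto_const filterlim_at_top_imp_at_infinity])
      show "LIM j sequentially. real (Suc j) ^ n :> at_top"
        using False
        by (intro filterlim_pow_at_top filterlim_compose[OF filterlim_real_sequentially filterlim_Suc]) simp
    qed
    hence "\<bar>(\<integral>x. x ^ n \<partial>\<gamma>) - M n\<bar> \<le> 0"
      by (rule LIMSEQ_le_const) (use close in \<open>auto simp del: of_nat_Suc\<close>)
    thus ?thesis by simp
  qed
qed

text \<open>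
  Bounded second moments make the sequence tight; the moments of any subsequential weak limit are the
  limits of the moments.
\<close>

lemma exists_distribution_with_limit_moments:
  fixes \<mu> :: "nat \<Rightarrow> real measure"
  assumes \<mu>: "\<And>N. real_distribution (\<mu> N)"
    and int: "\<And>N n. integrable (\<mu> N) (\<lambda>x. x ^ n)"
    and conv: "\<And>n. (\<lambda>N. \<integral>x. x ^ n \<partial>\<mu> N) \<longlonglongrightarrow> M n"
  shows "\<exists>\<gamma>. real_distribution \<gamma> \<and> (\<forall>n. integrable \<gamma> (\<lambda>x. x ^ n) \<and> (\<integral>x. x ^ n \<partial>\<gamma>) = M n)"
proof -
  interpret \<mu>: real_distribution "\<mu> N" for N by (rule \<mu>)
  have "Bseq (\<lambda>N. \<integral>x. x ^ 2 \<partial>\<mu> N)" using conv convergent_def by (intro convergent_imp_Bseq) blast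
  then obtain K where K: "K > 0" "\<And>N. norm (\<integral>x. x ^ 2 \<partial>\<mu> N) \<le> K" by (auto simp: Bseq_def)
  have "tight \<mu>"
    unfolding tight_def
  proof (intro conjI allI impI \<mu>)
    fix e :: real assume e: "e > 0"
    \<comment> \<open>Chebyshev: the mass outside \<open>[-R, R]\<close> is at most \<open>K / R\<^sup>2 < e\<close>.\<close>
    define R where "R = sqrt (K / e) + 1"
    have R: "R > 0" "R\<^sup>2 > K / e"
      using K(1) e by (auto simp: R_def power2_sum add_pos_nonneg intro!: add_nonneg_pos)
    have "measure (\<mu> N) {- R<..R} > 1 - e" for N
    proof -
      have "measure (\<mu> N) {x \<in> space (\<mu> N). R\<^sup>2 \<le> x ^ 2} \<le> (\<integral>x. x ^ 2 \<partial>\<mu> N) / R\<^sup>2"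
        using R int by (intro integral_Markov_inequality_measure[of _ _ "{}"]) auto
      also have "\<dots> \<le> K / R\<^sup>2" using K(2)[of N] R by (intro divide_right_mono) auto
      also have "\<dots> < e" using R e by (simp add: field_simps)
      finally have 1: "measure (\<mu> N) {x. R\<^sup>2 \<le> x ^ 2} < e" by simp
      have "1 = measure (\<mu> N) UNIV" using \<mu>.prob_space by simp
      also have "\<dots> \<le> measure (\<mu> N) ({- R<..R} \<union> {x. R\<^sup>2 \<le> x ^ 2})"
      proof (intro \<mu>.finite_measure_mono)
        have "R\<^sup>2 \<le> x\<^sup>2" if "\<not> (- R < x \<and> x \<le> R)" for x :: real
        proof -
          have "\<bar>R\<bar> \<le> \<bar>x\<bar>" using that R by auto
          thus ?thesis by (simp only: abs_le_square_iff)
        qed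
        thus "UNIV \<subseteq> {- R<..R} \<union> {x. R\<^sup>2 \<le> x\<^sup>2}" by force
      qed auto
      also have "\<dots> \<le> measure (\<mu> N) {- R<..R} + measure (\<mu> N) {x. R\<^sup>2 \<le> x ^ 2}"
        by (rule measure_Un_le) auto
      finally show ?thesis using 1 by linarith
    qed
    thus "\<exists>a b. a < b \<and> (\<forall>n. measure (\<mu> n) {a<..b} > 1 - e)"
      using R by (intro exI[of _ "-R"] exI[of _ R]) auto
  qed
  from tight_imp_convergent_subsubsequence[OF this strict_mono_id] obtain r \<gamma> where
    r: "strict_mono (r :: nat \<Rightarrow> nat)" "real_distribution \<gamma>" "weak_conv_m (\<mu> \<circ> r) \<gamma>" by auto
  have conv': "(\<lambda>N. \<integral>x. x ^ n \<partial>(\<mu> \<circ> r) N) \<longlonglongrightarrow> M n" for n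
    using LIMSEQ_subseq_LIMSEQ[OF conv r(1)] by (simp add: o_def)
  show ?thesis
    using weak_limit_moments[OF _ r(2) _ conv' r(3)] \<mu> int r(2) by auto
qed

section \<open>Eigenvalues and traces\<close>

definition trace_power :: "nat \<Rightarrow> real mat \<Rightarrow> real" where
  "trace_power k A = (\<Sum>i<dim_row A. (A ^\<^sub>m k) $$ (i, i))"

text \<open>
  The complex roots are real: for an eigenvector \<open>v\<close> the number \<open>S = \<Sum> A\<^sub>i\<^sub>j v\<^sub>j cnj v\<^sub>i\<close> equals its own
  conjugate by symmetry, and it is the eigenvalue times the positive number \<open>q = \<Sum> \<bar>v\<^sub>i\<bar>\<^sup>2\<close>.
\<close>

lemma symmetric_char_poly_splits:
  fixes A :: "real mat"
  assumes A: "A \<in> carrier_mat n n"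
    and sym: "\<And>i j. i < n \<Longrightarrow> j < n \<Longrightarrow> A $$ (i, j) = A $$ (j, i)"
  shows "\<exists>es. length es = n \<and> char_poly A = (\<Prod>e\<leftarrow>es. [:- e, 1:])"
proof -
  define C where "C = map_mat complex_of_real A"
  have C: "C \<in> carrier_mat n n" using A by (simp add: C_def)
  obtain as where as: "char_poly C = (\<Prod>a\<leftarrow>as. [:- a, 1:])" "length as = n"
    using char_poly_factorized[OF C] by blast
  have hom: "char_poly C = map_poly complex_of_real (char_poly A)"
    unfolding C_def by (rule of_real_hom.char_poly_hom[OF A])
  have real: "a = complex_of_real (Re a)" if a: "a \<in> set as" for a
  proof -
    have "poly (char_poly C) a = 0" unfolding as(1) using a by (induction as) auto
    then obtain v where v: "v \<in> carrier_vec n" "v \<noteq> 0\<^sub>v n" "C *\<^sub>v v = a \<cdot>\<^sub>v v"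
      using C by (auto simp: eigenvalue_root_char_poly[OF C, symmetric] eigenvalue_def eigenvector_def)
    define S where "S = (\<Sum>i<n. \<Sum>j<n. complex_of_real (A $$ (i,j)) * (v $ j * cnj (v $ i)))"
    define q where "q = (\<Sum>i<n. (cmod (v $ i))\<^sup>2)"
    have ent: "(\<Sum>j<n. complex_of_real (A $$ (i,j)) * v $ j) = a * v $ i" if i: "i < n" for i
    proof -
      have "(C *\<^sub>v v) $ i = (\<Sum>j<n. complex_of_real (A $$ (i,j)) * v $ j)"
        using i C A v(1) by (auto simp: C_def scalar_prod_def atLeast0LessThan intro!: sum.cong)
      thus ?thesis using v i by simp
    qed
    have "S = (\<Sum>i<n. (\<Sum>j<n. complex_of_real (A $$ (i,j)) * v $ j) * cnj (v $ i))"
      by (simp add: S_def sum_distrib_right mult.assoc)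
    also have "\<dots> = (\<Sum>i<n. a * (v $ i * cnj (v $ i)))"
      by (intro sum.cong) (auto simp: ent)
    also have "\<dots> = a * complex_of_real q"
      by (simp only: sum_distrib_left[symmetric] complex_norm_square[symmetric] q_def of_real_sum)
    finally have S1: "S = a * complex_of_real q" .
    have "cnj S = (\<Sum>i<n. \<Sum>j<n. complex_of_real (A $$ (j,i)) * (v $ i * cnj (v $ j)))"
      by (auto simp: S_def mult.commute sym intro!: sum.cong)
    also have "\<dots> = S" unfolding S_def by (rule sum.swap)
    finally have "cnj S = S" .
    hence 1: "(cnj a - a) * complex_of_real q = 0" by (simp add: S1 algebra_simps)
    obtain i where i: "i < n" "v $ i \<noteq> 0" using v(1,2) by (metis eq_vecI carrier_vecD index_zero_vec)
    have "q > 0" unfolding q_def using i by (intro sum_pos2[of _ i]) auto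
    with 1 have "cnj a = a" by simp
    thus ?thesis by (metis Reals_cnj_iff of_real_Re)
  qed
  interpret h: map_poly_inj_idom_hom complex_of_real ..
  have "map_poly complex_of_real (\<Prod>e\<leftarrow>map Re as. [:- e, 1:]) = (\<Prod>a\<leftarrow>as. [:- a, 1:])"
    using real
  proof (induction as)
    case (Cons a as)
    have "map_poly complex_of_real ([:- Re a, 1:] * (\<Prod>e\<leftarrow>map Re as. [:- e, 1:])) =
        map_poly complex_of_real [:- Re a, 1:] * map_poly complex_of_real (\<Prod>e\<leftarrow>map Re as. [:- e, 1:])"
      by (rule h.hom_mult)
    moreover have "map_poly complex_of_real [:- Re a, 1:] = [:- a, 1:]"
      using Cons.prems[of a] by (simp add: map_poly_pCons)
    ultimately show ?case using Cons by simp
  qed simp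
  hence "map_poly complex_of_real (\<Prod>e\<leftarrow>map Re as. [:- e, 1:]) = map_poly complex_of_real (char_poly A)"
    using as hom by simp
  hence "char_poly A = (\<Prod>e\<leftarrow>map Re as. [:- e, 1:])"
    by (simp only: h.eq_iff)
  thus ?thesis using as(2) by (intro exI[of _ "map Re as"]) simp
qed

lemma trace_mult_commute:
  fixes X Y :: "real mat"
  assumes "X \<in> carrier_mat n n" "Y \<in> carrier_mat n n"
  shows "(\<Sum>i<n. (X * Y) $$ (i, i)) = (\<Sum>i<n. (Y * X) $$ (i, i))"
proof -
  have "(\<Sum>i<n. (X * Y) $$ (i, i)) = (\<Sum>i<n. \<Sum>j<n. X $$ (i, j) * Y $$ (j, i))"
    using assms by (auto simp: scalar_prod_def atLeast0LessThan intro!: sum.cong)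
  also have "\<dots> = (\<Sum>j<n. \<Sum>i<n. X $$ (i, j) * Y $$ (j, i))" by (rule sum.swap)
  also have "\<dots> = (\<Sum>i<n. (Y * X) $$ (i, i))"
    using assms by (auto simp: scalar_prod_def atLeast0LessThan mult.commute intro!: sum.cong)
  finally show ?thesis .
qed

text \<open>
  As the characteristic polynomial splits, the matrix is similar to a triangular one with the eigenvalues
  on the diagonal; powers of a triangular matrix have the powers of its diagonal entries on the diagonal,
  and the trace is invariant under similarity.
\<close>

lemma trace_power_eq_sum_eigenvalues:
  fixes A :: "real mat"
  assumes A: "A \<in> carrier_mat n n" and es: "length es = n" "char_poly A = (\<Prod>e\<leftarrow>es. [:- e, 1:])"
  shows "trace_power k A = (\<Sum>i<n. (es ! i) ^ k)"
proof -
  obtain B P Q where BPQ: "schur_decomposition A es = (B, P, Q)" by (metis prod_cases3)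
  from schur_decomposition[OF A es(2) BPQ]
  have sim: "similar_mat_wit A B P Q" and ut: "upper_triangular B" and dB: "diag_mat B = es" by auto
  from similar_mat_witD2[OF A sim]
  have car: "B \<in> carrier_mat n n" "P \<in> carrier_mat n n" "Q \<in> carrier_mat n n"
    and QP: "Q * P = 1\<^sub>m n" by auto
  have diag: "B $$ (i, i) = es ! i" if "i < n" for i
    using that car dB by (auto simp: diag_mat_def)
  have Bk: "(B ^\<^sub>m k) $$ (i, i) = (es ! i) ^ k \<and> (\<forall>j<i. (B ^\<^sub>m k) $$ (i, j) = 0)" if "i < n" for i
    using that
  proof (induction k arbitrary: i)
    case 0
    thus ?case using car by auto
  next
    case (Suc k)
    have ent: "(B ^\<^sub>m Suc k) $$ (i, j) = (\<Sum>l<n. (B ^\<^sub>m k) $$ (i, l) * B $$ (l, j))" if "j < n" for j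
      using Suc.prems that car by (simp add: scalar_prod_def atLeast0LessThan)
    have z: "(B ^\<^sub>m k) $$ (i, l) * B $$ (l, j) = 0" if "l < n" "j \<le> i" "l \<noteq> i" for l j
    proof (cases "l < i")
      case True
      thus ?thesis using Suc.IH[OF Suc.prems] by simp
    next
      case False
      hence "B $$ (l, j) = 0" using ut that car by (auto intro: upper_triangularD)
      thus ?thesis by simp
    qed
    have ent': "(B ^\<^sub>m Suc k) $$ (i, j) = (B ^\<^sub>m k) $$ (i, i) * B $$ (i, j)" if "j \<le> i" for j
    proof -
      have "(B ^\<^sub>m Suc k) $$ (i, j) = (\<Sum>l<n. (B ^\<^sub>m k) $$ (i, l) * B $$ (l, j))"
        using that Suc.prems by (intro ent) simp
      also have "\<dots> = (\<Sum>l\<in>{i}. (B ^\<^sub>m k) $$ (i, l) * B $$ (l, j))"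
        using Suc.prems that z by (intro sum.mono_neutral_right) auto
      finally show ?thesis by simp
    qed
    have "B $$ (i, j) = 0" if "j < i" for j using ut that Suc.prems car by (auto intro: upper_triangularD)
    thus ?case using ent' Suc.IH[OF Suc.prems] Suc.prems by (auto simp: diag mult.commute)
  qed
  have "trace_power k A = (\<Sum>i<n. (P * (B ^\<^sub>m k) * Q) $$ (i, i))"
    using A by (simp add: trace_power_def similar_mat_wit_pow_id[OF sim])
  also have "\<dots> = (\<Sum>i<n. (Q * (P * (B ^\<^sub>m k))) $$ (i, i))"
    using car by (intro trace_mult_commute) auto
  also have "Q * (P * (B ^\<^sub>m k)) = (Q * P) * (B ^\<^sub>m k)"
    using car by (intro assoc_mult_mat[symmetric, of Q n n P n "B ^\<^sub>m k" n]) auto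
  also have "\<dots> = B ^\<^sub>m k" unfolding QP using car by (intro left_mult_one_mat[of _ n n]) auto
  also have "(\<Sum>i<n. (B ^\<^sub>m k) $$ (i, i)) = (\<Sum>i<n. (es ! i) ^ k)" using Bk by simp
  finally show ?thesis .
qed

section \<open>Eigenvalue distributions as probability measures\<close>

text \<open>
  The defining set function of the empirical distribution is the law of an eigenvalue chosen uniformly
  at random from a list of all eigenvalues; this shows that it is a probability measure and gives its
  moments.
\<close>

lemma symmetric_eigenvalue_distr:
  fixes A :: "real mat"
  assumes A: "A \<in> carrier_mat n n" and n: "n > 0"
    and sym: "\<And>i j. i < n \<Longrightarrow> j < n \<Longrightarrow> A $$ (i, j) = A $$ (j, i)"
  shows "real_distribution (empirical_eigenvalue_distr A)" (is ?A)
    and "B \<in> sets borel \<Longrightarrow> emeasure (empirical_eigenvalue_distr A) B =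
           (\<Sum>x\<in>#proots (char_poly A). emeasure (return borel x) B) / of_nat n" (is "_ \<Longrightarrow> ?B")
    and "integrable (empirical_eigenvalue_distr A) (\<lambda>x. x ^ k)" (is ?C)
    and "(\<integral>x. x ^ k \<partial>empirical_eigenvalue_distr A) = trace_power k A / n" (is ?D)
    and "\<exists>es. length es = n \<and> (\<forall>k. trace_power k A = (\<Sum>i<n. (es ! i) ^ k)) \<and>
           (\<forall>B\<in>sets borel. emeasure (empirical_eigenvalue_distr A) B = ennreal ((\<Sum>i<n. indicator B (es ! i)) / n))" (is ?E)
proof -
  obtain es where es: "length es = n" "char_poly A = (\<Prod>e\<leftarrow>es. [:- e, 1:])"
    using symmetric_char_poly_splits[OF A sym] by blast
  have pr: "proots (char_poly A) = mset es"
    unfolding es(2)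
  proof (induction es)
    case (Cons e es)
    have "proots ([:- e, 1:] * (\<Prod>e\<leftarrow>es. [:- e, 1:])) = proots [:- e, 1:] + proots (\<Prod>e\<leftarrow>es. [:- e, 1:])"
      by (intro proots_mult) (auto simp: prod_list_zero_iff)
    thus ?case using Cons.IH by simp
  qed simp
  define p where "p = pmf_of_set {..<n}"
  define M where "M = distr (measure_pmf p) borel (\<lambda>i. es ! i)"
  have ne: "{..<n} \<noteq> {}" using n by auto
  have sum_eq: "(\<Sum>x\<in>#mset es. f x) = (\<Sum>i<n. f (es ! i))" for f :: "real \<Rightarrow> ennreal"
  proof -
    have "(\<Sum>x\<in>#mset es. f x) = sum_list (map f es)" by (simp flip: mset_map add: sum_mset_sum_list)
    thus ?thesis using es(1) by (simp add: sum_list_sum_nth atLeast0LessThan)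
  qed
  have em: "emeasure M B = (\<Sum>x\<in>#proots (char_poly A). emeasure (return borel x) B) / of_nat n"
    if B: "B \<in> sets borel" for B
  proof -
    have "emeasure M B = emeasure (measure_pmf p) ((!) es -` B)"
      unfolding M_def using B by (simp add: emeasure_distr)
    also have "\<dots> = (\<integral>\<^sup>+i. indicator ((!) es -` B) i \<partial>measure_pmf p)" by simp
    also have "\<dots> = (\<integral>\<^sup>+i. indicator B (es ! i) \<partial>measure_pmf p)"
      by (rule nn_integral_cong) (simp add: indicator_def)
    also have "\<dots> = (\<Sum>i<n. indicator B (es ! i)) / of_nat n"
      unfolding p_def using ne by (subst nn_integral_pmf_of_set) auto
    finally show ?thesis using B by (simp add: pr sum_eq)
  qed
  have eq: "empirical_eigenvalue_distr A = M"
  proof -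
    have "empirical_eigenvalue_distr A = measure_of (space M) (sets M) (emeasure M)"
      unfolding empirical_eigenvalue_distr_def using em A
      by (simp add: M_def[THEN arg_cong[of _ _ space]] M_def[THEN arg_cong[of _ _ sets]])
         (intro measure_of_eq, auto simp: sets.sigma_sets_eq[of borel, simplified])
    thus ?thesis by (simp add: measure_of_of_measure)
  qed
  show ?A unfolding eq M_def real_distribution_def real_distribution_axioms_def
    by (auto intro!: prob_space.prob_space_distr measure_pmf.prob_space_axioms)
  show ?B if "B \<in> sets borel" using em[OF that] by (simp add: eq)
  show ?C unfolding eq M_def p_def
    by (subst integrable_distr_eq) (auto intro!: integrable_measure_pmf_finite simp: set_pmf_of_set[OF ne])
  have int: "(\<integral>x. f x \<partial>M) = (\<Sum>i<n. f (es ! i)) / n" if "f \<in> borel_measurable borel" for f :: "real \<Rightarrow> real"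
    unfolding M_def p_def using that ne by (subst integral_distr) (auto simp: integral_pmf_of_set)
  have tr: "trace_power k A = (\<Sum>i<n. (es ! i) ^ k)" for k
    by (rule trace_power_eq_sum_eigenvalues[OF A es])
  show ?D unfolding eq tr by (subst int) auto
  interpret M: prob_space M unfolding M_def
    by (auto intro!: prob_space.prob_space_distr measure_pmf.prob_space_axioms)
  have "emeasure M B = ennreal ((\<Sum>i<n. indicator B (es ! i)) / n)" if "B \<in> sets borel" for B
  proof -
    have "measure M B = (\<integral>x. indicator B x \<partial>M)" using that by (simp add: M_def)
    thus ?thesis unfolding M.emeasure_eq_measure using int[of "indicator B"] that by simp
  qed
  thus ?E unfolding eq using tr es(1) by (intro exI[of _ es]) auto
qed

text \<open>
  A diagonal use of the Weierstrass theorem: on \<open>[-j, j]\<close> the \<open>j\<close>-th polynomial is within \<open>1 / (j + 1)\<close> of a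
  continuous function that drops from \<open>1\<close> to \<open>0\<close> between \<open>x\<close> and \<open>x + 1 / (j + 1)\<close>. It makes the number of
  eigenvalues below \<open>x\<close> a pointwise limit of combinations of traces of powers, hence measurable.
\<close>

lemma exists_polynomials_tendsto_indicator:
  fixes x :: real
  shows "\<exists>p :: nat \<Rightarrow> nat \<Rightarrow> real. \<exists>d. \<forall>y. (\<lambda>j. \<Sum>i\<le>d j. p j i * y ^ i) \<longlonglongrightarrow> indicator {..x} y"
proof -
  define g where "g j = cts_step x (x + 1 / real (Suc j))" for j
  have "\<exists>a n. \<forall>y. \<bar>y\<bar> \<le> real j \<longrightarrow> \<bar>g j y - (\<Sum>i\<le>n. a i * y ^ i)\<bar> < 1 / real (Suc j)" for j
  proof -
    have c: "continuous_on {- real j..real j} (g j)"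
      unfolding g_def
      by (rule continuous_on_subset[OF uniformly_continuous_imp_continuous[OF cts_step_uniformly_continuous]]) auto
    obtain q where q: "real_polynomial_function q" "\<And>y. y \<in> {- real j..real j} \<Longrightarrow> \<bar>g j y - q y\<bar> < 1 / real (Suc j)"
      using Stone_Weierstrass_real_polynomial_function[OF compact_Icc c, of "1 / real (Suc j)"] by auto
    obtain a n where "q = (\<lambda>y. \<Sum>i\<le>n. a i * y ^ i)"
      using q(1) unfolding real_polynomial_function_iff_sum by blast
    thus ?thesis using q(2) by (intro exI[of _ a] exI[of _ n]) (auto simp: abs_le_iff)
  qed
  then obtain p d where pd: "\<And>j y. \<bar>y\<bar> \<le> real j \<Longrightarrow> \<bar>g j y - (\<Sum>i\<le>d j. p j i * y ^ i)\<bar> < 1 / real (Suc j)"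
    by metis
  have "(\<lambda>j. \<Sum>i\<le>d j. p j i * y ^ i) \<longlonglongrightarrow> indicator {..x} y" for y
  proof -
    have zero: "(\<lambda>j. 1 / real (Suc j)) \<longlonglongrightarrow> 0" using LIMSEQ_inverse_real_of_nat by (simp add: inverse_eq_divide)
    obtain j0 :: nat where j0: "\<bar>y\<bar> \<le> real j0" using real_arch_simple by blast
    have "\<forall>\<^sub>F j in sequentially. norm (g j y - (\<Sum>i\<le>d j. p j i * y ^ i)) \<le> 1 / real (Suc j)"
      using j0 pd by (auto simp: eventually_sequentially intro!: exI[of _ j0] less_imp_le)
    from Lim_null_comparison[OF this zero]
    have 1: "(\<lambda>j. g j y - (\<Sum>i\<le>d j. p j i * y ^ i)) \<longlonglongrightarrow> 0" .
    have 2: "(\<lambda>j. g j y) \<longlonglongrightarrow> indicator {..x} y"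
    proof (cases "y \<le> x")
      case True
      thus ?thesis by (auto simp: g_def cts_step_def)
    next
      case False
      have "\<forall>\<^sub>F j in sequentially. 1 / real (Suc j) < y - x"
        by (rule order_tendstoD(2)[OF zero]) (use False in auto)
      hence "\<forall>\<^sub>F j in sequentially. g j y = indicator {..x} y"
        by eventually_elim (use False in \<open>auto simp: g_def cts_step_def\<close>)
      thus ?thesis by (rule tendsto_eventually)
    qed
    show ?thesis using tendsto_diff[OF 2 1] by simp
  qed
  thus ?thesis by blast
qed

lemma integral_bind_nonneg:
  fixes f :: "'b \<Rightarrow> real"
  assumes K: "K \<in> measurable P (subprob_algebra L)" and f: "f \<in> borel_measurable L" "\<And>x. f x \<ge> 0"
    and intK: "\<And>\<omega>. \<omega> \<in> space P \<Longrightarrow> integrable (K \<omega>) f"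
    and int: "integrable P (\<lambda>\<omega>. \<integral>x. f x \<partial>K \<omega>)" and ne: "space P \<noteq> {}"
  shows "integrable (P \<bind> K) f" "(\<integral>x. f x \<partial>(P \<bind> K)) = (\<integral>\<omega>. \<integral>x. f x \<partial>K \<omega> \<partial>P)"
proof -
  have "(\<integral>\<^sup>+x. ennreal (f x) \<partial>(P \<bind> K)) = (\<integral>\<^sup>+\<omega>. \<integral>\<^sup>+x. ennreal (f x) \<partial>K \<omega> \<partial>P)"
    using f K by (intro nn_integral_bind) auto
  also have "\<dots> = (\<integral>\<^sup>+\<omega>. ennreal (\<integral>x. f x \<partial>K \<omega>) \<partial>P)"
    using intK f by (intro nn_integral_cong nn_integral_eq_integral) auto
  also have "\<dots> = ennreal (\<integral>\<omega>. \<integral>x. f x \<partial>K \<omega> \<partial>P)"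
    using int f by (intro nn_integral_eq_integral) auto
  finally have nn: "(\<integral>\<^sup>+x. ennreal (f x) \<partial>(P \<bind> K)) = ennreal (\<integral>\<omega>. \<integral>x. f x \<partial>K \<omega> \<partial>P)" .
  have m: "f \<in> borel_measurable (P \<bind> K)"
    by (subst measurable_cong_sets[OF sets_bind[OF sets_kernel[OF K] ne] refl]) (auto intro: f)
  show "integrable (P \<bind> K) f"
    using nn f m by (intro integrableI_nn_integral_finite[of _ _ "\<integral>\<omega>. \<integral>x. f x \<partial>K \<omega> \<partial>P"]) auto
  show "(\<integral>x. f x \<partial>(P \<bind> K)) = (\<integral>\<omega>. \<integral>x. f x \<partial>K \<omega> \<partial>P)"
    using m f nn by (subst integral_eq_nn_integral) (auto intro!: Bochner_Integration.integral_nonneg)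
qed

text \<open>
  The mean distribution is the mixture of the empirical distributions, provided that these depend
  measurably on the outcome. It is enough to check this for half-lines, where the mass is a limit of
  measurable combinations of traces.
\<close>

lemma mean_eigenvalue_distr_moments:
  fixes A :: "'a \<Rightarrow> real mat"
  assumes P: "prob_space P" and n: "n > 0"
    and A: "\<And>\<omega>. \<omega> \<in> space P \<Longrightarrow> A \<omega> \<in> carrier_mat n n"
    and sym: "\<And>\<omega> i j. \<omega> \<in> space P \<Longrightarrow> i < n \<Longrightarrow> j < n \<Longrightarrow> A \<omega> $$ (i, j) = A \<omega> $$ (j, i)"
    and int: "\<And>k. integrable P (\<lambda>\<omega>. trace_power k (A \<omega>))"
  shows "real_distribution (mean_eigenvalue_distr P n A)"
    and "integrable (mean_eigenvalue_distr P n A) (\<lambda>x. x ^ k)"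
    and "(\<integral>x. x ^ k \<partial>mean_eigenvalue_distr P n A) = (\<integral>\<omega>. trace_power k (A \<omega>) \<partial>P) / n"
proof -
  interpret prob_space P by (rule P)
  define K where "K \<omega> = empirical_eigenvalue_distr (A \<omega>)" for \<omega>
  have emp: "real_distribution (K \<omega>)"
    "\<And>B. B \<in> sets borel \<Longrightarrow> emeasure (K \<omega>) B =
       (\<Sum>x\<in>#proots (char_poly (A \<omega>)). emeasure (return borel x) B) / of_nat n"
    "\<And>k. integrable (K \<omega>) (\<lambda>x. x ^ k)" "\<And>k. (\<integral>x. x ^ k \<partial>K \<omega>) = trace_power k (A \<omega>) / n"
    "\<exists>es. length es = n \<and> (\<forall>k. trace_power k (A \<omega>) = (\<Sum>i<n. (es ! i) ^ k)) \<and>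
       (\<forall>B\<in>sets borel. emeasure (K \<omega>) B = ennreal ((\<Sum>i<n. indicator B (es ! i)) / n))"
    if \<omega>: "\<omega> \<in> space P" for \<omega>
    using symmetric_eigenvalue_distr[OF A[OF \<omega>] n sym[OF \<omega>]] unfolding K_def by auto
  have setsK: "sets (K \<omega>) = sets borel" for \<omega>
    by (simp add: K_def empirical_eigenvalue_distr_def sets.sigma_sets_eq[of borel, simplified])
  have meas_atMost: "(\<lambda>\<omega>. emeasure (K \<omega>) {..x}) \<in> borel_measurable P" for x :: real
  proof -
    obtain p :: "nat \<Rightarrow> nat \<Rightarrow> real" and d where pd: "\<And>y. (\<lambda>j. \<Sum>i\<le>d j. p j i * y ^ i) \<longlonglongrightarrow> indicator {..x} y"
      using exists_polynomials_tendsto_indicator by metis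
    define F where "F \<omega> = lim (\<lambda>j. (\<Sum>i\<le>d j. p j i * trace_power i (A \<omega>)) / n)" for \<omega>
    have "emeasure (K \<omega>) {..x} = ennreal (F \<omega>)" if \<omega>: "\<omega> \<in> space P" for \<omega>
    proof -
      obtain es where es: "\<And>k. trace_power k (A \<omega>) = (\<Sum>i<n. (es ! i) ^ k)"
        "\<And>B. B\<in>sets borel \<Longrightarrow> emeasure (K \<omega>) B = ennreal ((\<Sum>i<n. indicator B (es ! i)) / n)"
        using emp(5)[OF \<omega>] by blast
      have "(\<lambda>j. (\<Sum>l<n. \<Sum>i\<le>d j. p j i * (es ! l) ^ i) / n) \<longlonglongrightarrow> (\<Sum>l<n. indicator {..x} (es ! l)) / n"
        using n by (intro tendsto_intros pd) auto
      also have "(\<lambda>j. (\<Sum>l<n. \<Sum>i\<le>d j. p j i * (es ! l) ^ i) / n) = (\<lambda>j. (\<Sum>i\<le>d j. p j i * trace_power i (A \<omega>)) / n)"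
        by (subst sum.swap) (simp add: es sum_distrib_left)
      finally have "F \<omega> = (\<Sum>l<n. indicator {..x} (es ! l)) / n"
        unfolding F_def by (rule limI)
      thus ?thesis by (simp add: es)
    qed
    moreover have "(\<lambda>\<omega>. ennreal (F \<omega>)) \<in> borel_measurable P"
      unfolding F_def using int[THEN borel_measurable_integrable] by measurable
    ultimately show ?thesis by (subst measurable_cong) auto
  qed
  have K: "K \<in> measurable P (prob_algebra borel)"
  proof (rule measurable_prob_algebra_generated[where G="range (\<lambda>x. {..x})" and \<Omega>=UNIV])
    show "sets borel = sigma_sets UNIV (range (\<lambda>x::real. {..x}))"
      by (simp add: borel_eq_atMost)
    show "Int_stable (range (\<lambda>x::real. {..x}))"
      by (auto simp: Int_stable_def intro!: exI[of _ "min _ _"])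
  qed (use emp(1) setsK meas_atMost in \<open>auto simp: real_distribution_def\<close>)
  hence K': "K \<in> measurable P (subprob_algebra borel)" by (rule measurable_prob_algebraD)
  define M where "M = P \<bind> K"
  have setsM: "sets M = sets borel"
    unfolding M_def using setsK not_empty by (intro sets_bind) auto
  have M: "prob_space M" unfolding M_def
    by (rule prob_space_bind'[OF _ K]) (simp add: space_prob_algebra prob_space_axioms)
  have em: "emeasure M B = (\<integral>\<^sup>+\<omega>. (\<Sum>x\<in>#proots (char_poly (A \<omega>)). emeasure (return borel x) B) \<partial>P) / of_nat n"
    if B: "B \<in> sets borel" for B
  proof -
    have "emeasure M B = (\<integral>\<^sup>+\<omega>. emeasure (K \<omega>) B \<partial>P)"
      unfolding M_def using not_empty by (intro emeasure_bind[OF _ K' B])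
    moreover have "(\<integral>\<^sup>+\<omega>. emeasure (K \<omega>) B * of_nat n \<partial>P) = (\<integral>\<^sup>+\<omega>. emeasure (K \<omega>) B \<partial>P) * of_nat n"
      using measurable_emeasure_kernel[OF K' B] by (rule nn_integral_multc)
    moreover have "(\<integral>\<^sup>+\<omega>. emeasure (K \<omega>) B * of_nat n \<partial>P) =
        (\<integral>\<^sup>+\<omega>. (\<Sum>x\<in>#proots (char_poly (A \<omega>)). emeasure (return borel x) B) \<partial>P)"
    proof (rule nn_integral_cong)
      fix \<omega> assume \<omega>: "\<omega> \<in> space P"
      show "emeasure (K \<omega>) B * of_nat n = (\<Sum>x\<in>#proots (char_poly (A \<omega>)). emeasure (return borel x) B)"
        unfolding emp(2)[OF \<omega> B] using n
        by (subst ennreal_divide_times) (simp add: ennreal_of_nat_eq_real_of_nat)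
    qed
    ultimately show ?thesis using n ennreal_mult_divide_eq[of "of_nat n" "emeasure M B"] by auto
  qed
  have eq: "mean_eigenvalue_distr P n A = M"
  proof -
    have "mean_eigenvalue_distr P n A = measure_of (space M) (sets M) (emeasure M)"
      unfolding mean_eigenvalue_distr_def using em
      by (simp add: setsM sets_eq_imp_space_eq[OF setsM])
         (intro measure_of_eq, auto simp: sets.sigma_sets_eq[of borel, simplified])
    thus ?thesis by (simp add: measure_of_of_measure)
  qed
  show "real_distribution (mean_eigenvalue_distr P n A)"
    unfolding eq real_distribution_def real_distribution_axioms_def
    using M setsM sets_eq_imp_space_eq[OF setsM] by simp
  \<comment> \<open>Adding a larger even power reduces the moments to non-negative integrands.\<close>
  define g where "g x = 1 + x ^ (2 * k)" for x :: real
  define f where "f x = x ^ k + g x" for x :: real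
  have g: "g x \<ge> 0" for x by (simp add: g_def)
  have f: "f x \<ge> 0" for x unfolding f_def g_def using two_abs_power_le[of x k] by linarith
  have intK: "integrable (K \<omega>) (\<lambda>x. x ^ j)" if "\<omega> \<in> space P" for \<omega> j by (rule emp(3)[OF that])
  have K1: "integrable (K \<omega>) (\<lambda>_. 1::real)" if "\<omega> \<in> space P" for \<omega> using intK[OF that, of 0] by simp
  have gi: "integrable (K \<omega>) g" "(\<integral>x. g x \<partial>K \<omega>) = trace_power 0 (A \<omega>) / n + trace_power (2*k) (A \<omega>) / n" if "\<omega> \<in> space P" for \<omega>
    using intK[OF that] K1[OF that] emp(4)[OF that, of 0] emp(4)[OF that, of "2*k"]
    by (simp_all add: g_def[abs_def])
  have fi: "integrable (K \<omega>) f" "(\<integral>x. f x \<partial>K \<omega>) = trace_power k (A \<omega>) / n + (\<integral>x. g x \<partial>K \<omega>)" if "\<omega> \<in> space P" for \<omega>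
    using intK[OF that] gi(1)[OF that] emp(4)[OF that] by (simp_all add: f_def[abs_def])
  have gI: "integrable P (\<lambda>\<omega>. \<integral>x. g x \<partial>K \<omega>)"
    using int by (subst Bochner_Integration.integrable_cong[OF refl gi(2)]) auto
  have fI: "integrable P (\<lambda>\<omega>. \<integral>x. f x \<partial>K \<omega>)"
    using int gI by (subst Bochner_Integration.integrable_cong[OF refl fi(2)]) auto
  note Mg = integral_bind_nonneg[OF K' _ g gi(1) gI not_empty, folded M_def]
  note Mf = integral_bind_nonneg[OF K' _ f fi(1) fI not_empty, folded M_def]
  have [measurable]: "g \<in> borel_measurable borel" "f \<in> borel_measurable borel"
    unfolding f_def[abs_def] g_def[abs_def] by measurable
  have xk: "(\<lambda>x. x ^ k) = (\<lambda>x. f x - g x)" by (simp add: f_def)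
  show "integrable (mean_eigenvalue_distr P n A) (\<lambda>x. x ^ k)"
    unfolding eq xk using Mg Mf by simp
  have "(\<integral>x. x ^ k \<partial>M) = (\<integral>\<omega>. (\<integral>x. f x \<partial>K \<omega>) \<partial>P) - (\<integral>\<omega>. (\<integral>x. g x \<partial>K \<omega>) \<partial>P)"
    unfolding xk using Mg Mf by simp
  also have "\<dots> = (\<integral>\<omega>. (\<integral>x. f x \<partial>K \<omega>) - (\<integral>x. g x \<partial>K \<omega>) \<partial>P)"
    using gI fI by simp
  also have "\<dots> = (\<integral>\<omega>. trace_power k (A \<omega>) / n \<partial>P)"
    by (intro Bochner_Integration.integral_cong) (auto simp: fi)
  finally show "(\<integral>x. x ^ k \<partial>mean_eigenvalue_distr P n A) = (\<integral>\<omega>. trace_power k (A \<omega>) \<partial>P) / n"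
    by (simp add: eq)
qed

section \<open>Traces of powers as sums over closed walks\<close>

lemma sum_PiE_lessThan_Suc:
  "(\<Sum>u\<in>{..<Suc n} \<rightarrow>\<^sub>E S. f u) = (\<Sum>p\<in>S. \<Sum>w\<in>{..<n} \<rightarrow>\<^sub>E S. f (w(n := p)))"
proof -
  have inj: "inj_on (\<lambda>(p, w). w(n := p)) (S \<times> ({..<n} \<rightarrow>\<^sub>E S))"
    using inj_combinator[of n "{..<n}" "\<lambda>_. S"] by simp
  have "(\<Sum>u\<in>{..<Suc n} \<rightarrow>\<^sub>E S. f u) = (\<Sum>u\<in>(\<lambda>(p, w). w(n := p)) ` (S \<times> ({..<n} \<rightarrow>\<^sub>E S)). f u)"
    by (simp only: lessThan_Suc PiE_insert_eq)
  also have "\<dots> = (\<Sum>(p, w)\<in>S \<times> ({..<n} \<rightarrow>\<^sub>E S). f (w(n := p)))"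
    by (subst sum.reindex[OF inj]) (simp add: case_prod_unfold)
  finally show ?thesis by (simp add: sum.cartesian_product)
qed

text \<open>
  \<open>w\<close> lists the \<open>n\<close> intermediate vertices of a path with \<open>n + 1\<close> steps from \<open>p\<close> to \<open>q\<close>.
\<close>

lemma pow_mat_index_eq_sum_paths:
  fixes A :: "real mat"
  assumes A: "A \<in> carrier_mat d d" and p: "p < d" and q: "q < d"
  shows "(A ^\<^sub>m Suc n) $$ (p, q) =
    (\<Sum>w\<in>{..<n} \<rightarrow>\<^sub>E {..<d}. \<Prod>l<Suc n. A $$ (if l = 0 then p else w (l - 1), if l = n then q else w l))"
  using q
proof (induction n arbitrary: q)
  case 0
  thus ?case using A p by simp
next
  case (Suc n)
  have "(A ^\<^sub>m Suc (Suc n)) $$ (p, q) = (\<Sum>r<d. (A ^\<^sub>m Suc n) $$ (p, r) * A $$ (r, q))"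
    using A p Suc.prems by (simp add: scalar_prod_def atLeast0LessThan del: pow_mat.simps(2) add: pow_mat.simps(2)[of A "Suc n"])
  also have "\<dots> = (\<Sum>r<d. \<Sum>w\<in>{..<n} \<rightarrow>\<^sub>E {..<d}.
      (\<Prod>l<Suc n. A $$ (if l = 0 then p else w (l - 1), if l = n then r else w l)) * A $$ (r, q))"
    by (intro sum.cong refl) (simp only: Suc.IH lessThan_iff sum_distrib_right)
  also have "\<dots> = (\<Sum>r<d. \<Sum>w\<in>{..<n} \<rightarrow>\<^sub>E {..<d}.
      \<Prod>l<Suc (Suc n). A $$ (if l = 0 then p else (w(n := r)) (l - 1), if l = Suc n then q else (w(n := r)) l))"
  proof (intro sum.cong refl)
    fix r w
    have "(\<Prod>l<Suc n. A $$ (if l = 0 then p else w (l - 1), if l = n then r else w l)) =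
        (\<Prod>l<Suc n. A $$ (if l = 0 then p else (w(n := r)) (l - 1), if l = Suc n then q else (w(n := r)) l))"
      by (intro prod.cong refl) auto
    thus "(\<Prod>l<Suc n. A $$ (if l = 0 then p else w (l - 1), if l = n then r else w l)) * A $$ (r, q) =
        (\<Prod>l<Suc (Suc n). A $$ (if l = 0 then p else (w(n := r)) (l - 1), if l = Suc n then q else (w(n := r)) l))"
      by (simp only: prod.lessThan_Suc[of _ "Suc n"]) simp
  qed
  finally show ?case by (simp only: sum_PiE_lessThan_Suc)
qed

lemma trace_power_eq_sum_closed_walks:
  fixes A :: "real mat"
  assumes A: "A \<in> carrier_mat d d" and n: "n \<ge> 1"
  shows "trace_power n A = (\<Sum>w\<in>{..<n} \<rightarrow>\<^sub>E {..<d}. \<Prod>l<n. A $$ (w l, w ((l + 1) mod n)))"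
proof -
  obtain k where k: "n = Suc k" using n by (cases n) auto
  have "trace_power n A = (\<Sum>p<d. \<Sum>w\<in>{..<k} \<rightarrow>\<^sub>E {..<d}.
      \<Prod>l<Suc k. A $$ (if l = 0 then p else w (l - 1), if l = k then p else w l))"
    unfolding trace_power_def k using A pow_mat_index_eq_sum_paths[OF A] by (intro sum.cong) auto
  also have "\<dots> = (\<Sum>p<d. \<Sum>w\<in>{..<k} \<rightarrow>\<^sub>E {..<d}.
      \<Prod>l<Suc k. A $$ ((w(k := p)) l, (w(k := p)) ((l + 1) mod Suc k)))"
  proof (intro sum.cong refl)
    fix p :: nat and w :: "nat \<Rightarrow> nat"
    define u where "u = w(k := p)"
    have "(\<Prod>l<Suc k. A $$ (if l = 0 then p else w (l - 1), if l = k then p else w l)) =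
        (\<Prod>l<Suc k. A $$ (if l = 0 then u k else u (l - 1), u l))"
      by (intro prod.cong refl) (auto simp: u_def)
    also have "\<dots> = A $$ (u k, u 0) * (\<Prod>l<k. A $$ (u l, u (Suc l)))"
      by (simp only: prod.lessThan_Suc_shift) simp
    also have "\<dots> = (\<Prod>l<Suc k. A $$ (u l, u ((l + 1) mod Suc k)))"
      by (simp add: mult.commute)
    finally show "(\<Prod>l<Suc k. A $$ (if l = 0 then p else w (l - 1), if l = k then p else w l)) =
        (\<Prod>l<Suc k. A $$ ((w(k := p)) l, (w(k := p)) ((l + 1) mod Suc k)))" by (simp add: u_def)
  qed
  finally show ?thesis unfolding k by (simp only: sum_PiE_lessThan_Suc)
qed

lemma trace_power_smult:
  fixes A :: "real mat"
  assumes A: "A \<in> carrier_mat d d"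
  shows "trace_power n (c \<cdot>\<^sub>m A) = c ^ n * trace_power n A"
proof (cases "n = 0")
  case True
  thus ?thesis using A by (simp add: trace_power_def)
next
  case False
  have "(c \<cdot>\<^sub>m A) \<in> carrier_mat d d" using A by simp
  hence "trace_power n (c \<cdot>\<^sub>m A) = (\<Sum>w\<in>{..<n} \<rightarrow>\<^sub>E {..<d}. \<Prod>l<n. (c \<cdot>\<^sub>m A) $$ (w l, w ((l + 1) mod n)))"
    using False by (intro trace_power_eq_sum_closed_walks) auto
  also have "\<dots> = (\<Sum>w\<in>{..<n} \<rightarrow>\<^sub>E {..<d}. c ^ n * (\<Prod>l<n. A $$ (w l, w ((l + 1) mod n))))"
  proof (intro sum.cong refl)
    fix w assume w: "w \<in> {..<n} \<rightarrow>\<^sub>E {..<d}"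
    have "(c \<cdot>\<^sub>m A) $$ (w l, w ((l + 1) mod n)) = c * A $$ (w l, w ((l + 1) mod n))" if "l < n" for l
      using A that PiE_mem[OF w, of l] PiE_mem[OF w, of "(l + 1) mod n"] by simp
    hence "(\<Prod>l<n. (c \<cdot>\<^sub>m A) $$ (w l, w ((l + 1) mod n))) = (\<Prod>l<n. c * A $$ (w l, w ((l + 1) mod n)))"
      by (intro prod.cong) auto
    thus "(\<Prod>l<n. (c \<cdot>\<^sub>m A) $$ (w l, w ((l + 1) mod n))) = c ^ n * (\<Prod>l<n. A $$ (w l, w ((l + 1) mod n)))"
      by (simp add: prod.distrib)
  qed
  finally show ?thesis using A False by (simp add: sum_distrib_left trace_power_eq_sum_closed_walks[of A d n])
qed

text \<open>
  An index of the large matrix is a block index together with an index inside the block.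
\<close>

lemma sum_PiE_div_mod:
  fixes m N n :: nat
  assumes m: "m \<ge> 1"
  shows "(\<Sum>w\<in>{..<n} \<rightarrow>\<^sub>E {..<m * N}. f w) =
    (\<Sum>i\<in>{..<n} \<rightarrow>\<^sub>E {..<N}. \<Sum>j\<in>{..<n} \<rightarrow>\<^sub>E {..<m}. f (\<lambda>l\<in>{..<n}. i l * m + j l))"
proof -
  have "(\<Sum>w\<in>{..<n} \<rightarrow>\<^sub>E {..<m * N}. f w) =
    (\<Sum>(i, j)\<in>({..<n} \<rightarrow>\<^sub>E {..<N}) \<times> ({..<n} \<rightarrow>\<^sub>E {..<m}). f (\<lambda>l\<in>{..<n}. i l * m + j l))"
  proof (rule sum.reindex_bij_witness[where j="\<lambda>w. (\<lambda>l\<in>{..<n}. w l div m, \<lambda>l\<in>{..<n}. w l mod m)"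
        and i="\<lambda>(i, j). \<lambda>l\<in>{..<n}. i l * m + j l"])
    fix w assume w: "w \<in> {..<n} \<rightarrow>\<^sub>E {..<m * N}"
    have "(\<lambda>l\<in>{..<n}. w l div m * m + w l mod m) = w"
    proof
      fix l show "(\<lambda>l\<in>{..<n}. w l div m * m + w l mod m) l = w l"
        using PiE_arb[OF w, of l] by (cases "l < n") auto
    qed
    hence eq: "(\<lambda>l\<in>{..<n}. (\<lambda>l\<in>{..<n}. w l div m) l * m + (\<lambda>l\<in>{..<n}. w l mod m) l) = w"
      by (simp add: restrict_def cong: if_cong)
    thus "(case (\<lambda>l\<in>{..<n}. w l div m, \<lambda>l\<in>{..<n}. w l mod m) of (i, j) \<Rightarrow> \<lambda>l\<in>{..<n}. i l * m + j l) = w"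
      by simp
    show "(\<lambda>l\<in>{..<n}. w l div m, \<lambda>l\<in>{..<n}. w l mod m) \<in> ({..<n} \<rightarrow>\<^sub>E {..<N}) \<times> ({..<n} \<rightarrow>\<^sub>E {..<m})"
    proof (rule SigmaI)
      have "w l div m < N" if "l < n" for l
        using PiE_mem[OF w, of l] that m by (simp add: less_mult_imp_div_less mult.commute)
      thus "(\<lambda>l\<in>{..<n}. w l div m) \<in> {..<n} \<rightarrow>\<^sub>E {..<N}" by simp
      show "(\<lambda>l\<in>{..<n}. w l mod m) \<in> {..<n} \<rightarrow>\<^sub>E {..<m}" using m by simp
    qed
    show "(case (\<lambda>l\<in>{..<n}. w l div m, \<lambda>l\<in>{..<n}. w l mod m) of (i, j) \<Rightarrow> f (\<lambda>l\<in>{..<n}. i l * m + j l)) = f w"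
      using eq by simp
  next
    fix ij assume "ij \<in> ({..<n} \<rightarrow>\<^sub>E {..<N}) \<times> ({..<n} \<rightarrow>\<^sub>E {..<m})"
    then obtain i j where ij: "ij = (i, j)" "i \<in> {..<n} \<rightarrow>\<^sub>E {..<N}" "j \<in> {..<n} \<rightarrow>\<^sub>E {..<m}" by auto
    have bd: "i l < N" "j l < m" if "l < n" for l
      using PiE_mem[OF ij(2), of l] PiE_mem[OF ij(3), of l] that by auto
    show "(case ij of (i, j) \<Rightarrow> \<lambda>l\<in>{..<n}. i l * m + j l) \<in> {..<n} \<rightarrow>\<^sub>E {..<m * N}"
    proof -
      have "i l * m + j l < m * N" if "l < n" for l
      proof -
        have "i l * m + j l < Suc (i l) * m" using bd[OF that] by simp
        also have "\<dots> \<le> N * m" using bd[OF that] by (intro mult_right_mono) auto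
        finally show ?thesis by (simp add: mult.commute)
      qed
      thus ?thesis by (simp add: ij(1))
    qed
    have "(\<lambda>l\<in>{..<n}. (\<lambda>l\<in>{..<n}. i l * m + j l) l div m) = i"
    proof
      fix l show "(\<lambda>l\<in>{..<n}. (\<lambda>l\<in>{..<n}. i l * m + j l) l div m) l = i l"
        using PiE_arb[OF ij(2), of l] bd[of l] by (cases "l < n") auto
    qed
    moreover have "(\<lambda>l\<in>{..<n}. (\<lambda>l\<in>{..<n}. i l * m + j l) l mod m) = j"
    proof
      fix l show "(\<lambda>l\<in>{..<n}. (\<lambda>l\<in>{..<n}. i l * m + j l) l mod m) l = j l"
        using PiE_arb[OF ij(3), of l] bd[of l] by (cases "l < n") auto
    qed
    ultimately show "(\<lambda>l\<in>{..<n}. (case ij of (i, j) \<Rightarrow> \<lambda>l\<in>{..<n}. i l * m + j l) l div m,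
          \<lambda>l\<in>{..<n}. (case ij of (i, j) \<Rightarrow> \<lambda>l\<in>{..<n}. i l * m + j l) l mod m) = ij"
      by (simp add: ij(1))
  qed
  thus ?thesis by (simp add: sum.cartesian_product)
qed

definition walk_steps :: "nat \<Rightarrow> (nat \<Rightarrow> nat) \<Rightarrow> nat \<Rightarrow> int" where
  "walk_steps n i = (\<lambda>l\<in>{..<n}. int (i l) - int (i ((l + 1) mod n)))"

definition walk_count :: "nat \<Rightarrow> nat \<Rightarrow> (nat \<Rightarrow> int) \<Rightarrow> nat" where
  "walk_count n N s = card {i \<in> {..<n} \<rightarrow>\<^sub>E {..<N}. walk_steps n i = s}"

text \<open>
  A term depends on the block indices of the walk only through their differences, so walks with the same
  steps can be collected. Walks with a step outside the band contribute nothing.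
\<close>

lemma trace_power_block_toeplitz:
  assumes m: "m \<ge> 1" and n: "n \<ge> 1"
    and band: "\<And>s i j. \<bar>s\<bar> > int b \<Longrightarrow> i < m \<Longrightarrow> j < m \<Longrightarrow> A s i j = 0"
  shows "trace_power n (block_toeplitz_mat m N A) =
    (\<Sum>s\<in>{..<n} \<rightarrow>\<^sub>E {- int b..int b}. real (walk_count n N s) *
       (\<Sum>j\<in>{..<n} \<rightarrow>\<^sub>E {..<m}. \<Prod>l<n. A (s l) (j l) (j ((l + 1) mod n))))"
proof -
  define h where "h s = (\<Sum>j\<in>{..<n} \<rightarrow>\<^sub>E {..<m}. \<Prod>l<n. A (s l) (j l) (j ((l + 1) mod n)))" for s
  define W where "W = {..<n} \<rightarrow>\<^sub>E {..<N}"
  define S where "S = {..<n} \<rightarrow>\<^sub>E {- int b..int b}"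
  have finW: "finite W" unfolding W_def by (intro finite_PiE) auto
  have finS: "finite S" unfolding S_def by (intro finite_PiE) auto
  have car: "block_toeplitz_mat m N A \<in> carrier_mat (m * N) (m * N)" by (simp add: block_toeplitz_mat_def)
  have "trace_power n (block_toeplitz_mat m N A) =
      (\<Sum>w\<in>{..<n} \<rightarrow>\<^sub>E {..<m * N}. \<Prod>l<n. block_toeplitz_mat m N A $$ (w l, w ((l + 1) mod n)))"
    by (rule trace_power_eq_sum_closed_walks[OF car n])
  also have "\<dots> = (\<Sum>w\<in>{..<n} \<rightarrow>\<^sub>E {..<m * N}. \<Prod>l<n.
      A (int (w l div m) - int (w ((l + 1) mod n) div m)) (w l mod m) (w ((l + 1) mod n) mod m))"
  proof (intro sum.cong prod.cong refl)
    fix w l assume w: "w \<in> {..<n} \<rightarrow>\<^sub>E {..<m * N}" and l: "l \<in> {..<n}"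
    show "block_toeplitz_mat m N A $$ (w l, w ((l + 1) mod n)) =
       A (int (w l div m) - int (w ((l + 1) mod n) div m)) (w l mod m) (w ((l + 1) mod n) mod m)"
      using PiE_mem[OF w, of l] PiE_mem[OF w, of "(l + 1) mod n"] l by (simp add: block_toeplitz_mat_def)
  qed
  also have "\<dots> = (\<Sum>i\<in>W. h (walk_steps n i))"
    unfolding sum_PiE_div_mod[OF m] h_def W_def
  proof (intro sum.cong prod.cong refl)
    fix i j l assume ij: "i \<in> {..<n} \<rightarrow>\<^sub>E {..<N}" "j \<in> {..<n} \<rightarrow>\<^sub>E {..<m}" and l: "l \<in> {..<n}"
    have l': "(l + 1) mod n < n" using l by simp
    have "j l < m" "j ((l + 1) mod n) < m" using PiE_mem[OF ij(2)] l l' by auto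
    thus "A (int ((\<lambda>l\<in>{..<n}. i l * m + j l) l div m) - int ((\<lambda>l\<in>{..<n}. i l * m + j l) ((l + 1) mod n) div m))
        ((\<lambda>l\<in>{..<n}. i l * m + j l) l mod m) ((\<lambda>l\<in>{..<n}. i l * m + j l) ((l + 1) mod n) mod m) =
        A (walk_steps n i l) (j l) (j ((l + 1) mod n))"
      using l l' by (simp add: walk_steps_def)
  qed
  also have "\<dots> = (\<Sum>i\<in>{i\<in>W. walk_steps n i \<in> S}. h (walk_steps n i))"
  proof (rule sum.mono_neutral_right[OF finW])
    show "\<forall>i\<in>W - {i \<in> W. walk_steps n i \<in> S}. h (walk_steps n i) = 0"
    proof
      fix i assume i: "i \<in> W - {i \<in> W. walk_steps n i \<in> S}"
      have "\<exists>l<n. walk_steps n i l \<notin> {- int b..int b}"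
      proof (rule ccontr)
        assume "\<not> (\<exists>l<n. walk_steps n i l \<notin> {- int b..int b})"
        hence "walk_steps n i \<in> S" unfolding S_def walk_steps_def by (intro restrict_PiE_iff[THEN iffD2]) auto
        thus False using i by simp
      qed
      then obtain l where l: "l < n" "\<bar>walk_steps n i l\<bar> > int b" by force
      have "(\<Prod>l<n. A (walk_steps n i l) (j l) (j ((l + 1) mod n))) = 0" if j: "j \<in> {..<n} \<rightarrow>\<^sub>E {..<m}" for j
      proof -
        have "j l < m" "j ((l + 1) mod n) < m" using PiE_mem[OF j] l n by auto
        thus ?thesis using band[OF l(2)] l(1) by (auto simp: prod_zero_iff)
      qed
      thus "h (walk_steps n i) = 0" by (simp add: h_def)
    qed
  qed auto
  also have "\<dots> = (\<Sum>s\<in>S. \<Sum>i\<in>{i\<in>{i\<in>W. walk_steps n i \<in> S}. walk_steps n i = s}. h (walk_steps n i))"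
    using finW finS by (intro sum.group[symmetric]) auto
  also have "\<dots> = (\<Sum>s\<in>S. real (walk_count n N s) * h s)"
  proof (intro sum.cong refl)
    fix s assume s: "s \<in> S"
    have "(\<Sum>i\<in>{i\<in>{i\<in>W. walk_steps n i \<in> S}. walk_steps n i = s}. h (walk_steps n i)) =
        (\<Sum>i\<in>{i\<in>W. walk_steps n i = s}. h s)" using s by (intro sum.cong) auto
    thus "(\<Sum>i\<in>{i\<in>{i\<in>W. walk_steps n i \<in> S}. walk_steps n i = s}. h (walk_steps n i)) = real (walk_count n N s) * h s"
      by (simp add: walk_count_def W_def)
  qed
  finally show ?thesis by (simp add: h_def S_def)
qed

text \<open>
  A walk with prescribed steps is determined by its starting point.
\<close>

lemma walk_count_le:
  assumes n: "n \<ge> 1"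
  shows "walk_count n N s \<le> N"
proof -
  have "inj_on (\<lambda>i. i 0) {i \<in> {..<n} \<rightarrow>\<^sub>E {..<N}. walk_steps n i = s}"
  proof (rule inj_onI)
    fix i i' assume i: "i \<in> {i \<in> {..<n} \<rightarrow>\<^sub>E {..<N}. walk_steps n i = s}"
      "i' \<in> {i \<in> {..<n} \<rightarrow>\<^sub>E {..<N}. walk_steps n i = s}" and eq: "i 0 = i' 0"
    have st: "int (i l) - int (i ((l + 1) mod n)) = int (i' l) - int (i' ((l + 1) mod n))" if "l < n" for l
    proof -
      have "walk_steps n i l = walk_steps n i' l" using i by simp
      thus ?thesis using that by (simp add: walk_steps_def)
    qed
    have "i l = i' l" if "l < n" for l
      using that
    proof (induction l)
      case (Suc l)
      thus ?case using st[of l] by simp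
    qed (rule eq)
    thus "i = i'" using i by (intro PiE_ext[of i "{..<n}" _ i']) auto
  qed
  moreover have "(\<lambda>i. i 0) ` {i \<in> {..<n} \<rightarrow>\<^sub>E {..<N}. walk_steps n i = s} \<subseteq> {..<N}"
  proof (rule image_subsetI)
    fix i assume "i \<in> {i \<in> {..<n} \<rightarrow>\<^sub>E {..<N}. walk_steps n i = s}"
    hence "i \<in> {..<n} \<rightarrow>\<^sub>E {..<N}" by simp
    from PiE_mem[OF this, of 0] show "i 0 \<in> {..<N}" using n by simp
  qed
  ultimately have "walk_count n N s \<le> card {..<N}" unfolding walk_count_def by (intro card_inj_on_le) auto
  thus ?thesis by simp
qed

text \<open>
  The steps of a closed walk telescope to zero.
\<close>

lemma walk_count_eq_0:
  assumes n: "n \<ge> 1" and s: "sum s {..<n} \<noteq> 0"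
  shows "walk_count n N s = 0"
proof -
  obtain k where k: "n = Suc k" using n by (cases n) auto
  have "sum (walk_steps n i) {..<n} = 0" for i
  proof -
    have "sum (walk_steps n i) {..<n} = (\<Sum>l<n. int (i l)) - (\<Sum>l<n. int (i ((l + 1) mod n)))"
      by (simp add: walk_steps_def sum_subtractf)
    also have "(\<Sum>l<n. int (i ((l + 1) mod n))) = (\<Sum>l<n. int (i l))"
      unfolding k by (subst (2) sum.lessThan_Suc_shift) simp
    finally show ?thesis by simp
  qed
  hence "{i \<in> {..<n} \<rightarrow>\<^sub>E {..<N}. walk_steps n i = s} = {}" using s by auto
  thus ?thesis by (simp only: walk_count_def card.empty)
qed

text \<open>
  A walk with \<open>n\<close> steps of size at most \<open>b\<close> cannot leave \<open>{..<N}\<close> if it starts at distance at least \<open>n b\<close>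
  from both ends.
\<close>

lemma walk_count_ge:
  assumes n: "n \<ge> 1" and s: "s \<in> {..<n} \<rightarrow>\<^sub>E {- int b..int b}" "sum s {..<n} = 0"
  shows "N - 2 * (n * b) \<le> walk_count n N s"
proof -
  define i where "i x = (\<lambda>l\<in>{..<n}. nat (int x - sum s {..<l}))" for x
  have sb: "\<bar>sum s {..<l}\<bar> \<le> int (n * b)" if "l \<le> n" for l
  proof -
    have "\<bar>sum s {..<l}\<bar> \<le> (\<Sum>k<l. \<bar>s k\<bar>)" by (rule sum_abs)
    also have "\<dots> \<le> (\<Sum>k<l. int b)"
    proof (rule sum_mono)
      fix k assume "k \<in> {..<l}"
      thus "\<bar>s k\<bar> \<le> int b" using PiE_mem[OF s(1), of k] that by auto
    qed
    also have "\<dots> \<le> int (n * b)" using that by (simp add: mult_right_mono)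
    finally show ?thesis .
  qed
  have sub: "i ` {n * b..<N - n * b} \<subseteq> {i \<in> {..<n} \<rightarrow>\<^sub>E {..<N}. walk_steps n i = s}"
  proof (rule image_subsetI)
    fix x assume x: "x \<in> {n * b..<N - n * b}"
    have "n * b \<le> x" "x + n * b < N" using x by auto
    hence x': "int (n * b) \<le> int x" "int x + int (n * b) < int N"
      by (simp_all only: of_nat_le_iff of_nat_add[symmetric] of_nat_less_iff)
    have pos: "0 \<le> int x - sum s {..<l}" "int x - sum s {..<l} < int N" if "l \<le> n" for l
      using sb[OF that] x' by linarith+
    have il: "int (i x l) = int x - sum s {..<l}" if "l < n" for l
      using pos[of l] that by (simp add: i_def)
    have "walk_steps n (i x) = s"
    proof
      fix l
      show "walk_steps n (i x) l = s l"
      proof (cases "l < n")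
        case True
        show ?thesis
        proof (cases "Suc l < n")
          case True
          thus ?thesis using il by (simp add: walk_steps_def)
        next
          case False
          hence "n = Suc l" using True by simp
          thus ?thesis using il[of l] il[of 0] s(2) by (simp add: walk_steps_def)
        qed
      next
        case False
        thus ?thesis using PiE_arb[OF s(1), of l] by (simp add: walk_steps_def)
      qed
    qed
    moreover have "i x \<in> {..<n} \<rightarrow>\<^sub>E {..<N}"
      unfolding i_def using pos by (intro restrict_PiE_iff[THEN iffD2]) (auto simp: nat_less_iff)
    ultimately show "i x \<in> {i \<in> {..<n} \<rightarrow>\<^sub>E {..<N}. walk_steps n i = s}" by simp
  qed
  have inj: "inj_on i {n * b..<N - n * b}"
  proof (rule inj_onI)
    fix x y assume "i x = i y"
    hence "i x 0 = i y 0" by simp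
    thus "x = y" using n by (simp add: i_def)
  qed
  have "finite {i \<in> {..<n} \<rightarrow>\<^sub>E {..<N}. walk_steps n i = s}"
    by (rule finite_subset[of _ "{..<n} \<rightarrow>\<^sub>E {..<N}"]) (auto intro: finite_PiE)
  hence "card {n * b..<N - n * b} \<le> walk_count n N s"
    unfolding walk_count_def by (rule card_inj_on_le[OF inj sub])
  thus ?thesis by simp
qed

section \<open>Counting words\<close>

text \<open>
  The pattern of a word is finite information that does not depend on the range of its letters; a count
  of words up to constants may therefore be done for each pattern separately.
\<close>

definition word_pattern :: "'l set \<Rightarrow> ('l \<Rightarrow> int) \<Rightarrow> ('l \<times> 'l) set \<times> ('l \<times> 'l) set" where
  "word_pattern L s = ({(p, q) \<in> L \<times> L. s p = s q}, {(p, q) \<in> L \<times> L. s p = - s q})"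

text \<open>
  Only these words can have a non-zero expectation: a letter whose absolute value occurs once belongs to
  an independent centred factor.
\<close>

definition matched_word :: "'l set \<Rightarrow> ('l \<Rightarrow> int) \<Rightarrow> bool" where
  "matched_word L s \<longleftrightarrow> (\<forall>p\<in>L. \<exists>q\<in>L. q \<noteq> p \<and> \<bar>s q\<bar> = \<bar>s p\<bar>)"

text \<open>
  The words of leading order. The condition \<open>s p \<noteq> s q\<close> for the two letters of equal absolute value says
  that they are opposite and not zero.
\<close>

definition paired_word :: "'l set \<Rightarrow> ('l \<Rightarrow> int) \<Rightarrow> bool" where
  "paired_word L s \<longleftrightarrow> (\<forall>p\<in>L. \<exists>q\<in>L. {l \<in> L. \<bar>s l\<bar> = \<bar>s p\<bar>} = {p, q} \<and> s p \<noteq> s q)"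

text \<open>
  A word is encoded by its pattern, for which there are at most \<open>4 ^ (card L)\<^sup>2\<close> possibilities, and by its
  letters at the at most \<open>r\<close> positions that determine it within the pattern.
\<close>

lemma card_words_le:
  fixes S :: "('l \<Rightarrow> int) set"
  assumes L: "finite L" and S: "S \<subseteq> L \<rightarrow>\<^sub>E {- int b..int b}"
    and det: "\<And>s. s \<in> S \<Longrightarrow> \<exists>F\<subseteq>L. card F \<le> r \<and>
       (\<forall>s'\<in>S. \<forall>s''\<in>S. word_pattern L s' = word_pattern L s \<longrightarrow> word_pattern L s'' = word_pattern L s \<longrightarrow>
          (\<forall>l\<in>F. s' l = s'' l) \<longrightarrow> s' = s'')"
  shows "card S \<le> 4 ^ ((card L)\<^sup>2) * (2 * b + 1) ^ r"
proof -
  define D where "D = word_pattern L ` S"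
  have "\<forall>d\<in>D. \<exists>F\<subseteq>L. card F \<le> r \<and> (\<forall>s'\<in>S. \<forall>s''\<in>S. word_pattern L s' = d \<longrightarrow> word_pattern L s'' = d \<longrightarrow>
          (\<forall>l\<in>F. s' l = s'' l) \<longrightarrow> s' = s'')"
    unfolding D_def using det by auto
  then obtain F where F: "\<And>d. d \<in> D \<Longrightarrow> F d \<subseteq> L" "\<And>d. d \<in> D \<Longrightarrow> card (F d) \<le> r"
    "\<And>d s' s''. d \<in> D \<Longrightarrow> s' \<in> S \<Longrightarrow> s'' \<in> S \<Longrightarrow> word_pattern L s' = d \<Longrightarrow> word_pattern L s'' = d \<Longrightarrow>
       (\<forall>l\<in>F d. s' l = s'' l) \<Longrightarrow> s' = s''"
    unfolding bchoice_iff by blast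
  define f where "f s = (word_pattern L s, restrict s (F (word_pattern L s)))" for s
  have D_sub: "D \<subseteq> Pow (L \<times> L) \<times> Pow (L \<times> L)" by (auto simp: D_def word_pattern_def)
  have finD: "finite D" using finite_subset[OF D_sub] L by simp
  have finF: "finite (F d)" if "d \<in> D" for d using F(1)[OF that] L finite_subset by blast
  have "inj_on f S"
  proof (rule inj_onI)
    fix s s' assume s: "s \<in> S" "s' \<in> S" "f s = f s'"
    have "s l = s' l" if "l \<in> F (word_pattern L s)" for l
      using s(3) that unfolding f_def by (metis prod.inject restrict_apply')
    thus "s = s'" using s by (intro F(3)[of "word_pattern L s"]) (auto simp: D_def f_def)
  qed
  moreover have "f ` S \<subseteq> (SIGMA d:D. F d \<rightarrow>\<^sub>E {- int b..int b})"
    using S F(1) by (fastforce simp: f_def D_def)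
  moreover have "finite (SIGMA d:D. F d \<rightarrow>\<^sub>E {- int b..int b})"
    using finD finF by (intro finite_SigmaI finite_PiE) auto
  ultimately have "card S \<le> card (SIGMA d:D. F d \<rightarrow>\<^sub>E {- int b..int b})"
    by (metis card_image card_mono)
  also have "\<dots> = (\<Sum>d\<in>D. (2 * b + 1) ^ card (F d))"
    using finD finF by (simp add: card_SigmaI finite_PiE card_PiE nat_add_distrib nat_mult_distrib)
  also have "\<dots> \<le> (\<Sum>d\<in>D. (2 * b + 1) ^ r)"
    using F(2) by (intro sum_mono power_increasing) auto
  also have "\<dots> = card D * (2 * b + 1) ^ r" by simp
  also have "card D \<le> card (Pow (L \<times> L) \<times> Pow (L \<times> L))"
    using D_sub L by (intro card_mono) auto
  also have "\<dots> = 4 ^ ((card L)\<^sup>2)"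
    using L by (simp add: card_Pow card_cartesian_product power2_eq_square power_mult_distrib[symmetric])
  finally show ?thesis by simp
qed

text \<open>
  Given the pattern, one letter determines all letters of the same absolute value.
\<close>

lemma word_pattern_propagate:
  assumes "word_pattern L s' = word_pattern L s" "word_pattern L s'' = word_pattern L s"
    and "p \<in> L" "q \<in> L" "\<bar>s p\<bar> = \<bar>s q\<bar>" "s' p = s'' p"
  shows "s' q = s'' q"
proof -
  consider "s q = s p" | "s q = - s p" using assms(5) by linarith
  thus ?thesis
  proof cases
    case 1
    hence "(q, p) \<in> fst (word_pattern L s)" using assms by (simp add: word_pattern_def)
    hence "s' q = s' p" "s'' q = s'' p"
      using assms(1,2) by (metis (mono_tags, lifting) word_pattern_def case_prodD fst_conv mem_Collect_eq)+
    thus ?thesis using assms(6) by simp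
  next
    case 2
    hence "(q, p) \<in> snd (word_pattern L s)" using assms by (simp add: word_pattern_def)
    hence "s' q = - s' p" "s'' q = - s'' p"
      using assms(1,2) by (metis (mono_tags, lifting) word_pattern_def case_prodD snd_conv mem_Collect_eq)+
    thus ?thesis using assms(6) by simp
  qed
qed

text \<open>
  One position for each absolute value; by \<open>word_pattern_propagate\<close> the letters at these positions
  determine the word, given its pattern.
\<close>

lemma word_transversal:
  assumes "finite L"
  shows "\<exists>T\<subseteq>L. (\<forall>l\<in>L. \<exists>t\<in>T. \<bar>s t\<bar> = \<bar>s l\<bar>) \<and> inj_on (\<lambda>l. \<bar>s l\<bar>) T \<and>
    card L = (\<Sum>t\<in>T. card {l \<in> L. \<bar>s l\<bar> = \<bar>s t\<bar>})"
proof -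
  obtain T where T: "T \<subseteq> L" "inj_on (\<lambda>l. \<bar>s l\<bar>) T" "(\<lambda>l. \<bar>s l\<bar>) ` L = (\<lambda>l. \<bar>s l\<bar>) ` T"
    using subset_image_inj[of "(\<lambda>l. \<bar>s l\<bar>) ` L" "\<lambda>l. \<bar>s l\<bar>" L] by auto
  have "card L = (\<Sum>x\<in>(\<lambda>l. \<bar>s l\<bar>) ` L. card {l \<in> L. \<bar>s l\<bar> = x})"
    using sum.image_gen[OF assms, of "\<lambda>_. 1::nat" "\<lambda>l. \<bar>s l\<bar>"] by simp
  also have "\<dots> = (\<Sum>t\<in>T. card {l \<in> L. \<bar>s l\<bar> = \<bar>s t\<bar>})"
    unfolding T(3) by (simp add: sum.reindex[OF T(2)])
  finally have card: "card L = (\<Sum>t\<in>T. card {l \<in> L. \<bar>s l\<bar> = \<bar>s t\<bar>})" .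
  have "\<exists>t\<in>T. \<bar>s t\<bar> = \<bar>s l\<bar>" if "l \<in> L" for l
  proof -
    have "\<bar>s l\<bar> \<in> (\<lambda>l. \<bar>s l\<bar>) ` T" unfolding T(3)[symmetric] using that by blast
    thus ?thesis by force
  qed
  thus ?thesis using T card by (intro exI[of _ T]) auto
qed

lemma matched_word_class_card:
  assumes "finite L" "matched_word L s" "p \<in> L"
  shows "2 \<le> card {l \<in> L. \<bar>s l\<bar> = \<bar>s p\<bar>}"
proof -
  obtain q where "q \<in> L" "q \<noteq> p" "\<bar>s q\<bar> = \<bar>s p\<bar>" using assms by (auto simp: matched_word_def)
  hence "card {p, q} \<le> card {l \<in> L. \<bar>s l\<bar> = \<bar>s p\<bar>}" using assms by (intro card_mono) auto
  thus ?thesis using \<open>q \<noteq> p\<close> by simp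
qed

text \<open>
  Every absolute value occurs at least twice, so a transversal has at most half as many elements as \<open>L\<close>.
  If it has fewer, it is small enough. Otherwise every absolute value occurs exactly twice, and as the
  word is not paired, some two positions \<open>p\<close>, \<open>q\<close> carry the same letter; then \<open>2 s\<^sub>p\<close> is determined by the
  other letters because the sum is zero, so \<open>p\<close> needs no free letter.
\<close>

lemma card_unpaired_words_le:
  fixes L :: "'l set"
  assumes L: "finite L" "L \<noteq> {}"
  shows "card {s \<in> L \<rightarrow>\<^sub>E {- int b..int b}. matched_word L s \<and> sum s L = 0 \<and> \<not> paired_word L s}
           \<le> 4 ^ ((card L)\<^sup>2) * (2 * b + 1) ^ ((card L - 1) div 2)" (is "card ?S \<le> _")
proof (rule card_words_le[OF L(1)])
  show "?S \<subseteq> L \<rightarrow>\<^sub>E {- int b..int b}" by auto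
next
  fix s assume s: "s \<in> ?S"
  obtain T where T: "T \<subseteq> L" "\<And>l. l \<in> L \<Longrightarrow> \<exists>t\<in>T. \<bar>s t\<bar> = \<bar>s l\<bar>" "inj_on (\<lambda>l. \<bar>s l\<bar>) T"
    "card L = (\<Sum>t\<in>T. card {l \<in> L. \<bar>s l\<bar> = \<bar>s t\<bar>})" using word_transversal[OF L(1), of s] by blast
  have finT: "finite T" using T(1) L finite_subset by blast
  have cls: "2 \<le> card {l \<in> L. \<bar>s l\<bar> = \<bar>s p\<bar>}" if "p \<in> L" for p
    using s that matched_word_class_card[OF L(1), of s p] by auto
  have le: "2 * card T \<le> card L"
  proof -
    have "(\<Sum>t\<in>T. 2) \<le> (\<Sum>t\<in>T. card {l \<in> L. \<bar>s l\<bar> = \<bar>s t\<bar>})" using T(1) cls by (intro sum_mono) auto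
    thus ?thesis by (simp add: T(4)[symmetric])
  qed
  show "\<exists>F\<subseteq>L. card F \<le> (card L - 1) div 2 \<and>
       (\<forall>s'\<in>?S. \<forall>s''\<in>?S. word_pattern L s' = word_pattern L s \<longrightarrow> word_pattern L s'' = word_pattern L s \<longrightarrow>
          (\<forall>l\<in>F. s' l = s'' l) \<longrightarrow> s' = s'')"
  proof (cases "2 * card T < card L")
    case True
    have "s' = s''" if s': "s' \<in> ?S" "s'' \<in> ?S" "word_pattern L s' = word_pattern L s"
      "word_pattern L s'' = word_pattern L s" "\<forall>l\<in>T. s' l = s'' l" for s' s''
    proof -
      have "s' l = s'' l" if l: "l \<in> L" for l
      proof -
        obtain t where t: "t \<in> T" "\<bar>s t\<bar> = \<bar>s l\<bar>" using T(2) l by blast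
        thus ?thesis using l T(1) s'(5) by (intro word_pattern_propagate[OF s'(3,4), of t l]) auto
      qed
      thus ?thesis using s' by (intro PiE_ext[of s' L _ s'']) auto
    qed
    thus ?thesis using T(1) True by (intro exI[of _ T]) auto
  next
    case False
    hence c: "2 * card T = card L" using le by simp
    have two: "card {l \<in> L. \<bar>s l\<bar> = \<bar>s t\<bar>} = 2" if "t \<in> T" for t
    proof (rule ccontr)
      assume "card {l \<in> L. \<bar>s l\<bar> = \<bar>s t\<bar>} \<noteq> 2"
      hence "(\<Sum>t\<in>T. 2) < (\<Sum>t\<in>T. card {l \<in> L. \<bar>s l\<bar> = \<bar>s t\<bar>})"
        using T(1) cls cls[of t] that finT
        by (intro sum_strict_mono_ex1) (auto simp: le_less subset_iff intro!: bexI[of _ t])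
      thus False using c T(4) by simp
    qed
    obtain p where p: "p \<in> L" "\<And>q. q \<in> L \<Longrightarrow> {l \<in> L. \<bar>s l\<bar> = \<bar>s p\<bar>} = {p, q} \<Longrightarrow> s p = s q"
      using s by (auto simp: paired_word_def)
    obtain t where t: "t \<in> T" "\<bar>s t\<bar> = \<bar>s p\<bar>" using T(2)[OF p(1)] by blast
    have "card {l \<in> L. \<bar>s l\<bar> = \<bar>s p\<bar>} = 2" using two[OF t(1)] t(2) by simp
    then obtain x y where xy: "{l \<in> L. \<bar>s l\<bar> = \<bar>s p\<bar>} = {x, y}" "x \<noteq> y" by (auto simp: card_2_iff)
    have "p \<in> {x, y}" unfolding xy(1)[symmetric] using p(1) by simp
    then obtain q where q: "{l \<in> L. \<bar>s l\<bar> = \<bar>s p\<bar>} = {p, q}" "q \<noteq> p"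
      using xy by (metis insert_commute insert_iff singletonD)
    have qL: "q \<in> L" using q(1) by auto
    \<comment> \<open>A pair of zeros and a pair with equal signs are both covered by this equation.\<close>
    have pq: "s p = s q" by (rule p(2)[OF qL q(1)])
    have "s' = s''" if s': "s' \<in> ?S" "s'' \<in> ?S" "word_pattern L s' = word_pattern L s"
      "word_pattern L s'' = word_pattern L s" "\<forall>l\<in>T - {t}. s' l = s'' l" for s' s''
    proof -
      have out: "s' l = s'' l" if l: "l \<in> L - {p, q}" for l
      proof -
        obtain t' where t': "t' \<in> T" "\<bar>s t'\<bar> = \<bar>s l\<bar>" using T(2) l by blast
        have "\<bar>s l\<bar> \<noteq> \<bar>s p\<bar>" using l q(1) by blast
        hence "t' \<noteq> t" using t' t by auto
        thus ?thesis using t' s' l T(1) word_pattern_propagate[OF s'(3,4), of t' l] by auto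
      qed
      have "(p, q) \<in> fst (word_pattern L s)" using pq p(1) qL by (simp add: word_pattern_def)
      hence e: "s' p = s' q" "s'' p = s'' q"
        using s'(3,4) by (metis (mono_tags, lifting) word_pattern_def case_prodD fst_conv mem_Collect_eq)+
      have sp: "sum u L = u p + u q + sum u (L - {p, q})" for u :: "'l \<Rightarrow> int"
        using L(1) p(1) qL q(2) by (subst sum.subset_diff[of "{p, q}" L]) auto
      have "sum s' (L - {p, q}) = sum s'' (L - {p, q})" using out by (intro sum.cong) auto
      hence "s' p = s'' p" using sp[of s'] sp[of s''] s'(1,2) e by auto
      hence "s' l = s'' l" if "l \<in> L" for l using out that e by (cases "l \<in> {p, q}") auto
      thus ?thesis using s' by (intro PiE_ext[of s' L _ s'']) auto
    qed
    moreover have "card (T - {t}) \<le> (card L - 1) div 2" using c finT t(1) by (simp add: card_Diff_singleton)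
    ultimately show ?thesis using T(1) by (intro exI[of _ "T - {t}"]) auto
  qed
qed

text \<open>
  Here \<open>L\<close> consists of the positions of several words, the rows; each row adds up to zero and each row shares an
  absolute value with another row. Two letters fewer than half of the positions are free. Either the
  transversal is already that small, or at most nine positions carry an absolute value that occurs three
  times or more. Since there are at least twelve rows, three of them contain only absolute values that
  occur exactly twice. In such a row \<open>r1\<close> take a letter whose partner lies in another row \<open>r1'\<close>, and do the
  same for a second such row \<open>r2\<close> different from \<open>r1\<close> and \<open>r1'\<close>. The zero sum of row \<open>r2\<close> determines its
  chosen letter because the letter of \<open>r1\<close> and its partner do not occur in \<open>r2\<close>; after that the zero sum
  of row \<open>r1\<close> determines the other one.
\<close>

lemma card_linked_words_le:
  fixes R :: "'r set" and n :: nat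
  assumes R: "finite R" "12 \<le> card R" and n: "n \<ge> 1"
  defines "L \<equiv> R \<times> {..<n}"
  shows "card {s \<in> L \<rightarrow>\<^sub>E {- int b..int b}. matched_word L s \<and> (\<forall>r\<in>R. (\<Sum>l<n. s (r, l)) = 0) \<and>
              (\<forall>r\<in>R. \<exists>l<n. \<exists>r'\<in>R. \<exists>l'<n. r' \<noteq> r \<and> \<bar>s (r', l')\<bar> = \<bar>s (r, l)\<bar>)}
           \<le> 4 ^ ((card L)\<^sup>2) * (2 * b + 1) ^ (card L div 2 - 2)" (is "card ?S \<le> _")
proof (rule card_words_le)
  show finL: "finite L" using R by (simp add: L_def)
  show "?S \<subseteq> L \<rightarrow>\<^sub>E {- int b..int b}" by auto
  have "12 * 1 \<le> card R * n" using R(2) n by (intro mult_mono) auto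
  hence cL: "card L \<ge> 12" by (simp add: L_def card_cartesian_product)
  fix s assume s: "s \<in> ?S"
  obtain T where T: "T \<subseteq> L" "\<And>l. l \<in> L \<Longrightarrow> \<exists>t\<in>T. \<bar>s t\<bar> = \<bar>s l\<bar>" "inj_on (\<lambda>l. \<bar>s l\<bar>) T"
    "card L = (\<Sum>t\<in>T. card {l \<in> L. \<bar>s l\<bar> = \<bar>s t\<bar>})" using word_transversal[OF finL, of s] by blast
  have finT: "finite T" using T(1) finL finite_subset by blast
  define k where "k t = card {l \<in> L. \<bar>s l\<bar> = \<bar>s t\<bar>}" for t
  have cls: "2 \<le> k p" if "p \<in> L" for p
    using s that matched_word_class_card[OF finL, of s p] by (auto simp: k_def)
  have cLk: "card L = (\<Sum>t\<in>T. k t)" using T(4) by (simp add: k_def)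
  have le: "2 * card T \<le> card L"
  proof -
    have "(\<Sum>t\<in>T. 2) \<le> (\<Sum>t\<in>T. k t)" using T(1) cls by (intro sum_mono) auto
    thus ?thesis by (simp add: cLk)
  qed
  show "\<exists>F\<subseteq>L. card F \<le> card L div 2 - 2 \<and>
       (\<forall>s'\<in>?S. \<forall>s''\<in>?S. word_pattern L s' = word_pattern L s \<longrightarrow> word_pattern L s'' = word_pattern L s \<longrightarrow>
          (\<forall>l\<in>F. s' l = s'' l) \<longrightarrow> s' = s'')"
  proof (cases "card T \<le> card L div 2 - 2")
    case True
    have "s' = s''" if s': "s' \<in> ?S" "s'' \<in> ?S" "word_pattern L s' = word_pattern L s"
      "word_pattern L s'' = word_pattern L s" "\<forall>l\<in>T. s' l = s'' l" for s' s''
    proof -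
      have "s' l = s'' l" if l: "l \<in> L" for l
      proof -
        obtain t where t: "t \<in> T" "\<bar>s t\<bar> = \<bar>s l\<bar>" using T(2) l by blast
        thus ?thesis using l T(1) s'(5) by (intro word_pattern_propagate[OF s'(3,4), of t l]) auto
      qed
      thus ?thesis using s' by (intro PiE_ext[of s' L _ s'']) auto
    qed
    thus ?thesis using T(1) True by (intro exI[of _ T]) auto
  next
    case False
    hence big: "card L \<le> 2 * card T + 3" using cL by linarith
    \<comment> \<open>In total the classes exceed size two by at most three, and a class of size \<open>k \<ge> 3\<close> has at most
      \<open>3 (k - 2)\<close> elements.\<close>
    define B where "B = {l \<in> L. k l \<ge> 3}"
    have "card B \<le> 9"
    proof -
      have sub2: "(\<Sum>t\<in>T. k t - 2) \<le> 3"
      proof -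
        have "(\<Sum>t\<in>T. k t - 2) + (\<Sum>t\<in>T. 2) = (\<Sum>t\<in>T. k t)"
          unfolding sum.distrib[symmetric] using T(1) cls
          by (intro sum.cong refl) (metis le_add_diff_inverse2 subsetD)
        thus ?thesis using big cLk by simp
      qed
      have kc: "k l = k t" if "\<bar>s t\<bar> = \<bar>s l\<bar>" for l t using that by (simp add: k_def)
      have "B \<subseteq> (\<Union>t\<in>{t\<in>T. k t \<ge> 3}. {l \<in> L. \<bar>s l\<bar> = \<bar>s t\<bar>})"
      proof
        fix l assume l: "l \<in> B"
        then obtain t where "t \<in> T" "\<bar>s t\<bar> = \<bar>s l\<bar>" using T(2)[of l] by (auto simp: B_def)
        thus "l \<in> (\<Union>t\<in>{t\<in>T. k t \<ge> 3}. {l \<in> L. \<bar>s l\<bar> = \<bar>s t\<bar>})"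
          using l kc[of t l] by (intro UN_I[of t]) (simp_all add: B_def)
      qed
      hence "card B \<le> card (\<Union>t\<in>{t\<in>T. k t \<ge> 3}. {l \<in> L. \<bar>s l\<bar> = \<bar>s t\<bar>})"
        using finL finT by (intro card_mono) auto
      also have "\<dots> \<le> (\<Sum>t\<in>{t\<in>T. k t \<ge> 3}. k t)"
        unfolding k_def using finT by (intro card_UN_le) auto
      also have "\<dots> \<le> (\<Sum>t\<in>{t\<in>T. k t \<ge> 3}. 3 * (k t - 2))" by (intro sum_mono) auto
      also have "\<dots> \<le> (\<Sum>t\<in>T. 3 * (k t - 2))" using finT by (intro sum_mono2) auto
      also have "\<dots> \<le> 9" using sub2 by (simp add: sum_distrib_left[symmetric])
      finally show ?thesis .
    qed
    \<comment> \<open>The rows in which every absolute value occurs exactly twice in \<open>L\<close>.\<close>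
    define G where "G = R - fst ` B"
    have "card (fst ` B) \<le> 9" using \<open>card B \<le> 9\<close> card_image_le[of B fst] finL by (simp add: B_def)
    hence cG: "3 \<le> card G"
      unfolding G_def using R diff_card_le_card_Diff[of "fst ` B" R] finL by (simp add: B_def)
    have good: "\<exists>l r' l'. l < n \<and> r' \<in> R \<and> l' < n \<and> r' \<noteq> r \<and> {x \<in> L. \<bar>s x\<bar> = \<bar>s (r, l)\<bar>} = {(r, l), (r', l')}"
      if r: "r \<in> G" for r
    proof -
      have rR: "r \<in> R" using r by (simp add: G_def)
      then obtain l r' l' where l: "l < n" "r' \<in> R" "l' < n" "r' \<noteq> r" "\<bar>s (r', l')\<bar> = \<bar>s (r, l)\<bar>"
        using s by blast
      have L1: "(r, l) \<in> L" "(r', l') \<in> L" using rR l by (auto simp: L_def)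
      have "(r, l) \<notin> B" using r unfolding G_def by (metis DiffD2 fst_conv imageI)
      hence "k (r, l) = 2" using cls[OF L1(1)] L1 by (auto simp: B_def)
      hence "{(r, l), (r', l')} = {x \<in> L. \<bar>s x\<bar> = \<bar>s (r, l)\<bar>}"
        using l L1 finL by (intro card_subset_eq) (auto simp: k_def)
      from l(1-4) this[symmetric] show ?thesis by (intro exI conjI)
    qed
    obtain r1 where r1: "r1 \<in> G" using cG by fastforce
    obtain l1 r1' l1' where V: "l1 < n" "r1' \<in> R" "l1' < n" "r1' \<noteq> r1"
      "{x \<in> L. \<bar>s x\<bar> = \<bar>s (r1, l1)\<bar>} = {(r1, l1), (r1', l1')}" using good[OF r1] by blast
    have "\<not> G \<subseteq> {r1, r1'}"
    proof
      assume "G \<subseteq> {r1, r1'}"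
      hence "card G \<le> card {r1, r1'}" by (intro card_mono) auto
      also have "\<dots> \<le> 2" by (simp add: card_insert_if)
      finally show False using cG by simp
    qed
    then obtain r2 where r2: "r2 \<in> G" "r2 \<noteq> r1" "r2 \<noteq> r1'" by auto
    obtain l2 r2' l2' where W: "l2 < n" "r2' \<in> R" "l2' < n" "r2' \<noteq> r2"
      "{x \<in> L. \<bar>s x\<bar> = \<bar>s (r2, l2)\<bar>} = {(r2, l2), (r2', l2')}" using good[OF r2(1)] by blast
    have R12: "r1 \<in> R" "r2 \<in> R" using r1 r2 by (auto simp: G_def)
    have L12: "(r1, l1) \<in> L" "(r2, l2) \<in> L" "(r1', l1') \<in> L" "(r2', l2') \<in> L" using R12 V W by (auto simp: L_def)
    obtain t1 where t1: "t1 \<in> T" "\<bar>s t1\<bar> = \<bar>s (r1, l1)\<bar>" using T(2)[OF L12(1)] by blast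
    obtain t2 where t2: "t2 \<in> T" "\<bar>s t2\<bar> = \<bar>s (r2, l2)\<bar>" using T(2)[OF L12(2)] by blast
    have Vx: "x \<in> {(r1, l1), (r1', l1')}" if "x \<in> L" "\<bar>s x\<bar> = \<bar>s (r1, l1)\<bar>" for x
      unfolding V(5)[symmetric] using that by simp
    have Wx: "x \<in> {(r2, l2), (r2', l2')}" if "x \<in> L" "\<bar>s x\<bar> = \<bar>s (r2, l2)\<bar>" for x
      unfolding W(5)[symmetric] using that by simp
    have VW: "\<bar>s (r2, l2)\<bar> \<noteq> \<bar>s (r1, l1)\<bar>" using Vx[OF L12(2)] r2 by auto
    have t12: "t1 \<noteq> t2" using t1 t2 VW by auto
    have "s' = s''" if s': "s' \<in> ?S" "s'' \<in> ?S" "word_pattern L s' = word_pattern L s"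
      "word_pattern L s'' = word_pattern L s" "\<forall>l\<in>T - {t1, t2}. s' l = s'' l" for s' s''
    proof -
      have out: "s' x = s'' x" if x: "x \<in> L" "\<bar>s x\<bar> \<noteq> \<bar>s (r1, l1)\<bar>" "\<bar>s x\<bar> \<noteq> \<bar>s (r2, l2)\<bar>" for x
      proof -
        obtain t' where t': "t' \<in> T" "\<bar>s t'\<bar> = \<bar>s x\<bar>" using T(2) x by blast
        have "t' \<notin> {t1, t2}" using t' t1 t2 x by auto
        thus ?thesis using t' s' x T(1) word_pattern_propagate[OF s'(3,4), of t' x] by auto
      qed
      have row: "s' (r, l) = s'' (r, l)"
        if "r \<in> R" "l < n" "\<And>i. i < n \<Longrightarrow> i \<noteq> l \<Longrightarrow> s' (r, i) = s'' (r, i)" for r l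
      proof -
        have "(\<Sum>i<n. s' (r, i)) = (\<Sum>i<n. s'' (r, i))" using s' that(1) by auto
        moreover have "(\<Sum>i<n. u (r, i)) = u (r, l) + (\<Sum>i\<in>{..<n} - {l}. u (r, i))" for u :: "'r \<times> nat \<Rightarrow> int"
          using that(2) by (simp add: sum.remove)
        moreover have "(\<Sum>i\<in>{..<n} - {l}. s' (r, i)) = (\<Sum>i\<in>{..<n} - {l}. s'' (r, i))"
          using that(3) by (intro sum.cong) auto
        ultimately show ?thesis by simp
      qed
      have "s' (r2, l2) = s'' (r2, l2)"
      proof (rule row[OF R12(2) W(1)])
        fix i assume i: "i < n" "i \<noteq> l2"
        have "(r2, i) \<in> L" using R12 i by (simp add: L_def)
        moreover have "\<bar>s (r2, i)\<bar> \<noteq> \<bar>s (r1, l1)\<bar>"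
          using Vx[OF \<open>(r2, i) \<in> L\<close>] r2 by auto
        moreover have "\<bar>s (r2, i)\<bar> \<noteq> \<bar>s (r2, l2)\<bar>"
          using Wx[OF \<open>(r2, i) \<in> L\<close>] W(4) i by auto
        ultimately show "s' (r2, i) = s'' (r2, i)" by (rule out)
      qed
      hence inW: "s' x = s'' x" if "x \<in> L" "\<bar>s x\<bar> = \<bar>s (r2, l2)\<bar>" for x
        using that L12 word_pattern_propagate[OF s'(3,4), of "(r2, l2)" x] by auto
      have "s' (r1, l1) = s'' (r1, l1)"
      proof (rule row[OF R12(1) V(1)])
        fix i assume i: "i < n" "i \<noteq> l1"
        have L: "(r1, i) \<in> L" using R12 i by (simp add: L_def)
        have "\<bar>s (r1, i)\<bar> \<noteq> \<bar>s (r1, l1)\<bar>"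
          using Vx[OF L] V(4) i by auto
        thus "s' (r1, i) = s'' (r1, i)" using out[OF L] inW[OF L] by blast
      qed
      hence inV: "s' x = s'' x" if "x \<in> L" "\<bar>s x\<bar> = \<bar>s (r1, l1)\<bar>" for x
        using that L12 word_pattern_propagate[OF s'(3,4), of "(r1, l1)" x] by auto
      have "s' x = s'' x" if "x \<in> L" for x using out inV inW that by blast
      thus ?thesis using s' by (intro PiE_ext[of s' L _ s'']) auto
    qed
    moreover have "card (T - {t1, t2}) \<le> card L div 2 - 2"
      using le finT t1 t2 t12 by (subst card_Diff_subset) auto
    ultimately show ?thesis using T(1) by (intro exI[of _ "T - {t1, t2}"]) auto
  qed
qed

section \<open>The rank of the system of a pairing\<close>

lemma (in vec_space) zero_in_span: "0\<^sub>v n \<in> span W"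
  by (rule in_spanI[of _ "\<lambda>_. 0" "{}"]) (auto simp: lincomb_def)

lemma (in vec_space) in_span_minus:
  assumes "W \<subseteq> carrier_vec n" "x \<in> span W" "y \<in> span W"
  shows "x - y \<in> span W"
proof -
  have c: "x \<in> carrier_vec n" "y \<in> carrier_vec n" using assms span_closed by auto
  have "x + (- 1) \<cdot>\<^sub>v y \<in> span W" using assms by (intro span_add1[simplified] smult_in_span)
  also have "x + (- 1) \<cdot>\<^sub>v y = x - y" using c by auto
  finally show ?thesis .
qed

text \<open>
  Let \<open>p\<close> and \<open>\<sigma> p\<close> be equivalent for all \<open>p\<close>, and let \<open>R\<close> be the set of smallest representatives of the
  classes. The system says that a solution is constant on classes, so there are \<open>m ^ card R\<close> solutions.
  The column space is spanned by the linearly independent vectors \<open>e\<^sub>p - e\<^sub>\<rho>\<^sub>p\<close> for \<open>p\<close> outside \<open>R\<close>, where \<open>\<rho> p\<close>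
  represents \<open>p\<close>: a column is the difference of two such vectors or zeros, and conversely \<open>e\<^sub>p - e\<^sub>\<rho>\<^sub>p\<close>
  telescopes along a chain from \<open>p\<close> to its representative.
\<close>

lemma rank_of_differences:
  fixes \<sigma> :: "nat \<Rightarrow> nat" and n m :: nat
  defines "M \<equiv> mat n n (\<lambda>(t, p). of_bool (t = p) - of_bool (t = \<sigma> p)) :: real mat"
  assumes \<sigma>: "\<And>p. p < n \<Longrightarrow> \<sigma> p < n"
  shows "vec_space.rank n M \<le> n"
    and "card {j \<in> {..<n} \<rightarrow>\<^sub>E {..<m}. \<forall>p<n. j p = j (\<sigma> p)} = m ^ (n - vec_space.rank n M)"
proof -
  interpret vec_space "TYPE(real)" n .
  define E where "E = ((\<lambda>p. (p, \<sigma> p)) ` {..<n} \<union> (\<lambda>p. (\<sigma> p, p)) ` {..<n})\<^sup>*"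
  have E_refl: "(p, p) \<in> E" for p by (simp add: E_def)
  have E_trans: "(p, r) \<in> E" if "(p, q) \<in> E" "(q, r) \<in> E" for p q r
    using that unfolding E_def by (rule rtrancl_trans)
  have symE: "sym E" unfolding E_def by (rule sym_rtrancl) (auto simp: sym_def)
  have E_sym: "(q, p) \<in> E" if "(p, q) \<in> E" for p q using symE that by (auto simp: sym_def)
  have E_step: "(p, \<sigma> p) \<in> E" if "p < n" for p using that unfolding E_def by (intro r_into_rtrancl) auto
  define \<rho> where "\<rho> p = (LEAST q. (p, q) \<in> E)" for p
  have \<rho>E: "(p, \<rho> p) \<in> E" for p unfolding \<rho>_def by (rule LeastI[of _ p]) (rule E_refl)
  have \<rho>le: "\<rho> p \<le> p" for p unfolding \<rho>_def by (rule Least_le) (rule E_refl)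
  have \<rho>eq: "\<rho> p = \<rho> q" if "(p, q) \<in> E" for p q
  proof -
    have "(p, x) \<in> E \<longleftrightarrow> (q, x) \<in> E" for x using that E_trans E_sym by blast
    thus ?thesis by (simp add: \<rho>_def)
  qed
  have \<rho>\<rho>: "\<rho> (\<rho> p) = \<rho> p" for p using \<rho>eq[OF \<rho>E] by simp
  define R where "R = \<rho> ` {..<n}"
  have R_sub: "R \<subseteq> {..<n}" using \<rho>le by (auto simp: R_def intro: le_less_trans)
  have R_fix: "\<rho> p = p" if "p \<in> R" for p using that \<rho>\<rho> by (auto simp: R_def)
  define N where "N = {..<n} - R"
  have cN: "card N = n - card R" unfolding N_def using R_sub by (simp add: card_Diff_subset finite_subset)
  have cR: "card R \<le> n" using card_mono[OF _ R_sub] by simp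

  \<comment> \<open>A solution of the system is a free choice of one value for each class.\<close>
  have "card {j \<in> {..<n} \<rightarrow>\<^sub>E {..<m}. \<forall>p<n. j p = j (\<sigma> p)} = card (R \<rightarrow>\<^sub>E {..<m})"
  proof (rule bij_betw_same_card[of "\<lambda>j. restrict j R"], rule bij_betwI[where g="\<lambda>f. \<lambda>p\<in>{..<n}. f (\<rho> p)"])
    have const: "j p = j q" if j: "\<forall>p<n. j p = j (\<sigma> p)" and pq: "(p, q) \<in> E" for j :: "nat \<Rightarrow> nat" and p q
      using pq unfolding E_def by (induction) (use j in auto)
    show "(\<lambda>f. \<lambda>p\<in>{..<n}. f (\<rho> p)) \<in> (R \<rightarrow>\<^sub>E {..<m}) \<rightarrow> {j \<in> {..<n} \<rightarrow>\<^sub>E {..<m}. \<forall>p<n. j p = j (\<sigma> p)}"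
    proof (rule Pi_I, rule CollectI, intro conjI allI impI)
      fix f assume f: "f \<in> R \<rightarrow>\<^sub>E {..<m}"
      show "(\<lambda>p\<in>{..<n}. f (\<rho> p)) \<in> {..<n} \<rightarrow>\<^sub>E {..<m}"
        using f by (intro restrict_PiE_iff[THEN iffD2] ballI) (auto simp: R_def)
      fix p assume p: "p < n"
      show "(\<lambda>p\<in>{..<n}. f (\<rho> p)) p = (\<lambda>p\<in>{..<n}. f (\<rho> p)) (\<sigma> p)"
        using p \<sigma>[OF p] \<rho>eq[OF E_step[OF p]] by simp
    qed
    show "(\<lambda>j. restrict j R) \<in> {j \<in> {..<n} \<rightarrow>\<^sub>E {..<m}. \<forall>p<n. j p = j (\<sigma> p)} \<rightarrow> R \<rightarrow>\<^sub>E {..<m}"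
      using R_sub by auto
    show "(\<lambda>p\<in>{..<n}. (restrict j R) (\<rho> p)) = j"
      if j: "j \<in> {j \<in> {..<n} \<rightarrow>\<^sub>E {..<m}. \<forall>p<n. j p = j (\<sigma> p)}" for j
    proof
      fix p
      show "(\<lambda>p\<in>{..<n}. (restrict j R) (\<rho> p)) p = j p"
      proof (cases "p < n")
        case True
        have "\<rho> p \<in> R" using True by (simp add: R_def)
        moreover have "j p = j (\<rho> p)" using const[OF _ \<rho>E] j by simp
        ultimately show ?thesis using True by simp
      next
        case False
        thus ?thesis using j PiE_arb[of j "{..<n}" "\<lambda>_. {..<m}" p] by simp
      qed
    qed
    show "restrict (\<lambda>p\<in>{..<n}. f (\<rho> p)) R = f" if f: "f \<in> R \<rightarrow>\<^sub>E {..<m}" for f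
    proof
      fix p
      show "restrict (\<lambda>p\<in>{..<n}. f (\<rho> p)) R p = f p"
      proof (cases "p \<in> R")
        case True
        hence "p < n" "\<rho> p = p" using R_sub R_fix by auto
        thus ?thesis using True by simp
      next
        case False
        thus ?thesis using PiE_arb[OF f] by simp
      qed
    qed
  qed
  hence sol: "card {j \<in> {..<n} \<rightarrow>\<^sub>E {..<m}. \<forall>p<n. j p = j (\<sigma> p)} = m ^ card R"
    using finite_subset[OF R_sub] by (simp add: card_PiE)

  define w where "w p = unit_vec n p - (unit_vec n (\<rho> p) :: real vec)" for p
  have w_car: "w p \<in> carrier_vec n" for p by (simp add: w_def)
  have \<rho>n: "\<rho> p < n" if "p < n" for p using \<rho>le[of p] that by simp
  have w_ent: "w p $ i = (if i = p then 1 else 0)" if "p \<in> N" "i \<in> N" for p i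
  proof -
    have "\<rho> p \<noteq> i" using that by (auto simp: N_def R_def)
    thus ?thesis using that by (auto simp: w_def N_def \<rho>n)
  qed
  have inj: "inj_on w N"
  proof (rule inj_onI)
    fix p q assume pq: "p \<in> N" "q \<in> N" "w p = w q"
    thus "p = q" using w_ent[of p p] w_ent[of q p] by (auto split: if_splits)
  qed
  define B where "B = w ` N"
  have finB: "finite B" by (simp add: B_def N_def)
  have B_car: "B \<subseteq> carrier_vec n" using w_car by (auto simp: B_def)
  have indpt: "lin_indpt B"
  proof
    assume "lin_dep B"
    then obtain A a v where A: "finite A" "A \<subseteq> B" "lincomb a A = 0\<^sub>v n" "v \<in> A" "a v \<noteq> 0"
      unfolding lin_dep_def by auto
    obtain p where p: "p \<in> N" "v = w p" using A by (auto simp: B_def)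
    have pn: "p < n" using p by (simp add: N_def)
    have "0 = lincomb a A $ p" using A(3) pn by simp
    also have "\<dots> = (\<Sum>x\<in>A. a x * x $ p)" using A B_car by (intro lincomb_index pn) auto
    also have "\<dots> = (\<Sum>x\<in>{v}. a x * x $ p)"
    proof (rule sum.mono_neutral_right[OF A(1)])
      show "\<forall>x\<in>A - {v}. a x * x $ p = 0"
      proof
        fix x assume x: "x \<in> A - {v}"
        then obtain q where "q \<in> N" "x = w q" using A by (auto simp: B_def)
        thus "a x * x $ p = 0" using x p w_ent[of q p] by auto
      qed
    qed (use A in auto)
    also have "\<dots> = a v" using p w_ent[of p p] by simp
    finally show False using A(5) by simp
  qed

  define C where "C = set (cols M)"
  have C: "C = (\<lambda>p. unit_vec n p - unit_vec n (\<sigma> p)) ` {..<n}"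
  proof -
    have "col M p = unit_vec n p - unit_vec n (\<sigma> p)" if "p < n" for p
      using that \<sigma>[OF that] by (intro eq_vecI) (auto simp: M_def)
    thus ?thesis by (auto simp: C_def cols_def M_def image_iff atLeast0LessThan)
  qed
  have C_car: "C \<subseteq> carrier_vec n" by (auto simp: C)
  have wB: "w p \<in> span B" if "p < n" for p
  proof (cases "p \<in> R")
    case True
    have "w p = 0\<^sub>v n" using R_fix[OF True] that by (auto simp: w_def)
    thus ?thesis using zero_in_span by simp
  next
    case False
    thus ?thesis using that in_own_span[of B] B_car by (auto simp: B_def N_def)
  qed
  have CB: "C \<subseteq> span B"
  proof
    fix x assume "x \<in> C"
    then obtain p where p: "p < n" "x = unit_vec n p - unit_vec n (\<sigma> p)" by (auto simp: C)
    have "x = w p - w (\<sigma> p)"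
      using p \<sigma>[OF p(1)] \<rho>eq[OF E_step[OF p(1)]] by (intro eq_vecI) (auto simp: w_def \<rho>n)
    thus "x \<in> span B" using wB p \<sigma> B_car by (simp add: in_span_minus)
  qed
  have diff: "unit_vec n p - unit_vec n q \<in> span C" if "(p, q) \<in> E" "p < n" for p q
  proof -
    have "q < n \<and> unit_vec n p - unit_vec n q \<in> span C"
      using that(1) unfolding E_def
    proof (induction)
      case base
      have z: "unit_vec n p - unit_vec n p = (0\<^sub>v n :: real vec)" by auto
      show ?case unfolding z using that zero_in_span by blast
    next
      case (step y z)
      have 1: "unit_vec n x - unit_vec n (\<sigma> x) \<in> span C" if "x < n" for x
        using in_own_span[of C] C_car that by (auto simp: C)
      from step(2) consider "z = \<sigma> y" "y < n" | "y = \<sigma> z" "z < n" by auto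
      thus ?case
      proof cases
        case 1
        have "unit_vec n y - unit_vec n z \<in> span C" using 1 in_own_span[of C] C_car by (auto simp: C)
        hence "(unit_vec n p - unit_vec n y) + (unit_vec n y - unit_vec n z) \<in> span C"
          using step.IH C_car span_add1[of C] by auto
        also have "(unit_vec n p - unit_vec n y) + (unit_vec n y - unit_vec n z) = (unit_vec n p - unit_vec n z :: real vec)"
          by auto
        finally show ?thesis using 1 \<sigma> by simp
      next
        case 2
        have "unit_vec n z - unit_vec n y \<in> span C" using 2 in_own_span[of C] C_car by (auto simp: C)
        hence "(unit_vec n p - unit_vec n y) - (unit_vec n z - unit_vec n y) \<in> span C"
          using in_span_minus[OF C_car conjunct2[OF step.IH]] by blast
        also have "(unit_vec n p - unit_vec n y) - (unit_vec n z - unit_vec n y) = (unit_vec n p - unit_vec n z :: real vec)"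
          by auto
        finally show ?thesis using 2 by simp
      qed
    qed
    thus ?thesis by simp
  qed
  have "B \<subseteq> span C" unfolding B_def w_def N_def using diff[OF \<rho>E] by auto
  hence span: "span C = span B" using CB span_subsetI B_car C_car by (metis subset_antisym)
  have "maximal B (\<lambda>T. T \<subseteq> B \<and> lin_indpt T)" using indpt by (auto simp: maximal_def)
  from dim_span[OF _ finB this] have "vectorspace.dim class_ring (span_vs B) = card B"
    using B_car by simp
  hence "rank M = card B" unfolding rank_def C_def[symmetric] span .
  hence rk: "rank M = n - card R" using inj by (simp add: B_def card_image cN)
  show "rank M \<le> n" unfolding rk by simp
  show "card {j \<in> {..<n} \<rightarrow>\<^sub>E {..<m}. \<forall>p<n. j p = j (\<sigma> p)} = m ^ (n - rank M)"
    unfolding rk sol using cR by simp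
qed

section \<open>Pair partitions\<close>

lemma pair_partition_partner:
  assumes \<pi>: "\<pi> \<in> pair_partitions n" and p: "p < n"
  shows "partner \<pi> p \<noteq> p" "{p, partner \<pi> p} \<in> \<pi>" "partner \<pi> p < n"
    "\<And>q. q \<noteq> p \<Longrightarrow> {p, q} \<in> \<pi> \<Longrightarrow> partner \<pi> p = q"
proof -
  have part: "partition_on {..<n} \<pi>" and two: "\<And>V. V \<in> \<pi> \<Longrightarrow> card V = 2"
    using \<pi> by (auto simp: pair_partitions_def)
  have U: "\<Union>\<pi> = {..<n}" using part by (simp add: partition_on_def)
  obtain V where V: "V \<in> \<pi>" "p \<in> V" using U p by blast
  obtain x y where xy: "V = {x, y}" "x \<noteq> y" using two[OF V(1)] by (auto simp: card_2_iff)
  define q where "q = (if p = x then y else x)"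
  have q: "q \<noteq> p" "{p, q} \<in> \<pi>" using V xy by (auto simp: q_def insert_commute split: if_splits)
  have uniq: "q' = q" if "q' \<noteq> p" "{p, q'} \<in> \<pi>" for q'
  proof -
    have "{p, q'} = {p, q}"
      using part that(2) q(2) by (auto simp: partition_on_def dest: disjointD)
    thus ?thesis using that(1) by (metis doubleton_eq_iff)
  qed
  have the: "partner \<pi> p = q" unfolding partner_def
  proof (rule the_equality)
    show "q \<noteq> p \<and> {p, q} \<in> \<pi>" using q by simp
    show "q' = q" if "q' \<noteq> p \<and> {p, q'} \<in> \<pi>" for q' using uniq that by blast
  qed
  show "partner \<pi> p \<noteq> p" "{p, partner \<pi> p} \<in> \<pi>" using q by (simp_all add: the)
  show "partner \<pi> p < n" using q(2) U by (auto simp: the)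
  show "partner \<pi> p = q'" if "q' \<noteq> p" "{p, q'} \<in> \<pi>" for q' using uniq[OF that] the by simp
qed

lemma partner_partner:
  assumes "\<pi> \<in> pair_partitions n" "p < n"
  shows "partner \<pi> (partner \<pi> p) = p"
  using pair_partition_partner[OF assms] pair_partition_partner(4)[OF assms(1), of "partner \<pi> p" p]
  by (metis insert_commute)

lemma pair_partition_eq_image:
  assumes \<pi>: "\<pi> \<in> pair_partitions n"
  shows "\<pi> = (\<lambda>p. {p, partner \<pi> p}) ` {..<n}"
proof
  show "(\<lambda>p. {p, partner \<pi> p}) ` {..<n} \<subseteq> \<pi>" using pair_partition_partner(2)[OF \<pi>] by auto
  show "\<pi> \<subseteq> (\<lambda>p. {p, partner \<pi> p}) ` {..<n}"
  proof
    fix V assume V: "V \<in> \<pi>"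
    have "card V = 2" "V \<subseteq> {..<n}" using \<pi> V by (auto simp: pair_partitions_def partition_on_def)
    then obtain x y where xy: "V = {x, y}" "x \<noteq> y" "x < n" by (auto simp: card_2_iff)
    hence "partner \<pi> x = y" using V by (intro pair_partition_partner(4)[OF \<pi>]) auto
    thus "V \<in> (\<lambda>p. {p, partner \<pi> p}) ` {..<n}" using xy by auto
  qed
qed

lemma finite_pair_partitions: "finite (pair_partitions n)"
proof (rule finite_subset)
  show "pair_partitions n \<subseteq> Pow (Pow {..<n})" by (auto simp: pair_partitions_def partition_on_def)
qed simp

lemma sum_partner:
  assumes \<pi>: "\<pi> \<in> pair_partitions n"
  shows "(\<Sum>p<n. f (partner \<pi> p)) = (\<Sum>p<n. f p)"
  by (rule sum.reindex_bij_witness[where i="partner \<pi>" and j="partner \<pi>"])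
     (use pair_partition_partner(3)[OF \<pi>] partner_partner[OF \<pi>] in auto)

lemma pair_partition_halves:
  assumes \<pi>: "\<pi> \<in> pair_partitions n"
  defines "T \<equiv> {t. t < n \<and> t < partner \<pi> t}"
  shows "inj_on (partner \<pi>) T" "{..<n} = T \<union> partner \<pi> ` T" "T \<inter> partner \<pi> ` T = {}" "2 * card T = n"
proof -
  note pp = pair_partition_partner[OF \<pi>] partner_partner[OF \<pi>]
  show inj: "inj_on (partner \<pi>) T" by (rule inj_on_inverseI[of _ "partner \<pi>"]) (simp add: T_def pp)
  show un: "{..<n} = T \<union> partner \<pi> ` T"
  proof (intro equalityI subsetI)
    fix p assume "p \<in> {..<n}"
    hence p: "p < n" by simp
    show "p \<in> T \<union> partner \<pi> ` T"
    proof (cases "p < partner \<pi> p")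
      case True
      thus ?thesis using p by (simp add: T_def)
    next
      case False
      hence "partner \<pi> p \<in> T" using pp(1,3,5)[OF p] by (simp add: T_def)
      moreover have "p = partner \<pi> (partner \<pi> p)" using pp(5)[OF p] by simp
      ultimately show ?thesis by blast
    qed
  qed (use pp in \<open>auto simp: T_def\<close>)
  show dis: "T \<inter> partner \<pi> ` T = {}" by (auto simp: T_def pp)
  have "finite T" by (simp add: T_def)
  have "n = card (T \<union> partner \<pi> ` T)" by (simp add: un[symmetric])
  also have "\<dots> = card T + card (partner \<pi> ` T)" using \<open>finite T\<close> dis by (intro card_Un_disjoint) auto
  finally show "2 * card T = n" by (simp add: card_image[OF inj])
qed

text \<open>
  The words that cancel along the pairs of \<open>\<pi>\<close>; they may have further coincidences.
\<close>

definition pairing_words :: "nat \<Rightarrow> nat \<Rightarrow> nat set set \<Rightarrow> (nat \<Rightarrow> int) set" where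
  "pairing_words n b \<pi> = {s \<in> {..<n} \<rightarrow>\<^sub>E {- int b..int b}. \<forall>p<n. s p = - s (partner \<pi> p)}"

text \<open>
  The solutions with values in \<open>{..<m}\<close> of the linear system that defines \<open>pairing_rank\<close>.
\<close>

definition pairing_solutions :: "nat \<Rightarrow> nat \<Rightarrow> nat set set \<Rightarrow> (nat \<Rightarrow> nat) set" where
  "pairing_solutions n m \<pi> = {j \<in> {..<n} \<rightarrow>\<^sub>E {..<m}. \<forall>p<n. j p = j ((partner \<pi> p + 1) mod n)}"

lemma card_pairing_solutions_le: "card (pairing_solutions n m \<pi>) \<le> m ^ n"
proof -
  have "card (pairing_solutions n m \<pi>) \<le> card ({..<n} \<rightarrow>\<^sub>E {..<m})"
    by (intro card_mono finite_PiE) (auto simp: pairing_solutions_def)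
  thus ?thesis by (simp add: card_PiE)
qed

text \<open>
  The letters at the smaller elements of the pairs can be chosen freely.
\<close>

lemma card_pairing_words:
  assumes \<pi>: "\<pi> \<in> pair_partitions n"
  shows "card (pairing_words n b \<pi>) = (2 * b + 1) ^ (n div 2)"
proof -
  define T where "T = {t. t < n \<and> t < partner \<pi> t}"
  note half = pair_partition_halves[OF \<pi>, folded T_def]
  note pp = pair_partition_partner[OF \<pi>] partner_partner[OF \<pi>]
  define ext where "ext v = (\<lambda>p\<in>{..<n}. if p < partner \<pi> p then v p else - v (partner \<pi> p))" for v :: "nat \<Rightarrow> int"
  have "card (pairing_words n b \<pi>) = card (T \<rightarrow>\<^sub>E {- int b..int b})"
  proof (rule bij_betw_same_card[of "\<lambda>s. restrict s T"], rule bij_betwI[where g=ext])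
    show "(\<lambda>s. restrict s T) \<in> pairing_words n b \<pi> \<rightarrow> T \<rightarrow>\<^sub>E {- int b..int b}"
    proof (rule Pi_I, rule restrict_PiE_iff[THEN iffD2], rule ballI)
      fix s t assume "s \<in> pairing_words n b \<pi>" "t \<in> T"
      thus "s t \<in> {- int b..int b}" by (intro PiE_mem[of s "{..<n}"]) (auto simp: pairing_words_def T_def)
    qed
    have Tn: "p \<in> T \<or> partner \<pi> p \<in> T" if "p < n" for p using pp(1,3,5)[OF that] that by (auto simp: T_def)
    show "ext \<in> (T \<rightarrow>\<^sub>E {- int b..int b}) \<rightarrow> pairing_words n b \<pi>"
    proof (rule Pi_I)
      fix v assume v: "v \<in> T \<rightarrow>\<^sub>E {- int b..int b}"
      have "ext v \<in> {..<n} \<rightarrow>\<^sub>E {- int b..int b}"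
        unfolding ext_def
      proof (rule restrict_PiE_iff[THEN iffD2], rule ballI)
        fix p assume "p \<in> {..<n}"
        hence p: "p < n" by simp
        show "(if p < partner \<pi> p then v p else - v (partner \<pi> p)) \<in> {- int b..int b}"
          using PiE_mem[OF v, of p] PiE_mem[OF v, of "partner \<pi> p"] p pp(1,3,5)[OF p] by (auto simp: T_def)
      qed
      moreover have "ext v p = - ext v (partner \<pi> p)" if "p < n" for p
        using that pp(1,3,5)[OF that] by (auto simp: ext_def)
      ultimately show "ext v \<in> pairing_words n b \<pi>" by (simp add: pairing_words_def)
    qed
    show "ext (restrict s T) = s" if s: "s \<in> pairing_words n b \<pi>" for s
    proof
      fix p
      show "ext (restrict s T) p = s p"
      proof (cases "p < n")
        case True
        have "s p = - s (partner \<pi> p)" using s True by (simp add: pairing_words_def)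
        thus ?thesis using True pp(1,3,5)[OF True] by (auto simp: ext_def T_def)
      next
        case False
        thus ?thesis using s PiE_arb[of s "{..<n}" "\<lambda>_. {- int b..int b}" p]
          by (simp add: ext_def pairing_words_def)
      qed
    qed
    show "restrict (ext v) T = v" if v: "v \<in> T \<rightarrow>\<^sub>E {- int b..int b}" for v
    proof
      fix p
      show "restrict (ext v) T p = v p"
      proof (cases "p \<in> T")
        case True
        thus ?thesis by (simp add: ext_def T_def)
      next
        case False
        thus ?thesis using PiE_arb[OF v, of p] by simp
      qed
    qed
  qed
  also have "\<dots> = (2 * b + 1) ^ card T"
    by (simp add: card_PiE T_def nat_add_distrib nat_mult_distrib)
  also have "card T = n div 2" using half(4) by simp
  finally show ?thesis .
qed

lemma pairing_words_matched:
  assumes \<pi>: "\<pi> \<in> pair_partitions n" and s: "s \<in> pairing_words n b \<pi>"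
  shows "matched_word {..<n} s" "sum s {..<n} = 0"
proof -
  have e: "s p = - s (partner \<pi> p)" if "p < n" for p using s that by (simp add: pairing_words_def)
  show "matched_word {..<n} s"
    unfolding matched_word_def
  proof
    fix p assume "p \<in> {..<n}"
    hence p: "p < n" by simp
    show "\<exists>q\<in>{..<n}. q \<noteq> p \<and> \<bar>s q\<bar> = \<bar>s p\<bar>"
      using pair_partition_partner(1,3)[OF \<pi> p] e[OF p] by (intro bexI[of _ "partner \<pi> p"]) auto
  qed
  have "sum s {..<n} = (\<Sum>p<n. - s (partner \<pi> p))" using e by (intro sum.cong) auto
  also have "\<dots> = - sum s {..<n}" by (simp add: sum_negf sum_partner[OF \<pi>, of s])
  finally show "sum s {..<n} = 0" by simp
qed

text \<open>
  The absolute values of a paired word group the positions into pairs, and this is the only pairing along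
  which the word cancels.
\<close>

lemma paired_word_pair_partition:
  assumes s: "s \<in> {..<n} \<rightarrow>\<^sub>E {- int b..int b}" and pw: "paired_word {..<n} s"
  shows "\<exists>\<pi>\<in>pair_partitions n. s \<in> pairing_words n b \<pi> \<and> (\<forall>\<pi>'\<in>pair_partitions n. s \<in> pairing_words n b \<pi>' \<longrightarrow> \<pi>' = \<pi>) \<and>
     (\<forall>p<n. \<forall>q<n. \<bar>s q\<bar> = \<bar>s p\<bar> \<longrightarrow> q \<in> {p, partner \<pi> p}) \<and> (\<forall>p<n. s p \<noteq> 0)"
proof -
  define cl where "cl p = {l \<in> {..<n}. \<bar>s l\<bar> = \<bar>s p\<bar>}" for p
  define \<pi> where "\<pi> = cl ` {..<n}"
  have cl: "\<exists>q<n. cl p = {p, q} \<and> q \<noteq> p \<and> s p \<noteq> s q \<and> s p = - s q" if "p < n" for p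
  proof -
    have "\<exists>q\<in>{..<n}. cl p = {p, q} \<and> s p \<noteq> s q"
      using pw that unfolding paired_word_def cl_def by blast
    then obtain q where q: "q < n" "cl p = {p, q}" "s p \<noteq> s q" by blast
    have "q \<in> cl p" using q(2) by simp
    hence "\<bar>s q\<bar> = \<bar>s p\<bar>" by (simp add: cl_def)
    hence "s p = - s q" using q(3) by linarith
    thus ?thesis using q by auto
  qed
  have c2: "card (cl p) = 2" if "p < n" for p using cl[OF that] by auto
  have \<pi>: "\<pi> \<in> pair_partitions n"
    unfolding pair_partitions_def
  proof (intro CollectI conjI ballI)
    show "card V = 2" if "V \<in> \<pi>" for V using that c2 by (auto simp: \<pi>_def)
    show "partition_on {..<n} \<pi>"
    proof (rule partition_onI)
      show "\<Union>\<pi> = {..<n}" by (auto simp: \<pi>_def cl_def)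
      show "{} \<notin> \<pi>" by (auto simp: \<pi>_def cl_def)
      show "disjnt V W" if "V \<in> \<pi>" "W \<in> \<pi>" "V \<noteq> W" for V W
        using that by (auto simp: \<pi>_def cl_def disjnt_def)
    qed
  qed
  have part: "cl p = {p, partner \<pi> p}" if p: "p < n" for p
  proof -
    obtain q where q: "cl p = {p, q}" "q \<noteq> p" using cl[OF p] by blast
    have "partner \<pi> p = q"
      by (rule pair_partition_partner(4)[OF \<pi> p q(2)]) (use p q(1) in \<open>auto simp: \<pi>_def\<close>)
    thus ?thesis using q by simp
  qed
  have neg: "s p = - s (partner \<pi> p)" "s p \<noteq> 0" if p: "p < n" for p
    using cl[OF p] part[OF p] by (auto simp: doubleton_eq_iff)
  have "\<pi>' = \<pi>" if \<pi>': "\<pi>' \<in> pair_partitions n" "s \<in> pairing_words n b \<pi>'" for \<pi>'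
  proof -
    have "{p, partner \<pi>' p} = cl p" if p: "p < n" for p
    proof (rule card_subset_eq)
      have "s p = - s (partner \<pi>' p)" using \<pi>' p by (simp add: pairing_words_def)
      thus "{p, partner \<pi>' p} \<subseteq> cl p" using pair_partition_partner(3)[OF \<pi>'(1) p] p by (simp add: cl_def)
      show "card {p, partner \<pi>' p} = card (cl p)" using c2[OF p] pair_partition_partner(1)[OF \<pi>'(1) p] by auto
    qed (simp add: cl_def)
    thus ?thesis using pair_partition_eq_image[OF \<pi>'(1)] by (auto simp: \<pi>_def image_iff)
  qed
  moreover have "q \<in> {p, partner \<pi> p}" if "p < n" "q < n" "\<bar>s q\<bar> = \<bar>s p\<bar>" for p q
    unfolding part[OF that(1), symmetric] using that by (simp add: cl_def)
  ultimately show ?thesis using \<pi> s neg by (intro bexI[of _ \<pi>]) (auto simp: pairing_words_def)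
qed

text \<open>
  The count of label solutions, normalised as in the moment formula, is the summand of the theorem.
\<close>

lemma card_pairing_solutions:
  assumes k: "k \<ge> 1" and \<pi>: "\<pi> \<in> pair_partitions (2 * k)" and m: "m \<ge> 1"
  shows "real (card (pairing_solutions (2 * k) m \<pi>)) / real m ^ (k + 1) =
    real m powi (int k - 1 - int (pairing_rank k \<pi>))"
proof -
  define \<sigma> where "\<sigma> p = (partner \<pi> p + 1) mod (2 * k)" for p
  have \<sigma>: "\<sigma> p < 2 * k" for p using k by (simp add: \<sigma>_def)
  note rk = rank_of_differences[of "2 * k" \<sigma>, OF \<sigma>]
  have r: "pairing_rank k \<pi> = vec_space.rank (2 * k) (mat (2 * k) (2 * k) (\<lambda>(t, p). of_bool (t = p) - of_bool (t = \<sigma> p)) :: real mat)"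
    by (simp add: pairing_rank_def pairing_system_def \<sigma>_def)
  have "card (pairing_solutions (2 * k) m \<pi>) = m ^ (2 * k - pairing_rank k \<pi>)"
    unfolding r rk(2)[symmetric] by (simp add: pairing_solutions_def \<sigma>_def)
  hence "real (card (pairing_solutions (2 * k) m \<pi>)) = real m powi (int (2 * k - pairing_rank k \<pi>))"
    by simp
  moreover have "int (2 * k - pairing_rank k \<pi>) - int (k + 1) = int k - 1 - int (pairing_rank k \<pi>)"
    using rk(1) r by simp
  moreover have "real m powi (int (2 * k - pairing_rank k \<pi>) - int (k + 1)) =
      real m powi int (2 * k - pairing_rank k \<pi>) / real m powi int (k + 1)"
    using m by (intro power_int_diff) auto
  ultimately show ?thesis by (simp only: power_int_of_nat)
qed

text \<open>
  A fixed point has at most \<open>card A - 1\<close> possible partners; removing the pair leaves a pair partition of the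
  remaining points.
\<close>

lemma card_pair_partitions_le:
  "finite A \<Longrightarrow> card {\<pi>. partition_on A \<pi> \<and> (\<forall>V\<in>\<pi>. card V = 2)} \<le> 2 ^ (card A div 2) * fact (card A div 2)"
proof (induction "card A" arbitrary: A rule: less_induct)
  case less
  define PP where "PP B = {\<pi>. partition_on B \<pi> \<and> (\<forall>V\<in>\<pi>. card V = 2)}" for B :: "'a set"
  have finPP: "finite (PP B)" if "finite B" for B
    by (rule finite_subset[of _ "Pow (Pow B)"]) (use that in \<open>auto simp: PP_def partition_on_def\<close>)
  show ?case
  proof (cases "A = {}")
    case True
    have "PP A \<subseteq> {{}}" using True by (auto simp: PP_def partition_on_def)
    hence "card (PP A) \<le> 1" using card_mono[of "{{}}" "PP A"] by simp
    thus ?thesis using True by (simp add: PP_def)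
  next
    case False
    then obtain x where x: "x \<in> A" by blast
    have sub: "PP A \<subseteq> (\<Union>y\<in>A - {x}. insert {x, y} ` PP (A - {x, y}))"
    proof
      fix \<pi> assume \<pi>: "\<pi> \<in> PP A"
      then obtain V where V: "V \<in> \<pi>" "x \<in> V" using x by (auto simp: PP_def partition_on_def)
      have "card V = 2" using \<pi> V by (simp add: PP_def)
      then obtain y where y: "V = {x, y}" "y \<noteq> x" using V(2) by (auto simp: card_2_iff)
      have yA: "y \<in> A - {x}" using \<pi> V y by (auto simp: PP_def partition_on_def)
      have part: "partition_on A \<pi>" using \<pi> by (simp add: PP_def)
      have "\<Union>(\<pi> - {V}) = A - V"
      proof
        show "\<Union>(\<pi> - {V}) \<subseteq> A - V"
          using part V(1) unfolding partition_on_def by (fastforce dest: disjointD)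
        show "A - V \<subseteq> \<Union>(\<pi> - {V})" using part by (auto simp: partition_on_def)
      qed
      hence "partition_on (A - V) (\<pi> - {V})"
        using part unfolding partition_on_def by (auto intro: pairwise_subset)
      hence "\<pi> - {V} \<in> PP (A - {x, y})" using \<pi> y by (auto simp: PP_def)
      moreover have "\<pi> = insert {x, y} (\<pi> - {V})" using V y by auto
      ultimately show "\<pi> \<in> (\<Union>y\<in>A - {x}. insert {x, y} ` PP (A - {x, y}))" using yA by blast
    qed
    have IH: "card (PP (A - {x, y})) \<le> 2 ^ ((card A - 2) div 2) * fact ((card A - 2) div 2)" if "y \<in> A - {x}" for y
    proof -
      have "card (A - {x, y}) = card A - 2" using x that less.prems by (subst card_Diff_subset) auto
      moreover have "card A > 0" using x less.prems by (auto simp: card_gt_0_iff)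
      ultimately show ?thesis using less.hyps[of "A - {x, y}"] less.prems by (simp add: PP_def)
    qed
    have "card (PP A) \<le> card (\<Union>y\<in>A - {x}. insert {x, y} ` PP (A - {x, y}))"
      using sub less.prems finPP by (intro card_mono) auto
    also have "\<dots> \<le> (\<Sum>y\<in>A - {x}. card (insert {x, y} ` PP (A - {x, y})))"
      using less.prems by (intro card_UN_le) auto
    also have "\<dots> \<le> (\<Sum>y\<in>A - {x}. 2 ^ ((card A - 2) div 2) * fact ((card A - 2) div 2))"
      by (intro sum_mono order_trans[OF card_image_le IH] finPP) (use less.prems in auto)
    also have "\<dots> = (card A - 1) * (2 ^ ((card A - 2) div 2) * fact ((card A - 2) div 2))"
      using x less.prems by (simp add: card_Diff_singleton)
    also have "\<dots> \<le> 2 ^ (card A div 2) * fact (card A div 2)"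
    proof (cases "card A \<ge> 2")
      case True
      define c where "c = (card A - 2) div 2"
      have c: "card A div 2 = Suc c" using True by (auto simp: c_def)
      have "card A - 1 \<le> 2 * (card A div 2)" by presburger
      hence "card A - 1 \<le> 2 * Suc c" by (simp only: c)
      hence "(card A - 1) * (2 ^ c * fact c) \<le> (2 * Suc c) * (2 ^ c * fact c)" by (intro mult_right_mono) auto
      also have "\<dots> = 2 ^ Suc c * fact (Suc c)" by (simp add: algebra_simps)
      finally show ?thesis by (simp only: c c_def[symmetric])
    next
      case False
      hence "card A - 1 = 0" by simp
      thus ?thesis by simp
    qed
    finally show ?thesis by (simp add: PP_def)
  qed
qed

section \<open>Products of independent centred variables\<close>

lemma abs_prod_le_sum_power:
  fixes x :: "'l \<Rightarrow> real"
  assumes L: "finite L" "L \<noteq> {}"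
  shows "\<bar>\<Prod>p\<in>L. x p\<bar> \<le> (\<Sum>p\<in>L. \<bar>x p\<bar> ^ card L)"
proof -
  obtain q where q: "q \<in> L" "\<And>p. p \<in> L \<Longrightarrow> \<bar>x p\<bar> \<le> \<bar>x q\<bar>"
  proof -
    have "Max ((\<lambda>p. \<bar>x p\<bar>) ` L) \<in> (\<lambda>p. \<bar>x p\<bar>) ` L" using L by (intro Max_in) auto
    then obtain q where "q \<in> L" "Max ((\<lambda>p. \<bar>x p\<bar>) ` L) = \<bar>x q\<bar>" by auto
    thus ?thesis using that[of q] L by (metis Max_ge finite_imageI imageI)
  qed
  have "\<bar>\<Prod>p\<in>L. x p\<bar> = (\<Prod>p\<in>L. \<bar>x p\<bar>)" by (rule abs_prod)
  also have "\<dots> \<le> (\<Prod>p\<in>L. \<bar>x q\<bar>)" using q by (intro prod_mono) auto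
  also have "\<dots> = \<bar>x q\<bar> ^ card L" by simp
  also have "\<dots> \<le> (\<Sum>p\<in>L. \<bar>x p\<bar> ^ card L)" using q L by (intro member_le_sum) auto
  finally show ?thesis .
qed

lemma abs_diff_power_le:
  fixes x c :: real
  shows "\<bar>x - c\<bar> ^ g \<le> 2 ^ g * (\<bar>x\<bar> ^ g + \<bar>c\<bar> ^ g)"
proof -
  have "\<bar>x - c\<bar> ^ g \<le> (2 * max \<bar>x\<bar> \<bar>c\<bar>) ^ g" by (intro power_mono) auto
  also have "\<dots> = 2 ^ g * max \<bar>x\<bar> \<bar>c\<bar> ^ g" by (simp add: power_mult_distrib)
  also have "max \<bar>x\<bar> \<bar>c\<bar> ^ g \<le> \<bar>x\<bar> ^ g + \<bar>c\<bar> ^ g" by (auto simp: max_def)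
  finally show ?thesis by simp
qed

context prob_space
begin

text \<open>
  Random variables with absolute moments of all orders form an algebra, so every polynomial expression in
  the entries is integrable.
\<close>

definition has_moments :: "('a \<Rightarrow> real) \<Rightarrow> bool" where
  "has_moments Z \<longleftrightarrow> (\<forall>k. integrable M (\<lambda>\<omega>. \<bar>Z \<omega>\<bar> ^ k)) \<and> Z \<in> borel_measurable M"

lemma has_moments_integrable:
  assumes "has_moments Z"
  shows "integrable M Z" "integrable M (\<lambda>\<omega>. \<bar>Z \<omega>\<bar> ^ k)" "integrable M (\<lambda>\<omega>. Z \<omega> ^ k)"
proof -
  show 1: "integrable M (\<lambda>\<omega>. \<bar>Z \<omega>\<bar> ^ k)" for k using assms by (simp add: has_moments_def)
  have m: "Z \<in> borel_measurable M" using assms by (simp add: has_moments_def)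
  show "integrable M Z" by (rule Bochner_Integration.integrable_bound[OF 1[of 1] m]) simp
  show "integrable M (\<lambda>\<omega>. Z \<omega> ^ k)"
    using m by (intro Bochner_Integration.integrable_bound[OF 1[of k]]) (auto simp: power_abs)
qed

lemma has_moments_const: "has_moments (\<lambda>_. c)"
  by (simp add: has_moments_def)

lemma has_moments_diff:
  assumes "has_moments Z"
  shows "has_moments (\<lambda>\<omega>. Z \<omega> - c)"
  unfolding has_moments_def
proof (intro conjI allI)
  have [measurable]: "Z \<in> borel_measurable M" using assms by (simp add: has_moments_def)
  show "(\<lambda>\<omega>. Z \<omega> - c) \<in> borel_measurable M" by measurable
  fix k
  show "integrable M (\<lambda>\<omega>. \<bar>Z \<omega> - c\<bar> ^ k)"
    by (rule Bochner_Integration.integrable_bound[where f="\<lambda>\<omega>. 2 ^ k * (\<bar>Z \<omega>\<bar> ^ k + \<bar>c\<bar> ^ k)"])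
       (use has_moments_integrable(2)[OF assms] abs_diff_power_le in \<open>auto intro!: AE_I2\<close>)
qed

lemma has_moments_mult:
  assumes "has_moments Z" "has_moments W"
  shows "has_moments (\<lambda>\<omega>. Z \<omega> * W \<omega>)"
  unfolding has_moments_def
proof (intro conjI allI)
  have [measurable]: "Z \<in> borel_measurable M" "W \<in> borel_measurable M" using assms by (auto simp: has_moments_def)
  show "(\<lambda>\<omega>. Z \<omega> * W \<omega>) \<in> borel_measurable M" by measurable
  fix k
  show "integrable M (\<lambda>\<omega>. \<bar>Z \<omega> * W \<omega>\<bar> ^ k)"
  proof (rule Bochner_Integration.integrable_bound)
    show "integrable M (\<lambda>\<omega>. \<bar>Z \<omega>\<bar> ^ (2 * k) + \<bar>W \<omega>\<bar> ^ (2 * k))"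
      using has_moments_integrable(2)[OF assms(1)] has_moments_integrable(2)[OF assms(2)] by simp
    show "AE \<omega> in M. norm (\<bar>Z \<omega> * W \<omega>\<bar> ^ k) \<le> norm (\<bar>Z \<omega>\<bar> ^ (2 * k) + \<bar>W \<omega>\<bar> ^ (2 * k))"
    proof (rule AE_I2)
      fix \<omega>
      define x y where "x = \<bar>Z \<omega>\<bar> ^ k" and "y = \<bar>W \<omega>\<bar> ^ k"
      have "0 \<le> (x - y)\<^sup>2" "0 \<le> x * y" by (simp_all add: x_def y_def)
      hence "x * y \<le> x\<^sup>2 + y\<^sup>2" by (simp add: power2_diff)
      thus "norm (\<bar>Z \<omega> * W \<omega>\<bar> ^ k) \<le> norm (\<bar>Z \<omega>\<bar> ^ (2 * k) + \<bar>W \<omega>\<bar> ^ (2 * k))"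
        by (simp add: x_def y_def abs_mult power_mult_distrib power_mult[symmetric] mult.commute)
    qed
  qed measurable
qed

lemma has_moments_prod:
  assumes "\<And>p. p \<in> L \<Longrightarrow> has_moments (Z p)"
  shows "has_moments (\<lambda>\<omega>. \<Prod>p\<in>L. Z p \<omega>)"
  using assms
  by (induction L rule: infinite_finite_induct) (auto intro: has_moments_mult has_moments_const)

end

text \<open>
  The bounds \<open>C\<close> are explicit because the estimates below have to be uniform in the size of the matrix.
\<close>

locale centred_independent_family = prob_space M for M :: "'a measure" +
  fixes X :: "'e \<Rightarrow> 'a \<Rightarrow> real" and I :: "'e set" and C :: "nat \<Rightarrow> real"
  assumes indep: "indep_vars (\<lambda>_. borel) X I"
    and mean: "\<And>e. e \<in> I \<Longrightarrow> expectation (X e) = 0"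
    and variance: "\<And>e. e \<in> I \<Longrightarrow> expectation (\<lambda>\<omega>. (X e \<omega>)\<^sup>2) = 1"
    and moment_integrable: "\<And>e k. e \<in> I \<Longrightarrow> integrable M (\<lambda>\<omega>. \<bar>X e \<omega>\<bar> ^ k)"
    and moment_le: "\<And>e k. e \<in> I \<Longrightarrow> expectation (\<lambda>\<omega>. \<bar>X e \<omega>\<bar> ^ k) \<le> C k"
begin

lemma X_has_moments: "e \<in> I \<Longrightarrow> has_moments (X e)"
  using moment_integrable indep by (auto simp: has_moments_def indep_vars_def)

lemma monomial_has_moments:
  "(\<And>p. p \<in> L \<Longrightarrow> \<kappa> p \<in> I) \<Longrightarrow> has_moments (\<lambda>\<omega>. \<Prod>p\<in>L. X (\<kappa> p) \<omega>)"
  by (intro has_moments_prod X_has_moments)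

lemma expectation_mult_disjoint:
  fixes f g :: "('e \<Rightarrow> real) \<Rightarrow> real"
  assumes AB: "A \<inter> B = {}" "A \<subseteq> I" "B \<subseteq> I"
    and f: "f \<in> borel_measurable (PiM A (\<lambda>_. borel))" and g: "g \<in> borel_measurable (PiM B (\<lambda>_. borel))"
    and F: "\<And>\<omega>. \<omega> \<in> space M \<Longrightarrow> f (\<lambda>e\<in>A. X e \<omega>) = F \<omega>" and G: "\<And>\<omega>. \<omega> \<in> space M \<Longrightarrow> g (\<lambda>e\<in>B. X e \<omega>) = G \<omega>"
    and int: "integrable M F" "integrable M G"
  shows "expectation (\<lambda>\<omega>. F \<omega> * G \<omega>) = expectation F * expectation G"
proof -
  let ?f = "f \<circ> (\<lambda>\<omega>. \<lambda>e\<in>A. X e \<omega>)" and ?g = "g \<circ> (\<lambda>\<omega>. \<lambda>e\<in>B. X e \<omega>)"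
  have ind: "indep_var borel ?f borel ?g"
    by (rule indep_var_compose[OF indep_var_restrict[OF indep AB] f g])
  have eqF: "expectation ?f = expectation F" "integrable M ?f"
    using F int(1) by (auto intro!: Bochner_Integration.integral_cong simp: Bochner_Integration.integrable_cong[of M M ?f F])
  have eqG: "expectation ?g = expectation G" "integrable M ?g"
    using G int(2) by (auto intro!: Bochner_Integration.integral_cong simp: Bochner_Integration.integrable_cong[of M M ?g G])
  have "expectation (\<lambda>\<omega>. F \<omega> * G \<omega>) = expectation (\<lambda>\<omega>. ?f \<omega> * ?g \<omega>)"
    using F G by (intro Bochner_Integration.integral_cong) auto
  also have "\<dots> = expectation ?f * expectation ?g"
    by (rule indep_var_lebesgue_integral[OF ind eqF(2) eqG(2)])
  finally show ?thesis by (simp add: eqF eqG)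
qed

lemma expectation_lone_factor:
  assumes "e \<in> I" "B \<subseteq> I - {e}" "g \<in> borel_measurable (PiM B (\<lambda>_. borel))"
    and "\<And>\<omega>. \<omega> \<in> space M \<Longrightarrow> g (\<lambda>e\<in>B. X e \<omega>) = G \<omega>" "integrable M G"
  shows "expectation (\<lambda>\<omega>. X e \<omega> * G \<omega>) = 0"
proof -
  have "expectation (\<lambda>\<omega>. X e \<omega> * G \<omega>) = expectation (X e) * expectation G"
    using assms has_moments_integrable(1)[OF X_has_moments]
    by (intro expectation_mult_disjoint[where A="{e}" and B=B and f="\<lambda>x. x e" and g=g]) auto
  thus ?thesis using mean assms by simp
qed

lemma expectation_monomial_lone:
  assumes L: "finite L" "\<And>p. p \<in> L \<Longrightarrow> \<kappa> p \<in> I" and q: "q \<in> L" "\<And>p. p \<in> L \<Longrightarrow> p \<noteq> q \<Longrightarrow> \<kappa> p \<noteq> \<kappa> q"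
  shows "expectation (\<lambda>\<omega>. \<Prod>p\<in>L. X (\<kappa> p) \<omega>) = 0"
proof -
  have "expectation (\<lambda>\<omega>. X (\<kappa> q) \<omega> * (\<Prod>p\<in>L - {q}. X (\<kappa> p) \<omega>)) = 0"
    using L q
    by (intro expectation_lone_factor[where B="\<kappa> ` (L - {q})" and g="\<lambda>x. \<Prod>p\<in>L - {q}. x (\<kappa> p)"])
       (auto intro!: borel_measurable_prod measurable_component_singleton prod.cong
         has_moments_integrable(1) monomial_has_moments)
  thus ?thesis using L q by (simp add: prod.remove)
qed

lemma abs_expectation_monomial_le:
  assumes L: "finite L" "L \<noteq> {}" "\<And>p. p \<in> L \<Longrightarrow> \<kappa> p \<in> I"
  shows "expectation (\<lambda>\<omega>. \<bar>\<Prod>p\<in>L. X (\<kappa> p) \<omega>\<bar> ^ g) \<le> card L * C (g * card L)"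
proof -
  have "expectation (\<lambda>\<omega>. \<bar>\<Prod>p\<in>L. X (\<kappa> p) \<omega>\<bar> ^ g) \<le> expectation (\<lambda>\<omega>. \<Sum>p\<in>L. \<bar>X (\<kappa> p) \<omega>\<bar> ^ (g * card L))"
  proof (rule integral_mono)
    show "integrable M (\<lambda>\<omega>. \<bar>\<Prod>p\<in>L. X (\<kappa> p) \<omega>\<bar> ^ g)"
      by (intro has_moments_integrable(2) monomial_has_moments L)
    show "integrable M (\<lambda>\<omega>. \<Sum>p\<in>L. \<bar>X (\<kappa> p) \<omega>\<bar> ^ (g * card L))"
      by (intro Bochner_Integration.integrable_sum moment_integrable L)
    fix \<omega>
    have "\<bar>\<Prod>p\<in>L. X (\<kappa> p) \<omega>\<bar> ^ g = \<bar>\<Prod>p\<in>L. X (\<kappa> p) \<omega> ^ g\<bar>"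
      by (simp only: power_abs[symmetric] prod_power_distrib)
    also have "\<dots> \<le> (\<Sum>p\<in>L. \<bar>X (\<kappa> p) \<omega> ^ g\<bar> ^ card L)" by (rule abs_prod_le_sum_power[OF L(1,2)])
    finally show "\<bar>\<Prod>p\<in>L. X (\<kappa> p) \<omega>\<bar> ^ g \<le> (\<Sum>p\<in>L. \<bar>X (\<kappa> p) \<omega>\<bar> ^ (g * card L))"
      by (simp add: power_abs power_mult)
  qed
  also have "\<dots> = (\<Sum>p\<in>L. expectation (\<lambda>\<omega>. \<bar>X (\<kappa> p) \<omega>\<bar> ^ (g * card L)))"
    by (intro Bochner_Integration.integral_sum moment_integrable L)
  also have "\<dots> \<le> (\<Sum>p\<in>L. C (g * card L))" by (intro sum_mono moment_le L)
  finally show ?thesis by simp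
qed

context
  fixes R :: "'r set" and n :: nat and \<kappa> :: "'r \<times> nat \<Rightarrow> 'e" and Y :: "'r \<Rightarrow> 'a \<Rightarrow> real"
  assumes R: "finite R" and n: "n \<ge> 1" and \<kappa>: "\<And>p. p \<in> R \<times> {..<n} \<Longrightarrow> \<kappa> p \<in> I"
  defines "Y \<equiv> \<lambda>r \<omega>. \<Prod>l<n. X (\<kappa> (r, l)) \<omega>"
begin

lemma row_has_moments: "r \<in> R \<Longrightarrow> has_moments (Y r)"
  unfolding Y_def using \<kappa> by (intro monomial_has_moments) auto

lemma centred_rows_has_moments:
  assumes "R' \<subseteq> R"
  shows "has_moments (\<lambda>\<omega>. \<Prod>r\<in>R'. Y r \<omega> - expectation (Y r))"
  using assms by (intro has_moments_prod has_moments_diff row_has_moments) auto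

text \<open>
  Let \<open>(r0, l0)\<close> carry a variable that occurs nowhere else. The expectation of its row vanishes, so that
  centring the row changes nothing and the variable factors out of the whole product.
\<close>

lemma expectation_centred_rows_lone:
  assumes q: "r0 \<in> R" "l0 < n" and lone: "\<And>p. p \<in> R \<times> {..<n} \<Longrightarrow> p \<noteq> (r0, l0) \<Longrightarrow> \<kappa> p \<noteq> \<kappa> (r0, l0)"
  shows "expectation (\<lambda>\<omega>. \<Prod>r\<in>R. Y r \<omega> - expectation (Y r)) = 0"
proof -
  have "expectation (Y r0) = 0"
    unfolding Y_def using q \<kappa> lone by (intro expectation_monomial_lone[where q=l0]) auto
  hence "(\<Prod>r\<in>R. Y r \<omega> - expectation (Y r)) =
     X (\<kappa> (r0, l0)) \<omega> * ((\<Prod>l\<in>{..<n} - {l0}. X (\<kappa> (r0, l)) \<omega>) * (\<Prod>r\<in>R - {r0}. Y r \<omega> - expectation (Y r)))" for \<omega>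
    using q R by (simp add: prod.remove[of R r0] Y_def prod.remove[of "{..<n}" l0])
  moreover have "expectation (\<lambda>\<omega>. X (\<kappa> (r0, l0)) \<omega> *
      ((\<Prod>l\<in>{..<n} - {l0}. X (\<kappa> (r0, l)) \<omega>) * (\<Prod>r\<in>R - {r0}. Y r \<omega> - expectation (Y r)))) = 0"
  proof (rule expectation_lone_factor[where B="\<kappa> ` (R \<times> {..<n} - {(r0, l0)})" and
        g="\<lambda>x. (\<Prod>l\<in>{..<n} - {l0}. x (\<kappa> (r0, l))) * (\<Prod>r\<in>R - {r0}. (\<Prod>l<n. x (\<kappa> (r, l))) - expectation (Y r))"])
    show "\<kappa> (r0, l0) \<in> I" "\<kappa> ` (R \<times> {..<n} - {(r0, l0)}) \<subseteq> I - {\<kappa> (r0, l0)}" using \<kappa> q lone by auto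
    show "(\<lambda>x. (\<Prod>l\<in>{..<n} - {l0}. x (\<kappa> (r0, l))) * (\<Prod>r\<in>R - {r0}. (\<Prod>l<n. x (\<kappa> (r, l))) - expectation (Y r)))
        \<in> borel_measurable (PiM (\<kappa> ` (R \<times> {..<n} - {(r0, l0)})) (\<lambda>_. borel))"
      using q by (intro borel_measurable_times borel_measurable_prod borel_measurable_diff
            measurable_component_singleton measurable_const) auto
    show "integrable M (\<lambda>\<omega>. (\<Prod>l\<in>{..<n} - {l0}. X (\<kappa> (r0, l)) \<omega>) * (\<Prod>r\<in>R - {r0}. Y r \<omega> - expectation (Y r)))"
      using \<kappa> q by (intro has_moments_integrable(1) has_moments_mult monomial_has_moments centred_rows_has_moments) auto
    fix \<omega> assume "\<omega> \<in> space M"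
    have "restrict (\<lambda>e. X e \<omega>) (\<kappa> ` (R \<times> {..<n} - {(r0, l0)})) (\<kappa> p) = X (\<kappa> p) \<omega>"
      if "p \<in> R \<times> {..<n} - {(r0, l0)}" for p
      by (rule restrict_apply') (use that in blast)
    thus "(\<Prod>l\<in>{..<n} - {l0}. restrict (\<lambda>e. X e \<omega>) (\<kappa> ` (R \<times> {..<n} - {(r0, l0)})) (\<kappa> (r0, l))) *
        (\<Prod>r\<in>R - {r0}. (\<Prod>l<n. restrict (\<lambda>e. X e \<omega>) (\<kappa> ` (R \<times> {..<n} - {(r0, l0)})) (\<kappa> (r, l))) - expectation (Y r)) =
        (\<Prod>l\<in>{..<n} - {l0}. X (\<kappa> (r0, l)) \<omega>) * (\<Prod>r\<in>R - {r0}. Y r \<omega> - expectation (Y r))"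
      unfolding Y_def using q by (intro arg_cong2[where f="(*)"] prod.cong refl arg_cong2[where f="(-)"]) auto
  qed
  ultimately show ?thesis by simp
qed

text \<open>
  A row without common variables with the other rows is independent of them, and it is centred.
\<close>

lemma expectation_centred_rows_isolated:
  assumes r0: "r0 \<in> R"
    and iso: "\<And>l r l'. l < n \<Longrightarrow> r \<in> R \<Longrightarrow> r \<noteq> r0 \<Longrightarrow> l' < n \<Longrightarrow> \<kappa> (r, l') \<noteq> \<kappa> (r0, l)"
  shows "expectation (\<lambda>\<omega>. \<Prod>r\<in>R. Y r \<omega> - expectation (Y r)) = 0"
proof -
  define A where "A = \<kappa> ` ({r0} \<times> {..<n})"
  define B where "B = \<kappa> ` ((R - {r0}) \<times> {..<n})"
  have "expectation (\<lambda>\<omega>. (Y r0 \<omega> - expectation (Y r0)) * (\<Prod>r\<in>R - {r0}. Y r \<omega> - expectation (Y r))) =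
      expectation (\<lambda>\<omega>. Y r0 \<omega> - expectation (Y r0)) * expectation (\<lambda>\<omega>. \<Prod>r\<in>R - {r0}. Y r \<omega> - expectation (Y r))"
  proof (rule expectation_mult_disjoint[where A=A and B=B and f="\<lambda>x. (\<Prod>l<n. x (\<kappa> (r0, l))) - expectation (Y r0)"
        and g="\<lambda>x. \<Prod>r\<in>R - {r0}. (\<Prod>l<n. x (\<kappa> (r, l))) - expectation (Y r)"])
    show "A \<inter> B = {}" unfolding A_def B_def using iso by (fastforce)
    show "A \<subseteq> I" "B \<subseteq> I" using \<kappa> r0 by (auto simp: A_def B_def)
    show "(\<lambda>x. (\<Prod>l<n. x (\<kappa> (r0, l))) - expectation (Y r0)) \<in> borel_measurable (PiM A (\<lambda>_. borel))"
      by (intro borel_measurable_prod borel_measurable_diff measurable_component_singleton measurable_const)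
         (auto simp: A_def)
    show "(\<lambda>x. \<Prod>r\<in>R - {r0}. (\<Prod>l<n. x (\<kappa> (r, l))) - expectation (Y r)) \<in> borel_measurable (PiM B (\<lambda>_. borel))"
      by (intro borel_measurable_prod borel_measurable_diff measurable_component_singleton measurable_const)
         (auto simp: B_def)
    show "integrable M (\<lambda>\<omega>. Y r0 \<omega> - expectation (Y r0))"
      using r0 by (intro has_moments_integrable(1) has_moments_diff row_has_moments)
    show "integrable M (\<lambda>\<omega>. \<Prod>r\<in>R - {r0}. Y r \<omega> - expectation (Y r))"
      by (intro has_moments_integrable(1) centred_rows_has_moments) auto
    fix \<omega> assume "\<omega> \<in> space M"
    have "restrict (\<lambda>e. X e \<omega>) A (\<kappa> (r0, l)) = X (\<kappa> (r0, l)) \<omega>" if "l < n" for l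
      using that by (auto simp: A_def)
    thus "(\<Prod>l<n. restrict (\<lambda>e. X e \<omega>) A (\<kappa> (r0, l))) - expectation (Y r0) = Y r0 \<omega> - expectation (Y r0)"
      by (auto simp: Y_def intro!: prod.cong)
    have "restrict (\<lambda>e. X e \<omega>) B (\<kappa> (r, l)) = X (\<kappa> (r, l)) \<omega>" if "l < n" "r \<in> R - {r0}" for r l
      using that by (intro restrict_apply') (auto simp: B_def)
    thus "(\<Prod>r\<in>R - {r0}. (\<Prod>l<n. restrict (\<lambda>e. X e \<omega>) B (\<kappa> (r, l))) - expectation (Y r)) =
        (\<Prod>r\<in>R - {r0}. Y r \<omega> - expectation (Y r))"
      unfolding Y_def by (intro prod.cong refl arg_cong2[where f="(-)"]) auto
  qed
  moreover have "expectation (\<lambda>\<omega>. Y r0 \<omega> - expectation (Y r0)) = 0"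
    using has_moments_integrable(1)[OF row_has_moments[OF r0]] by (simp add: prob_space)
  ultimately show ?thesis using r0 R by (simp add: prod.remove[of R r0])
qed

lemma abs_expectation_centred_rows_le:
  assumes ne: "R \<noteq> {}"
  shows "\<bar>expectation (\<lambda>\<omega>. \<Prod>r\<in>R. Y r \<omega> - expectation (Y r))\<bar>
    \<le> card R * (2 ^ card R * (n * C (card R * n) + (n * C n) ^ card R))"
proof -
  define g where "g = card R"
  have bd: "expectation (\<lambda>\<omega>. \<bar>Y r \<omega>\<bar> ^ i) \<le> n * C (i * n)" if "r \<in> R" for r i
    unfolding Y_def using abs_expectation_monomial_le[of "{..<n}" "\<lambda>l. \<kappa> (r, l)" i] n \<kappa> that by force
  have c: "\<bar>expectation (Y r)\<bar> \<le> n * C n" if r: "r \<in> R" for r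
    using bd[OF r, of 1] by (intro order_trans[OF integral_abs_bound]) simp
  note hm = has_moments_integrable(2)[OF has_moments_diff[OF row_has_moments]]
    has_moments_integrable(2)[OF row_has_moments]
  have "\<bar>expectation (\<lambda>\<omega>. \<Prod>r\<in>R. Y r \<omega> - expectation (Y r))\<bar> \<le>
      expectation (\<lambda>\<omega>. \<bar>\<Prod>r\<in>R. Y r \<omega> - expectation (Y r)\<bar>)" by (rule integral_abs_bound)
  also have "\<dots> \<le> expectation (\<lambda>\<omega>. \<Sum>r\<in>R. \<bar>Y r \<omega> - expectation (Y r)\<bar> ^ g)"
    unfolding g_def using R ne has_moments_integrable(1)[OF centred_rows_has_moments[OF order_refl]]
    by (intro integral_mono abs_prod_le_sum_power Bochner_Integration.integrable_sum hm integrable_abs) auto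
  also have "\<dots> = (\<Sum>r\<in>R. expectation (\<lambda>\<omega>. \<bar>Y r \<omega> - expectation (Y r)\<bar> ^ g))"
    by (intro Bochner_Integration.integral_sum hm)
  also have "\<dots> \<le> (\<Sum>r\<in>R. 2 ^ g * (n * C (g * n) + (n * C n) ^ g))"
  proof (rule sum_mono)
    fix r assume r: "r \<in> R"
    have "expectation (\<lambda>\<omega>. \<bar>Y r \<omega> - expectation (Y r)\<bar> ^ g) \<le>
        expectation (\<lambda>\<omega>. 2 ^ g * (\<bar>Y r \<omega>\<bar> ^ g + \<bar>expectation (Y r)\<bar> ^ g))"
      using r by (intro integral_mono hm abs_diff_power_le Bochner_Integration.integrable_mult_right
          Bochner_Integration.integrable_add integrable_const) auto
    also have "\<dots> = 2 ^ g * (expectation (\<lambda>\<omega>. \<bar>Y r \<omega>\<bar> ^ g) + \<bar>expectation (Y r)\<bar> ^ g)"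
      using hm(2)[OF r] by (simp add: prob_space)
    also have "\<dots> \<le> 2 ^ g * (n * C (g * n) + (n * C n) ^ g)"
      using bd[OF r] c[OF r] by (intro mult_left_mono add_mono power_mono) auto
    finally show "expectation (\<lambda>\<omega>. \<bar>Y r \<omega> - expectation (Y r)\<bar> ^ g) \<le> 2 ^ g * (n * C (g * n) + (n * C n) ^ g)" .
  qed
  finally show ?thesis by (simp add: g_def)
qed

end

text \<open>
  Different pairs are independent. A pair of equal variables contributes the second moment \<open>1\<close>, a pair of
  different variables the product of two means.
\<close>

lemma expectation_paired_monomial:
  fixes T :: "'l set"
  assumes T: "finite T" "\<And>t. t \<in> T \<Longrightarrow> \<kappa> t \<in> I" "\<And>t. t \<in> T \<Longrightarrow> \<kappa>' t \<in> I"
    and disj: "\<And>t u. t \<in> T \<Longrightarrow> u \<in> T \<Longrightarrow> t \<noteq> u \<Longrightarrow> {\<kappa> t, \<kappa>' t} \<inter> {\<kappa> u, \<kappa>' u} = {}"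
  shows "expectation (\<lambda>\<omega>. \<Prod>t\<in>T. X (\<kappa> t) \<omega> * X (\<kappa>' t) \<omega>) = of_bool (\<forall>t\<in>T. \<kappa> t = \<kappa>' t)"
proof -
  have one: "expectation (\<lambda>\<omega>. X (\<kappa> t) \<omega> * X (\<kappa>' t) \<omega>) = of_bool (\<kappa> t = \<kappa>' t)" if t: "t \<in> T" for t
  proof (cases "\<kappa> t = \<kappa>' t")
    case True
    thus ?thesis using variance[of "\<kappa> t"] T(2)[OF t] by (simp add: power2_eq_square)
  next
    case False
    have "expectation (\<lambda>\<omega>. X (\<kappa> t) \<omega> * X (\<kappa>' t) \<omega>) = 0"
      using False T(2,3)[OF t] has_moments_integrable(1)[OF X_has_moments]
      by (intro expectation_lone_factor[where B="{\<kappa>' t}" and g="\<lambda>x. x (\<kappa>' t)"]) auto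
    thus ?thesis using False by simp
  qed
  define Z where "Z t \<omega> = X (\<kappa> t) \<omega> * X (\<kappa>' t) \<omega>" for t \<omega>
  have "indep_vars (\<lambda>t. PiM {\<kappa> t, \<kappa>' t} (\<lambda>_. borel)) (\<lambda>t \<omega>. restrict (\<lambda>e. X e \<omega>) {\<kappa> t, \<kappa>' t}) T"
    using T disj by (intro indep_vars_restrict[OF indep]) (auto simp: disjoint_family_on_def)
  hence "indep_vars (\<lambda>_. borel) (\<lambda>t \<omega>. (\<lambda>x. x (\<kappa> t) * x (\<kappa>' t)) (restrict (\<lambda>e. X e \<omega>) {\<kappa> t, \<kappa>' t})) T"
    by (rule indep_vars_compose2) (auto intro!: borel_measurable_times measurable_component_singleton)
  hence ind: "indep_vars (\<lambda>_. borel) Z T" by (simp add: Z_def[abs_def])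
  have "expectation (\<lambda>\<omega>. \<Prod>t\<in>T. Z t \<omega>) = (\<Prod>t\<in>T. expectation (Z t))"
    using T by (intro indep_vars_lebesgue_integral[OF T(1) ind])
       (auto simp: Z_def[abs_def] intro!: has_moments_integrable(1) has_moments_mult X_has_moments)
  also have "\<dots> = (\<Prod>t\<in>T. of_bool (\<kappa> t = \<kappa>' t))"
    using one by (intro prod.cong refl) (simp add: Z_def[abs_def])
  also have "\<dots> = of_bool (\<forall>t\<in>T. \<kappa> t = \<kappa>' t)"
    using T(1) by (auto simp: prod_zero_iff)
  finally show ?thesis by (simp add: Z_def)
qed

end

section \<open>The entries of the model\<close>

text \<open>
  The index, in the independent family of the model, of the variable that \<open>a\<^sub>i\<^sub>j(s)\<close> equals by the
  symmetry.
\<close>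

definition entry_key :: "int \<Rightarrow> nat \<Rightarrow> nat \<Rightarrow> int \<times> nat \<times> nat" where
  "entry_key s i j =
     (if s > 0 then (s, i, j) else if s < 0 then (- s, j, i) else (0, min i j, max i j))"

definition free_entries :: "nat \<Rightarrow> nat \<Rightarrow> (int \<times> nat \<times> nat) set" where
  "free_entries b m =
     {(s, i, j). 1 \<le> s \<and> s \<le> int b \<and> i < m \<and> j < m} \<union> {(s, i, j). s = 0 \<and> i \<le> j \<and> j < m}"

lemma entry_key_in_free_entries:
  "\<bar>s\<bar> \<le> int b \<Longrightarrow> i < m \<Longrightarrow> j < m \<Longrightarrow> entry_key s i j \<in> free_entries b m"
  by (auto simp: entry_key_def free_entries_def)

lemma fst_entry_key: "fst (entry_key s i j) = \<bar>s\<bar>"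
  by (simp add: entry_key_def)

lemma entry_key_opposite:
  assumes "s \<noteq> 0"
  shows "entry_key s i j = entry_key (- s) i' j' \<longleftrightarrow> i = j' \<and> j = i'"
  using assms by (auto simp: entry_key_def)

context block_toeplitz_band_model
begin

definition moment_bound :: "nat \<Rightarrow> nat \<Rightarrow> real" where
  "moment_bound m k = enn2real (abs_moment_sup P b a k m)"

lemma free_entries_family:
  assumes m: "1 \<le> m" and N: "1 \<le> N"
  shows "centred_independent_family P (\<lambda>(s, i, j). a m N s i j) (free_entries (b N) m) (moment_bound m)"
proof (unfold_locales)
  show "indep_vars (\<lambda>_. borel) (\<lambda>(s, i, j). a m N s i j) (free_entries (b N) m)"
    unfolding free_entries_def by (rule entries_independent[OF m N])
  fix e assume e: "e \<in> free_entries (b N) m"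
  obtain s i j where sij: "e = (s, i, j)" by (cases e)
  have bd: "\<bar>s\<bar> \<le> int (b N)" "i < m" "j < m" using e by (auto simp: sij free_entries_def)
  show "expectation ((\<lambda>(s, i, j). a m N s i j) e) = 0"
    using entry_mean[OF m N bd] by (simp add: sij)
  show "expectation (\<lambda>\<omega>. ((\<lambda>(s, i, j). a m N s i j) e \<omega>)\<^sup>2) = 1"
    using entry_second_moment[OF m N bd] by (simp add: sij)
  fix k
  have [measurable]: "a m N s i j \<in> borel_measurable P" by (rule entry_random_variable[OF m N bd])
  have le: "(\<integral>\<^sup>+\<omega>. ennreal (\<bar>a m N s i j \<omega>\<bar> ^ k) \<partial>P) \<le> abs_moment_sup P b a k m"
    unfolding abs_moment_sup_def using N bd by (intro SUP_upper2[of "(N, s, i, j)"]) auto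
  have fin: "abs_moment_sup P b a k m < \<infinity>" by (rule abs_moments_finite[OF m])
  have int: "integrable P (\<lambda>\<omega>. \<bar>a m N s i j \<omega>\<bar> ^ k)"
    by (rule integrableI_nonneg) (use le fin in \<open>auto intro: le_less_trans\<close>)
  thus "integrable P (\<lambda>\<omega>. \<bar>(\<lambda>(s, i, j). a m N s i j) e \<omega>\<bar> ^ k)" by (simp add: sij)
  have "expectation (\<lambda>\<omega>. \<bar>a m N s i j \<omega>\<bar> ^ k) = enn2real (\<integral>\<^sup>+\<omega>. ennreal (\<bar>a m N s i j \<omega>\<bar> ^ k) \<partial>P)"
    by (rule integral_eq_nn_integral) auto
  also have "\<dots> \<le> moment_bound m k" unfolding moment_bound_def using le fin by (intro enn2real_mono) auto
  finally show "expectation (\<lambda>\<omega>. \<bar>(\<lambda>(s, i, j). a m N s i j) e \<omega>\<bar> ^ k) \<le> moment_bound m k" by (simp add: sij)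
qed

lemma entry_eq_key:
  assumes "1 \<le> m" "1 \<le> N" "i < m" "j < m" "\<omega> \<in> space P"
  shows "a m N s i j \<omega> = (\<lambda>(s, i, j). a m N s i j) (entry_key s i j) \<omega>"
  using entry_transpose[OF assms(1,2) assms(3,4,5), of "- s"] entry_transpose[OF assms(1,2,4,3,5), of 0]
  by (auto simp: entry_key_def min_def max_def)

end

locale block_toeplitz_fixed = block_toeplitz_band_model +
  fixes m N :: nat
  assumes m: "1 \<le> m" and N: "1 \<le> N"
begin

sublocale entries: centred_independent_family P "\<lambda>(s, i, j). a m N s i j" "free_entries (b N) m" "moment_bound m"
  by (rule free_entries_family[OF m N])

abbreviation entry :: "int \<times> nat \<times> nat \<Rightarrow> 'a \<Rightarrow> real" where
  "entry \<equiv> \<lambda>(s, i, j). a m N s i j"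

definition letter_key :: "nat \<Rightarrow> (nat \<Rightarrow> int) \<Rightarrow> (nat \<Rightarrow> nat) \<Rightarrow> nat \<Rightarrow> int \<times> nat \<times> nat" where
  "letter_key n s j l = entry_key (s l) (j l) (j ((l + 1) mod n))"

definition word_monomial :: "nat \<Rightarrow> (nat \<Rightarrow> int) \<Rightarrow> (nat \<Rightarrow> nat) \<Rightarrow> 'a \<Rightarrow> real" where
  "word_monomial n s j \<omega> = (\<Prod>l<n. entry (letter_key n s j l) \<omega>)"

abbreviation words :: "nat \<Rightarrow> (nat \<Rightarrow> int) set" where
  "words n \<equiv> {..<n} \<rightarrow>\<^sub>E {- int (b N)..int (b N)}"

abbreviation labels :: "nat \<Rightarrow> (nat \<Rightarrow> nat) set" where
  "labels n \<equiv> {..<n} \<rightarrow>\<^sub>E {..<m}"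

lemma finite_words: "finite (words n)" and finite_labels: "finite (labels n)"
  by (auto intro: finite_PiE)

lemma card_labels: "card (labels n) = m ^ n"
  by (simp add: card_PiE)

lemma letter_key_free:
  assumes "s \<in> words n" "j \<in> labels n" "l < n"
  shows "letter_key n s j l \<in> free_entries (b N) m"
  unfolding letter_key_def
proof (rule entry_key_in_free_entries)
  show "\<bar>s l\<bar> \<le> int (b N)" using PiE_mem[OF assms(1), of l] assms(3) by auto
  show "j l < m" using PiE_mem[OF assms(2), of l] assms(3) by auto
  show "j ((l + 1) mod n) < m" using PiE_mem[OF assms(2), of "(l + 1) mod n"] assms(3) by auto
qed

lemma fst_letter_key: "fst (letter_key n s j l) = \<bar>s l\<bar>"
  by (simp add: letter_key_def fst_entry_key)

lemma word_monomial_has_moments: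
  assumes "s \<in> words n" "j \<in> labels n"
  shows "has_moments (word_monomial n s j)"
  unfolding word_monomial_def[abs_def]
  using letter_key_free[OF assms] by (intro entries.monomial_has_moments) auto

text \<open>
  The trace of the \<open>n\<close>-th power of the matrix before normalisation, see \<open>trace_power_normalized_toeplitz\<close>.
\<close>

definition trace_variable :: "nat \<Rightarrow> 'a \<Rightarrow> real" where
  "trace_variable n \<omega> =
     (\<Sum>(s, j)\<in>words n \<times> labels n. real (walk_count n N s) * word_monomial n s j \<omega>)"

lemma trace_power_normalized_toeplitz:
  assumes n: "n \<ge> 1" and \<omega>: "\<omega> \<in> space P"
  shows "trace_power n (normalized_toeplitz b a m N \<omega>) =
    (1 / sqrt (2 * real m * real (b N))) ^ n * trace_variable n \<omega>"
proof -
  have "trace_power n (block_toeplitz_mat m N (\<lambda>s i j. a m N s i j \<omega>)) =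
    (\<Sum>s\<in>words n. real (walk_count n N s) *
       (\<Sum>j\<in>labels n. \<Prod>l<n. a m N (s l) (j l) (j ((l + 1) mod n)) \<omega>))"
    using entry_outside_band[OF m N _ _ _ \<omega>] by (intro trace_power_block_toeplitz[OF m n]) auto
  also have "\<dots> = (\<Sum>s\<in>words n. \<Sum>j\<in>labels n. real (walk_count n N s) * word_monomial n s j \<omega>)"
    unfolding sum_distrib_left word_monomial_def
  proof (intro sum.cong prod.cong refl arg_cong2[where f="(*)"])
    fix s j l assume j: "j \<in> labels n" and l: "l \<in> {..<n}"
    have "j l < m" "j ((l + 1) mod n) < m"
      using PiE_mem[OF j, of l] PiE_mem[OF j, of "(l + 1) mod n"] l by auto
    thus "a m N (s l) (j l) (j ((l + 1) mod n)) \<omega> = entry (letter_key n s j l) \<omega>"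
      unfolding letter_key_def by (rule entry_eq_key[OF m N _ _ \<omega>])
  qed
  also have "\<dots> = trace_variable n \<omega>"
    by (simp add: trace_variable_def sum.cartesian_product)
  finally show ?thesis
    by (simp add: normalized_toeplitz_def trace_power_smult[of _ "m * N"] block_toeplitz_mat_def)
qed

lemma trace_variable_integrable: "integrable P (trace_variable n)"
  unfolding trace_variable_def[abs_def] case_prod_unfold
proof (intro Bochner_Integration.integrable_sum Bochner_Integration.integrable_mult_right)
  fix w assume "w \<in> words n \<times> labels n"
  hence "fst w \<in> words n" "snd w \<in> labels n" by (simp_all only: mem_Times_iff)
  thus "integrable P (word_monomial n (fst w) (snd w))"
    by (intro has_moments_integrable(1)[OF word_monomial_has_moments])
qed

lemma trace_power_normalized_integrable:
  "integrable P (\<lambda>\<omega>. trace_power n (normalized_toeplitz b a m N \<omega>))"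
proof (cases "n = 0")
  case True
  thus ?thesis
    by (simp add: trace_power_def normalized_toeplitz_def block_toeplitz_mat_def)
next
  case False
  thus ?thesis
    by (subst Bochner_Integration.integrable_cong[OF refl trace_power_normalized_toeplitz])
       (auto intro: trace_variable_integrable)
qed

lemma normalized_toeplitz_carrier: "normalized_toeplitz b a m N \<omega> \<in> carrier_mat (m * N) (m * N)"
  by (simp add: normalized_toeplitz_def block_toeplitz_mat_def)

lemma normalized_toeplitz_symmetric:
  assumes \<omega>: "\<omega> \<in> space P" and p: "p < m * N" and q: "q < m * N"
  shows "normalized_toeplitz b a m N \<omega> $$ (p, q) = normalized_toeplitz b a m N \<omega> $$ (q, p)"
proof -
  have "p mod m < m" "q mod m < m" using m by auto
  from entry_transpose[OF m N this \<omega>, of "int (q div m) - int (p div m)"]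
  show ?thesis using p q by (simp add: normalized_toeplitz_def block_toeplitz_mat_def)
qed

lemma expectation_word_monomial_unmatched:
  assumes sj: "s \<in> words n" "j \<in> labels n" and un: "\<not> matched_word {..<n} s"
  shows "expectation (word_monomial n s j) = 0"
proof -
  obtain q where q: "q < n" "\<And>p. p < n \<Longrightarrow> p \<noteq> q \<Longrightarrow> \<bar>s p\<bar> \<noteq> \<bar>s q\<bar>"
    using un by (auto simp: matched_word_def)
  show ?thesis
    unfolding word_monomial_def[abs_def]
  proof (rule entries.expectation_monomial_lone[where q=q])
    fix p assume "p \<in> {..<n}" "p \<noteq> q"
    thus "letter_key n s j p \<noteq> letter_key n s j q" using q(2)[of p] fst_letter_key by (metis lessThan_iff)
  qed (use q letter_key_free[OF sj] in auto)
qed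

lemma abs_expectation_word_monomial_le:
  assumes n: "n \<ge> 1" and sj: "s \<in> words n" "j \<in> labels n"
  shows "\<bar>expectation (word_monomial n s j)\<bar> \<le> real n * moment_bound m n"
proof -
  have "\<bar>expectation (word_monomial n s j)\<bar> \<le> expectation (\<lambda>\<omega>. \<bar>word_monomial n s j \<omega>\<bar> ^ 1)"
    by (intro order_trans[OF integral_abs_bound]) simp
  also have "\<dots> \<le> card {..<n} * moment_bound m (1 * card {..<n})"
    unfolding word_monomial_def using n letter_key_free[OF sj]
    by (intro entries.abs_expectation_monomial_le) (auto simp: lessThan_empty_iff)
  finally show ?thesis by simp
qed

text \<open>
  The sum on the right has exactly one summand, for the pairing given by the absolute values of the word.
  In a pair \<open>t\<close>, \<open>q t\<close> the two steps are opposite and not zero, so the two entries are the same variable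
  exactly if the labels at their ends agree crosswise, which is the pair of equations of \<open>{t, q t}\<close>.
\<close>

lemma sum_expectation_paired_word:
  assumes s: "s \<in> words n" and pw: "paired_word {..<n} s"
  shows "(\<Sum>j\<in>labels n. expectation (word_monomial n s j)) =
    (\<Sum>\<pi>\<in>{\<pi>\<in>pair_partitions n. s \<in> pairing_words n (b N) \<pi>}. real (card (pairing_solutions n m \<pi>)))"
proof -
  obtain \<pi> where \<pi>: "\<pi> \<in> pair_partitions n" "s \<in> pairing_words n (b N) \<pi>"
    and uniq: "\<forall>\<pi>'\<in>pair_partitions n. s \<in> pairing_words n (b N) \<pi>' \<longrightarrow> \<pi>' = \<pi>"
    and cls': "\<forall>p<n. \<forall>q<n. \<bar>s q\<bar> = \<bar>s p\<bar> \<longrightarrow> q \<in> {p, partner \<pi> p}"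
    and nz': "\<forall>p<n. s p \<noteq> 0"
    using paired_word_pair_partition[OF s pw] by (elim bexE conjE)
  have cls: "q = p \<or> q = partner \<pi> p" if "p < n" "q < n" "\<bar>s q\<bar> = \<bar>s p\<bar>" for p q
    using cls' that by simp
  have nz: "s p \<noteq> 0" if "p < n" for p using nz' that by simp
  define q where "q = partner \<pi>"
  define T where "T = {t. t < n \<and> t < q t}"
  have half: "inj_on q T" "{..<n} = T \<union> q ` T" "T \<inter> q ` T = {}"
    unfolding T_def q_def by (fact pair_partition_halves[OF \<pi>(1)])+
  note pp = pair_partition_partner[OF \<pi>(1), folded q_def] partner_partner[OF \<pi>(1), folded q_def]
  have neg: "s (q p) = - s p" if "p < n" for p using \<pi>(2) that by (simp add: pairing_words_def q_def)
  have finT: "finite T" by (simp add: T_def)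
  have one: "expectation (word_monomial n s j) = of_bool (j \<in> pairing_solutions n m \<pi>)"
    if j: "j \<in> labels n" for j
  proof -
    define \<kappa> where "\<kappa> = letter_key n s j"
    have "word_monomial n s j \<omega> = (\<Prod>t\<in>T. entry (\<kappa> t) \<omega> * entry (\<kappa> (q t)) \<omega>)" for \<omega>
    proof -
      have "word_monomial n s j \<omega> = (\<Prod>l\<in>T \<union> q ` T. entry (\<kappa> l) \<omega>)"
        unfolding word_monomial_def \<kappa>_def by (rule prod.cong[OF half(2) refl])
      also have "\<dots> = (\<Prod>l\<in>T. entry (\<kappa> l) \<omega>) * (\<Prod>l\<in>q ` T. entry (\<kappa> l) \<omega>)"
        using finT half(3) by (intro prod.union_disjoint) auto
      finally show ?thesis by (simp add: prod.reindex[OF half(1)] prod.distrib)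
    qed
    hence "expectation (word_monomial n s j) = expectation (\<lambda>\<omega>. \<Prod>t\<in>T. entry (\<kappa> t) \<omega> * entry (\<kappa> (q t)) \<omega>)"
      by (intro Bochner_Integration.integral_cong) auto
    also have "\<dots> = of_bool (\<forall>t\<in>T. \<kappa> t = \<kappa> (q t))"
    proof (rule entries.expectation_paired_monomial[OF finT])
      show "\<kappa> t \<in> free_entries (b N) m" "\<kappa> (q t) \<in> free_entries (b N) m" if "t \<in> T" for t
        using that pp(3) letter_key_free[OF s j] by (auto simp: \<kappa>_def T_def)
      fix t u assume tu: "t \<in> T" "u \<in> T" "t \<noteq> u"
      have f: "fst x = \<bar>s v\<bar>" if "x \<in> {\<kappa> v, \<kappa> (q v)}" "v \<in> T" for x v
        using that neg[of v] by (auto simp: \<kappa>_def fst_letter_key T_def)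
      have "\<bar>s u\<bar> \<noteq> \<bar>s t\<bar>"
      proof
        assume eq: "\<bar>s u\<bar> = \<bar>s t\<bar>"
        have tn: "t < n" "t < q t" and un: "u < n" "u < q u" using tu by (auto simp: T_def)
        have "u = q t" using cls[OF tn(1) un(1) eq] tu(3) by (simp add: q_def)
        hence "q u = t" using pp(5)[OF tn(1)] by simp
        thus False using tn(2) un(2) \<open>u = q t\<close> by simp
      qed
      thus "{\<kappa> t, \<kappa> (q t)} \<inter> {\<kappa> u, \<kappa> (q u)} = {}" using f tu by (metis disjoint_iff)
    qed
    also have "(\<forall>t\<in>T. \<kappa> t = \<kappa> (q t)) \<longleftrightarrow> (\<forall>p<n. j p = j ((q p + 1) mod n))"
    proof -
      have eq: "\<kappa> t = \<kappa> (q t) \<longleftrightarrow> j t = j ((q t + 1) mod n) \<and> j (q t) = j ((q (q t) + 1) mod n)" if t: "t \<in> T" for t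
      proof -
        have tn: "t < n" using t by (simp add: T_def)
        have "\<kappa> t = \<kappa> (q t) \<longleftrightarrow> j t = j ((q t + 1) mod n) \<and> j ((t + 1) mod n) = j (q t)"
          unfolding \<kappa>_def letter_key_def neg[OF tn] by (rule entry_key_opposite[OF nz[OF tn]])
        thus ?thesis using pp(5)[OF tn] by auto
      qed
      show ?thesis
      proof
        assume *: "\<forall>t\<in>T. \<kappa> t = \<kappa> (q t)"
        have both: "j t = j ((q t + 1) mod n) \<and> j (q t) = j ((q (q t) + 1) mod n)" if "t \<in> T" for t
          by (rule iffD1[OF eq[OF that] bspec[OF * that]])
        show "\<forall>p<n. j p = j ((q p + 1) mod n)"
        proof (intro allI impI)
          fix p assume "p < n"
          hence "p \<in> T \<union> q ` T" unfolding half(2)[symmetric] by (simp only: lessThan_iff)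
          then consider "p \<in> T" | t where "t \<in> T" "p = q t" by blast
          thus "j p = j ((q p + 1) mod n)"
          proof cases
            case 1
            show ?thesis by (rule conjunct1[OF both[OF 1]])
          next
            case 2
            show ?thesis unfolding 2(2) by (rule conjunct2[OF both[OF 2(1)]])
          qed
        qed
      next
        assume *: "\<forall>p<n. j p = j ((q p + 1) mod n)"
        show "\<forall>t\<in>T. \<kappa> t = \<kappa> (q t)"
        proof
          fix t assume t: "t \<in> T"
          have "t < n" "q t < n" using t pp(3) by (simp_all add: T_def)
          thus "\<kappa> t = \<kappa> (q t)" using * unfolding eq[OF t] by blast
        qed
      qed
    qed
    also have "of_bool \<dots> = (of_bool (j \<in> pairing_solutions n m \<pi>) :: real)"
      using j by (simp add: pairing_solutions_def q_def)
    finally show ?thesis .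
  qed
  have "(\<Sum>j\<in>labels n. expectation (word_monomial n s j)) = (\<Sum>j\<in>labels n. of_bool (j \<in> pairing_solutions n m \<pi>))"
    using one by (intro sum.cong) auto
  also have "\<dots> = real (card (labels n \<inter> pairing_solutions n m \<pi>))"
    using finite_labels by (simp add: sum.If_cases of_bool_def)
  also have "labels n \<inter> pairing_solutions n m \<pi> = pairing_solutions n m \<pi>" by (auto simp: pairing_solutions_def)
  also have "{\<pi>\<in>pair_partitions n. s \<in> pairing_words n (b N) \<pi>} = {\<pi>}" using \<pi> uniq by blast
  hence "real (card (pairing_solutions n m \<pi>)) =
    (\<Sum>\<pi>\<in>{\<pi>\<in>pair_partitions n. s \<in> pairing_words n (b N) \<pi>}. real (card (pairing_solutions n m \<pi>)))" by simp
  finally show ?thesis .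
qed

text \<open>
  The main term replaces the expectation for a word by the sum over all pairings along which the word
  cancels. Both agree for paired words and vanish for words that are not matched; words with non-zero sum
  have no walks. Only the few unpaired words remain, and for them both quantities are bounded.
\<close>

lemma expectation_trace_variable_approx:
  assumes n: "n \<ge> 1"
  shows "\<bar>expectation (trace_variable n) -
      (\<Sum>\<pi>\<in>pair_partitions n. real (card (pairing_solutions n m \<pi>)) *
          (\<Sum>s\<in>pairing_words n (b N) \<pi>. real (walk_count n N s)))\<bar>
    \<le> real N * (m ^ n * (real n * moment_bound m n + card (pair_partitions n))) *
        (4 ^ (n\<^sup>2) * real (2 * b N + 1) ^ ((n - 1) div 2))"
proof -
  define h where "h s = (\<Sum>j\<in>labels n. expectation (word_monomial n s j))" for s
  \<comment> \<open>The value of \<open>h\<close> that the pairings predict, and the words for which it may be wrong.\<close>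
  define h' where "h' s = (\<Sum>\<pi>\<in>{\<pi>\<in>pair_partitions n. s \<in> pairing_words n (b N) \<pi>}. real (card (pairing_solutions n m \<pi>)))" for s
  define U where "U = {s \<in> words n. matched_word {..<n} s \<and> sum s {..<n} = 0 \<and> \<not> paired_word {..<n} s}"
  define K where "K = m ^ n * (real n * moment_bound m n + card (pair_partitions n))"
  have 1: "expectation (trace_variable n) = (\<Sum>s\<in>words n. real (walk_count n N s) * h s)"
  proof -
    have int: "integrable P (\<lambda>\<omega>. real (walk_count n N (fst w)) * word_monomial n (fst w) (snd w) \<omega>)"
      if "w \<in> words n \<times> labels n" for w
    proof -
      have "fst w \<in> words n" "snd w \<in> labels n" using that by (simp_all only: mem_Times_iff)
      thus ?thesis
        by (intro Bochner_Integration.integrable_mult_right has_moments_integrable(1)[OF word_monomial_has_moments])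
    qed
    have "expectation (trace_variable n) = (\<Sum>w\<in>words n \<times> labels n.
        expectation (\<lambda>\<omega>. real (walk_count n N (fst w)) * word_monomial n (fst w) (snd w) \<omega>))"
      unfolding trace_variable_def[abs_def] case_prod_unfold by (rule Bochner_Integration.integral_sum[OF int])
    also have "\<dots> = (\<Sum>(s, j)\<in>words n \<times> labels n. real (walk_count n N s) * expectation (word_monomial n s j))"
      by (simp add: case_prod_unfold)
    finally show ?thesis by (simp add: h_def sum_distrib_left sum.cartesian_product)
  qed
  have sub: "pairing_words n (b N) \<pi> \<subseteq> words n" for \<pi> by (auto simp: pairing_words_def)
  have 2: "(\<Sum>\<pi>\<in>pair_partitions n. real (card (pairing_solutions n m \<pi>)) *
          (\<Sum>s\<in>pairing_words n (b N) \<pi>. real (walk_count n N s))) = (\<Sum>s\<in>words n. real (walk_count n N s) * h' s)"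
  proof -
    have "(\<Sum>\<pi>\<in>pair_partitions n. real (card (pairing_solutions n m \<pi>)) *
          (\<Sum>s\<in>pairing_words n (b N) \<pi>. real (walk_count n N s))) =
       (\<Sum>\<pi>\<in>pair_partitions n. \<Sum>s\<in>{s\<in>words n. s \<in> pairing_words n (b N) \<pi>}.
          real (walk_count n N s) * real (card (pairing_solutions n m \<pi>)))"
      unfolding sum_distrib_left using sub by (intro sum.cong) (auto simp: mult.commute)
    also have "\<dots> = (\<Sum>s\<in>words n. \<Sum>\<pi>\<in>{\<pi>\<in>pair_partitions n. s \<in> pairing_words n (b N) \<pi>}.
          real (walk_count n N s) * real (card (pairing_solutions n m \<pi>)))"
      by (rule sum.swap_restrict[OF finite_pair_partitions finite_words])
    finally show ?thesis by (simp add: h'_def sum_distrib_left)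
  qed
  have zero: "real (walk_count n N s) * (h s - h' s) = 0" if s: "s \<in> words n - U" for s
  proof -
    consider "\<not> matched_word {..<n} s" | "sum s {..<n} \<noteq> 0" | "paired_word {..<n} s" using s by (auto simp: U_def)
    thus ?thesis
    proof cases
      case 1
      have "{\<pi>\<in>pair_partitions n. s \<in> pairing_words n (b N) \<pi>} = {}" using 1 pairing_words_matched(1) by blast
      hence "h' s = 0" unfolding h'_def by (simp only: sum.empty)
      moreover have "h s = 0" using 1 s expectation_word_monomial_unmatched by (simp add: h_def)
      ultimately show ?thesis by simp
    next
      case 2
      thus ?thesis using walk_count_eq_0[OF n] by simp
    next
      case 3
      thus ?thesis using sum_expectation_paired_word[of s n] s by (simp add: h_def h'_def)
    qed
  qed
  have K: "\<bar>h s - h' s\<bar> \<le> K" if s: "s \<in> words n" for s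
  proof -
    have "\<bar>h s\<bar> \<le> (\<Sum>j\<in>labels n. \<bar>expectation (word_monomial n s j)\<bar>)" unfolding h_def by (rule sum_abs)
    also have "\<dots> \<le> (\<Sum>j\<in>labels n. real n * moment_bound m n)"
      using abs_expectation_word_monomial_le[OF n s] by (intro sum_mono) auto
    also have "\<dots> = m ^ n * (real n * moment_bound m n)" by (simp add: card_labels)
    finally have a: "\<bar>h s\<bar> \<le> m ^ n * (real n * moment_bound m n)" .
    have "h' s \<le> (\<Sum>\<pi>\<in>pair_partitions n. real (card (pairing_solutions n m \<pi>)))"
      unfolding h'_def by (intro sum_mono2 finite_pair_partitions) auto
    also have "\<dots> \<le> (\<Sum>\<pi>\<in>pair_partitions n. real (m ^ n))"
      using card_pairing_solutions_le by (intro sum_mono) (simp del: of_nat_power)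
    also have "\<dots> = m ^ n * card (pair_partitions n)" by simp
    finally have "h' s \<le> m ^ n * card (pair_partitions n)" by simp
    moreover have "0 \<le> h' s" by (simp add: h'_def sum_nonneg)
    ultimately show ?thesis using a by (simp add: K_def algebra_simps)
  qed
  have K0: "0 \<le> K" by (simp add: K_def moment_bound_def)
  have "\<bar>expectation (trace_variable n) -
      (\<Sum>\<pi>\<in>pair_partitions n. real (card (pairing_solutions n m \<pi>)) *
          (\<Sum>s\<in>pairing_words n (b N) \<pi>. real (walk_count n N s)))\<bar> =
      \<bar>\<Sum>s\<in>words n. real (walk_count n N s) * (h s - h' s)\<bar>"
    unfolding 1 2 by (simp add: sum_subtractf right_diff_distrib)
  also have "(\<Sum>s\<in>words n. real (walk_count n N s) * (h s - h' s)) = (\<Sum>s\<in>U. real (walk_count n N s) * (h s - h' s))"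
    using zero finite_words by (intro sum.mono_neutral_right) (auto simp: U_def)
  also have "\<bar>\<dots>\<bar> \<le> (\<Sum>s\<in>U. \<bar>real (walk_count n N s) * (h s - h' s)\<bar>)" by (rule sum_abs)
  also have "\<dots> \<le> (\<Sum>s\<in>U. real N * K)"
    using walk_count_le[OF n] K by (intro sum_mono) (auto simp: abs_mult U_def intro!: mult_mono)
  also have "\<dots> = real N * K * real (card U)" by simp
  also have "\<dots> \<le> real N * K * (4 ^ (n\<^sup>2) * real (2 * b N + 1) ^ ((n - 1) div 2))"
  proof (rule mult_left_mono)
    have "card U \<le> 4 ^ ((card {..<n})\<^sup>2) * (2 * b N + 1) ^ ((card {..<n} - 1) div 2)"
      unfolding U_def using n by (intro card_unpaired_words_le) (auto simp: lessThan_empty_iff)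
    hence "real (card U) \<le> real (4 ^ (n\<^sup>2) * (2 * b N + 1) ^ ((n - 1) div 2))" by (simp del: of_nat_mult of_nat_power)
    thus "real (card U) \<le> 4 ^ (n\<^sup>2) * real (2 * b N + 1) ^ ((n - 1) div 2)" by simp
    show "0 \<le> real N * K" using K0 by simp
  qed
  finally show ?thesis by (simp add: K_def)
qed

text \<open>
  The twelfth power expands into a sum over twelve rows, each consisting of a word and labels. A term
  vanishes unless every absolute value occurs at least twice, every row adds up to zero and every row is linked to
  another one; the remaining terms are counted by \<open>card_linked_words_le\<close> and bounded uniformly.
\<close>

lemma expectation_centred_trace_12:
  assumes n: "n \<ge> 1"
  shows "expectation (\<lambda>\<omega>. (trace_variable n \<omega> - expectation (trace_variable n)) ^ 12) \<le>
    real N ^ 12 * (12 * (2 ^ 12 * (real n * moment_bound m (12 * n) + (real n * moment_bound m n) ^ 12))) *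
      (4 ^ ((12 * n)\<^sup>2) * real (2 * b N + 1) ^ (6 * n - 2) * real m ^ (12 * n))" (is "_ \<le> _ * ?K * _")
    and "integrable P (\<lambda>\<omega>. (trace_variable n \<omega> - expectation (trace_variable n)) ^ 12)"
proof -
  define R where "R = {..<12::nat}"
  define W where "W = words n \<times> labels n"
  define c where "c w = word_monomial n (fst w) (snd w)" for w
  define wt where "wt w = real (walk_count n N (fst w))" for w :: "(nat \<Rightarrow> int) \<times> (nat \<Rightarrow> nat)"
  define Z where "Z w \<omega> = wt w * (c w \<omega> - expectation (c w))" for w \<omega>
  have finW: "finite W" unfolding W_def using finite_words finite_labels by (rule finite_cartesian_product)
  have cm: "has_moments (c w)" if "w \<in> W" for w
    unfolding c_def using that[unfolded W_def mem_Times_iff] by (intro word_monomial_has_moments) simp_all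
  have Wfst: "fst w \<in> words n" and Wsnd: "snd w \<in> labels n" if "w \<in> W" for w
    using that unfolding W_def mem_Times_iff by simp_all
  have tv: "trace_variable n \<omega> = (\<Sum>w\<in>W. wt w * c w \<omega>)" for \<omega>
    by (simp add: trace_variable_def W_def wt_def c_def case_prod_unfold)
  have etv: "expectation (trace_variable n) = (\<Sum>w\<in>W. wt w * expectation (c w))"
    unfolding tv[abs_def] using has_moments_integrable(1)[OF cm] by (subst Bochner_Integration.integral_sum) auto
  have expand: "(trace_variable n \<omega> - expectation (trace_variable n)) ^ 12 =
      (\<Sum>\<rho>\<in>R \<rightarrow>\<^sub>E W. (\<Prod>r\<in>R. wt (\<rho> r)) * (\<Prod>r\<in>R. c (\<rho> r) \<omega> - expectation (c (\<rho> r))))" for \<omega>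
  proof -
    have "trace_variable n \<omega> - expectation (trace_variable n) = (\<Sum>w\<in>W. Z w \<omega>)"
      unfolding etv unfolding tv by (simp add: Z_def sum_subtractf right_diff_distrib)
    hence "(trace_variable n \<omega> - expectation (trace_variable n)) ^ 12 = (\<Prod>r\<in>R. \<Sum>w\<in>W. Z w \<omega>)"
      by (simp add: R_def)
    also have "\<dots> = (\<Sum>\<rho>\<in>R \<rightarrow>\<^sub>E W. \<Prod>r\<in>R. Z (\<rho> r) \<omega>)"
      by (rule prod_sum_PiE) (auto simp: R_def finW)
    finally show ?thesis by (simp add: Z_def prod.distrib)
  qed
  define G where "G \<rho> = expectation (\<lambda>\<omega>. \<Prod>r\<in>R. c (\<rho> r) \<omega> - expectation (c (\<rho> r)))" for \<rho>
  have mem: "\<rho> r \<in> W" if "\<rho> \<in> R \<rightarrow>\<^sub>E W" "r \<in> R" for \<rho> r using PiE_mem[OF that] .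
  have int: "integrable P (\<lambda>\<omega>. \<Prod>r\<in>R. c (\<rho> r) \<omega> - expectation (c (\<rho> r)))" if "\<rho> \<in> R \<rightarrow>\<^sub>E W" for \<rho>
    using mem[OF that] by (intro has_moments_integrable(1) has_moments_prod has_moments_diff cm)
  show "integrable P (\<lambda>\<omega>. (trace_variable n \<omega> - expectation (trace_variable n)) ^ 12)"
    unfolding expand using int by (intro Bochner_Integration.integrable_sum Bochner_Integration.integrable_mult_right) auto
  have E: "expectation (\<lambda>\<omega>. (trace_variable n \<omega> - expectation (trace_variable n)) ^ 12) =
      (\<Sum>\<rho>\<in>R \<rightarrow>\<^sub>E W. (\<Prod>r\<in>R. wt (\<rho> r)) * G \<rho>)"
    unfolding expand G_def using int by (subst Bochner_Integration.integral_sum) auto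

  define L where "L = R \<times> {..<n}"
  define word where "word \<rho> = (\<lambda>(r, l)\<in>L. fst (\<rho> r) l)" for \<rho> :: "nat \<Rightarrow> (nat \<Rightarrow> int) \<times> (nat \<Rightarrow> nat)"
  \<comment> \<open>The words, read along all twelve rows, that can contribute.\<close>
  define S where "S = {s \<in> L \<rightarrow>\<^sub>E {- int (b N)..int (b N)}. matched_word L s \<and> (\<forall>r\<in>R. (\<Sum>l<n. s (r, l)) = 0) \<and>
              (\<forall>r\<in>R. \<exists>l<n. \<exists>r'\<in>R. \<exists>l'<n. r' \<noteq> r \<and> \<bar>s (r', l')\<bar> = \<bar>s (r, l)\<bar>)}"
  define \<kappa> where "\<kappa> \<rho> = (\<lambda>(r, l). letter_key n (fst (\<rho> r)) (snd (\<rho> r)) l)" for \<rho> :: "nat \<Rightarrow> (nat \<Rightarrow> int) \<times> (nat \<Rightarrow> nat)"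
  have word: "word \<rho> (r, l) = fst (\<rho> r) l" if "r \<in> R" "l < n" for \<rho> r l
    using that by (simp add: word_def L_def)
  have f\<kappa>: "fst (\<kappa> \<rho> (r, l)) = \<bar>word \<rho> (r, l)\<bar>" if "r \<in> R" "l < n" for \<rho> r l
    using that by (simp add: \<kappa>_def fst_letter_key word)
  have c\<kappa>: "c (\<rho> r) = (\<lambda>\<omega>. \<Prod>l<n. entry (\<kappa> \<rho> (r, l)) \<omega>)" for \<rho> r
    by (simp add: c_def word_monomial_def[abs_def] \<kappa>_def)
  have \<kappa>free: "\<kappa> \<rho> p \<in> free_entries (b N) m" if \<rho>: "\<rho> \<in> R \<rightarrow>\<^sub>E W" and p: "p \<in> R \<times> {..<n}" for \<rho> p
  proof -
    obtain r l where rl: "p = (r, l)" "r \<in> R" "l < n" using p by blast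
    show ?thesis
      using letter_key_free[OF Wfst[OF mem[OF \<rho> rl(2)]] Wsnd[OF mem[OF \<rho> rl(2)]] rl(3)] by (simp add: \<kappa>_def rl(1))
  qed
  have finR: "finite R" and cR: "card R = 12" by (auto simp: R_def)
  have Gbd: "\<bar>G \<rho>\<bar> \<le> ?K" if \<rho>: "\<rho> \<in> R \<rightarrow>\<^sub>E W" for \<rho>
  proof -
    have ne: "R \<noteq> {}" using cR by auto
    have "\<bar>G \<rho>\<bar> \<le> real (card R) * (2 ^ card R * (real n * moment_bound m (card R * n) + (real n * moment_bound m n) ^ card R))"
      unfolding G_def c\<kappa> by (rule entries.abs_expectation_centred_rows_le[OF finR n \<kappa>free[OF \<rho>] ne])
    thus ?thesis by (simp only: cR of_nat_numeral)
  qed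
  have vanish: "(\<Prod>r\<in>R. wt (\<rho> r)) * G \<rho> = 0" if \<rho>: "\<rho> \<in> R \<rightarrow>\<^sub>E W" and nS: "word \<rho> \<notin> S" for \<rho>
  proof -
    have wPi: "word \<rho> \<in> L \<rightarrow>\<^sub>E {- int (b N)..int (b N)}"
      unfolding word_def
    proof (rule restrict_PiE_iff[THEN iffD2], rule ballI)
      fix p assume p: "p \<in> L"
      obtain r l where rl: "p = (r, l)" "r \<in> R" "l < n" using p unfolding L_def by blast
      from PiE_mem[OF Wfst[OF mem[OF \<rho> rl(2)]], of l] rl
      show "(case p of (r, l) \<Rightarrow> fst (\<rho> r) l) \<in> {- int (b N)..int (b N)}" by simp
    qed
    consider "\<not> matched_word L (word \<rho>)" | "\<exists>r\<in>R. (\<Sum>l<n. word \<rho> (r, l)) \<noteq> 0"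
      | "\<exists>r\<in>R. \<forall>l<n. \<forall>r'\<in>R. \<forall>l'<n. r' \<noteq> r \<longrightarrow> \<bar>word \<rho> (r', l')\<bar> \<noteq> \<bar>word \<rho> (r, l)\<bar>"
      using nS wPi unfolding S_def by blast
    thus ?thesis
    proof cases
      case 1
      then obtain p where p: "p \<in> L" "\<And>q. q \<in> L \<Longrightarrow> q \<noteq> p \<Longrightarrow> \<bar>word \<rho> q\<bar> \<noteq> \<bar>word \<rho> p\<bar>"
        unfolding matched_word_def by blast
      obtain r0 l0 where rl: "p = (r0, l0)" "r0 \<in> R" "l0 < n" using p(1) by (auto simp: L_def)
      have "G \<rho> = 0"
        unfolding G_def c\<kappa>
      proof (rule entries.expectation_centred_rows_lone[OF finR n \<kappa>free[OF \<rho>] rl(2,3)])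
        fix q assume q: "q \<in> R \<times> {..<n}" "q \<noteq> (r0, l0)"
        obtain r l where "q = (r, l)" "r \<in> R" "l < n" using q(1) by auto
        thus "\<kappa> \<rho> q \<noteq> \<kappa> \<rho> (r0, l0)" using p(2)[of q] q f\<kappa>[of r l \<rho>] f\<kappa>[of r0 l0 \<rho>] rl by (auto simp: L_def)
      qed
      thus ?thesis by simp
    next
      case 2
      then obtain r where r: "r \<in> R" "(\<Sum>l<n. word \<rho> (r, l)) \<noteq> 0" by blast
      have "sum (fst (\<rho> r)) {..<n} \<noteq> 0" using r word[OF r(1)] by simp
      hence "wt (\<rho> r) = 0" by (simp add: wt_def walk_count_eq_0[OF n])
      hence "(\<Prod>r\<in>R. wt (\<rho> r)) = 0" using r(1) finR by (intro prod_zero) auto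
      thus ?thesis by simp
    next
      case 3
      then obtain r0 where r0: "r0 \<in> R" "\<And>l r l'. l < n \<Longrightarrow> r \<in> R \<Longrightarrow> l' < n \<Longrightarrow> r \<noteq> r0 \<Longrightarrow>
          \<bar>word \<rho> (r, l')\<bar> \<noteq> \<bar>word \<rho> (r0, l)\<bar>" by blast
      have "G \<rho> = 0"
        unfolding G_def c\<kappa>
      proof (rule entries.expectation_centred_rows_isolated[OF finR n \<kappa>free[OF \<rho>] r0(1)])
        fix l r l' assume *: "l < n" "r \<in> R" "r \<noteq> r0" "l' < n"
        show "\<kappa> \<rho> (r, l') \<noteq> \<kappa> \<rho> (r0, l)"
          using r0(2)[OF *(1,2,4,3)] f\<kappa>[OF *(2,4), of \<rho>] f\<kappa>[OF r0(1) *(1), of \<rho>] by auto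
      qed
      thus ?thesis by simp
    qed
  qed
  have finRW: "finite (R \<rightarrow>\<^sub>E W)" using finR finW by (intro finite_PiE) auto
  have finS: "finite S"
    by (rule finite_subset[of _ "L \<rightarrow>\<^sub>E {- int (b N)..int (b N)}"]) (auto simp: S_def L_def finR intro!: finite_PiE)
  define Q where "Q = {\<rho> \<in> R \<rightarrow>\<^sub>E W. word \<rho> \<in> S}"
  have cardQ: "card Q \<le> card S * m ^ (12 * n)"
  proof -
    have "card Q \<le> card (S \<times> (R \<rightarrow>\<^sub>E labels n))"
    proof (rule card_inj_on_le[of "\<lambda>\<rho>. (word \<rho>, \<lambda>r\<in>R. snd (\<rho> r))"])
      show "inj_on (\<lambda>\<rho>. (word \<rho>, \<lambda>r\<in>R. snd (\<rho> r))) Q"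
      proof (rule inj_onI)
        fix \<rho> \<rho>' assume \<rho>: "\<rho> \<in> Q" "\<rho>' \<in> Q" and eq: "(word \<rho>, \<lambda>r\<in>R. snd (\<rho> r)) = (word \<rho>', \<lambda>r\<in>R. snd (\<rho>' r))"
        have Pi: "\<rho> \<in> R \<rightarrow>\<^sub>E W" "\<rho>' \<in> R \<rightarrow>\<^sub>E W" using \<rho> by (auto simp: Q_def)
        have "\<rho> r = \<rho>' r" if r: "r \<in> R" for r
        proof (rule prod_eqI)
          show "snd (\<rho> r) = snd (\<rho>' r)" using fun_cong[OF conjunct2[OF eq[unfolded prod.inject]], of r] r by simp
          have "fst (\<rho> r) \<in> words n" "fst (\<rho>' r) \<in> words n"
            using Wfst[OF mem[OF Pi(1) r]] Wfst[OF mem[OF Pi(2) r]] .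
          moreover have "fst (\<rho> r) l = fst (\<rho>' r) l" if "l < n" for l
            using word[OF r that, of \<rho>] word[OF r that, of \<rho>'] eq by simp
          ultimately show "fst (\<rho> r) = fst (\<rho>' r)" by (intro PiE_ext[of _ "{..<n}"]) auto
        qed
        thus "\<rho> = \<rho>'" by (intro PiE_ext[OF Pi])
      qed
      show "(\<lambda>\<rho>. (word \<rho>, \<lambda>r\<in>R. snd (\<rho> r))) ` Q \<subseteq> S \<times> (R \<rightarrow>\<^sub>E labels n)"
      proof (rule image_subsetI)
        fix \<rho> assume \<rho>: "\<rho> \<in> Q"
        have "\<rho> \<in> R \<rightarrow>\<^sub>E W" using \<rho> by (simp add: Q_def)
        hence "snd (\<rho> r) \<in> labels n" if "r \<in> R" for r using Wsnd[OF mem[of \<rho> r]] that by blast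
        thus "(word \<rho>, \<lambda>r\<in>R. snd (\<rho> r)) \<in> S \<times> (R \<rightarrow>\<^sub>E labels n)" using \<rho> by (simp add: Q_def)
      qed
      show "finite (S \<times> (R \<rightarrow>\<^sub>E labels n))" using finS finR finite_labels by (intro finite_cartesian_product finite_PiE) auto
    qed
    thus ?thesis using finR by (simp add: card_cartesian_product card_PiE cR card_labels power_mult[symmetric] mult.commute)
  qed
  have cardS: "card S \<le> 4 ^ ((12 * n)\<^sup>2) * (2 * b N + 1) ^ (6 * n - 2)"
  proof -
    have cL: "card L = 12 * n" by (simp add: L_def card_cartesian_product cR)
    have "card S \<le> 4 ^ ((card L)\<^sup>2) * (2 * b N + 1) ^ (card L div 2 - 2)"
      unfolding S_def L_def using cR by (intro card_linked_words_le[OF finR _ n]) simp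
    thus ?thesis by (simp add: cL)
  qed
  have K0: "0 \<le> ?K" by (simp add: moment_bound_def)
  have "(\<Sum>\<rho>\<in>R \<rightarrow>\<^sub>E W. (\<Prod>r\<in>R. wt (\<rho> r)) * G \<rho>) = (\<Sum>\<rho>\<in>Q. (\<Prod>r\<in>R. wt (\<rho> r)) * G \<rho>)"
    using finRW vanish by (intro sum.mono_neutral_right) (auto simp: Q_def)
  also have "\<dots> \<le> (\<Sum>\<rho>\<in>Q. real N ^ 12 * ?K)"
  proof (rule sum_mono)
    fix \<rho> assume \<rho>: "\<rho> \<in> Q"
    have "0 \<le> (\<Prod>r\<in>R. wt (\<rho> r))" by (intro prod_nonneg) (simp add: wt_def)
    moreover have "(\<Prod>r\<in>R. wt (\<rho> r)) \<le> (\<Prod>r\<in>R. real N)"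
      by (intro prod_mono) (simp add: wt_def walk_count_le[OF n])
    moreover have "(\<Prod>r\<in>R. real N) = real N ^ 12" by (simp add: cR)
    ultimately have w: "0 \<le> (\<Prod>r\<in>R. wt (\<rho> r))" "(\<Prod>r\<in>R. wt (\<rho> r)) \<le> real N ^ 12" by auto
    have "(\<Prod>r\<in>R. wt (\<rho> r)) * G \<rho> \<le> (\<Prod>r\<in>R. wt (\<rho> r)) * ?K"
      using Gbd[of \<rho>] \<rho> w by (intro mult_left_mono) (auto simp: Q_def)
    also have "\<dots> \<le> real N ^ 12 * ?K" using w K0 by (intro mult_right_mono) auto
    finally show "(\<Prod>r\<in>R. wt (\<rho> r)) * G \<rho> \<le> real N ^ 12 * ?K" .
  qed
  also have "\<dots> = real N ^ 12 * ?K * real (card Q)" by simp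
  also have "\<dots> \<le> real N ^ 12 * ?K * (4 ^ ((12 * n)\<^sup>2) * real (2 * b N + 1) ^ (6 * n - 2) * real m ^ (12 * n))"
  proof (rule mult_left_mono)
    have "card Q \<le> 4 ^ ((12 * n)\<^sup>2) * (2 * b N + 1) ^ (6 * n - 2) * m ^ (12 * n)"
      using cardQ mult_right_mono[OF cardS, of "m ^ (12 * n)"] by linarith
    hence "real (card Q) \<le> real (4 ^ ((12 * n)\<^sup>2) * (2 * b N + 1) ^ (6 * n - 2) * m ^ (12 * n))"
      by (simp only: of_nat_le_iff)
    thus "real (card Q) \<le> 4 ^ ((12 * n)\<^sup>2) * real (2 * b N + 1) ^ (6 * n - 2) * real m ^ (12 * n)" by simp
    show "0 \<le> real N ^ 12 * ?K" using K0 by (intro mult_nonneg_nonneg) auto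
  qed
  finally show "expectation (\<lambda>\<omega>. (trace_variable n \<omega> - expectation (trace_variable n)) ^ 12) \<le>
    real N ^ 12 * ?K * (4 ^ ((12 * n)\<^sup>2) * real (2 * b N + 1) ^ (6 * n - 2) * real m ^ (12 * n))"
    unfolding E .
qed

end

section \<open>Convergence of the mean moments\<close>

text \<open>
  The case \<open>n = 0\<close> is separate because the empty pairing would contribute \<open>1 / m\<close> to the sum.
\<close>

definition limit_moment :: "nat \<Rightarrow> nat \<Rightarrow> real" where
  "limit_moment m n = (if n = 0 then 1 else
     (\<Sum>\<pi>\<in>pair_partitions n. real (card (pairing_solutions n m \<pi>)) / real m ^ (n div 2 + 1)))"

text \<open>
  An error term with fewer than \<open>n / 2\<close> free letters loses, up to a constant, at least a factor \<open>sqrt x\<close>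
  against the normalisation.
\<close>

lemma scaled_odd_power_le:
  fixes x :: real
  assumes x: "x \<ge> 1" and c: "0 \<le> c" "c \<le> 1 / sqrt x" and r: "2 * r + 1 \<le> n"
  shows "c ^ n * (2 * x + 1) ^ r \<le> 3 ^ r / sqrt x"
proof -
  have sx: "sqrt x \<ge> 1" using x by simp
  have "c ^ n * (2 * x + 1) ^ r \<le> (1 / sqrt x) ^ n * (3 * x) ^ r"
    using x c by (intro mult_mono power_mono) auto
  also have "(1 / sqrt x) ^ n \<le> (1 / sqrt x) ^ (2 * r + 1)"
    using r sx by (intro power_decreasing) (auto simp: field_simps)
  hence "(1 / sqrt x) ^ n * (3 * x) ^ r \<le> (1 / sqrt x) ^ (2 * r + 1) * (3 * x) ^ r"
    using x by (intro mult_right_mono) auto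
  also have "(1 / sqrt x) ^ (2 * r + 1) * (3 * x) ^ r = 3 ^ r / sqrt x"
  proof -
    have "(1 / sqrt x) ^ (2 * r + 1) = 1 / (x ^ r * sqrt x)"
      using x by (simp add: power_add power_mult power_divide)
    thus ?thesis using x by (simp add: power_mult_distrib)
  qed
  finally show ?thesis .
qed

context block_toeplitz_band_model
begin

text \<open>
  There are \<open>(2 b\<^sub>N + 1) ^ (n div 2)\<close> words for the pairing and between \<open>N - 2 n b\<^sub>N\<close> and \<open>N\<close> walks for each of
  them. As \<open>b\<^sub>N / N\<close> tends to zero the number of walks may be replaced by \<open>N\<close>, and as \<open>b\<^sub>N\<close> tends to infinity
  \<open>2 b\<^sub>N + 1\<close> may be replaced by \<open>2 b\<^sub>N\<close>.
\<close>

lemma pairing_weight_tendsto: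
  assumes m: "1 \<le> m" and n: "n \<ge> 1" and \<pi>: "\<pi> \<in> pair_partitions n"
    and small: "(\<lambda>N. real (b N)) \<in> o(\<lambda>N. real N)" and large: "filterlim b at_top sequentially"
  shows "(\<lambda>N. (1 / sqrt (2 * real m * real (b N))) ^ n *
      (\<Sum>s\<in>pairing_words n (b N) \<pi>. real (walk_count n N s)) / (real m * real N))
    \<longlonglongrightarrow> 1 / real m ^ (n div 2 + 1)"
proof -
  define k where "k = n div 2"
  have n2k: "n = 2 * k"
    unfolding k_def using pair_partition_halves(4)[OF \<pi>]
    by (metis nonzero_mult_div_cancel_left zero_neq_numeral)
  define w where "w N = (\<Sum>s\<in>pairing_words n (b N) \<pi>. real (walk_count n N s))" for N
  define x where "x N = real (b N)" for N
  have evb: "\<forall>\<^sub>F N in sequentially. b N \<ge> 1" using large by (simp add: filterlim_at_top)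
  have ev1: "\<forall>\<^sub>F N :: nat in sequentially. N \<ge> 1" by (rule eventually_ge_at_top)
  have xtop: "filterlim x at_top sequentially"
    unfolding x_def by (rule filterlim_compose[OF filterlim_real_sequentially large])
  have inv: "(\<lambda>N. 1 / (2 * x N)) \<longlonglongrightarrow> 0"
    by (rule tendsto_divide_0[OF tendsto_const filterlim_at_top_imp_at_infinity])
       (rule filterlim_tendsto_pos_mult_at_top[OF tendsto_const _ xtop], simp)
  have ratio: "(\<lambda>N. x N / real N) \<longlonglongrightarrow> 0"
    using smalloD_tendsto[OF small] by (simp add: x_def)
  have up: "w N \<le> real N * (2 * x N + 1) ^ k" for N
  proof -
    have "w N \<le> (\<Sum>s\<in>pairing_words n (b N) \<pi>. real N)"
      unfolding w_def using walk_count_le[OF n] by (intro sum_mono) simp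
    also have "\<dots> = real N * (2 * x N + 1) ^ k"
      using card_pairing_words[OF \<pi>, of "b N"] by (simp add: k_def x_def add.commute)
    finally show ?thesis .
  qed
  have low: "(real N - 2 * n * x N) * (2 * x N + 1) ^ k \<le> w N" for N
  proof -
    have "(real N - 2 * n * x N) * (2 * x N + 1) ^ k = (\<Sum>s\<in>pairing_words n (b N) \<pi>. real N - 2 * n * x N)"
      using card_pairing_words[OF \<pi>, of "b N"] by (simp add: k_def x_def add.commute)
    also have "\<dots> \<le> w N"
      unfolding w_def
    proof (rule sum_mono)
      fix s assume s: "s \<in> pairing_words n (b N) \<pi>"
      have "s \<in> {..<n} \<rightarrow>\<^sub>E {- int (b N)..int (b N)}" using s by (simp add: pairing_words_def)
      from walk_count_ge[OF n this pairing_words_matched(2)[OF \<pi> s], of N]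
      have "real (N - 2 * (n * b N)) \<le> real (walk_count n N s)" by (simp only: of_nat_le_iff)
      moreover have "real N - 2 * n * x N \<le> real (N - 2 * (n * b N))" by (simp add: x_def of_nat_diff_real max_def)
      ultimately show "real N - 2 * n * x N \<le> real (walk_count n N s)" by linarith
    qed
    finally show ?thesis .
  qed
  have "(\<lambda>N. w N / (real N * (2 * x N + 1) ^ k)) \<longlonglongrightarrow> 1"
  proof (rule tendsto_sandwich)
    show "\<forall>\<^sub>F N in sequentially. 1 - 2 * n * (x N / real N) \<le> w N / (real N * (2 * x N + 1) ^ k)"
      using ev1
    proof eventually_elim
      case (elim N)
      have p: "(2 * x N + 1) ^ k > 0" by (simp add: x_def add_nonneg_pos)
      have "1 - 2 * n * (x N / real N) = (real N - 2 * n * x N) * (2 * x N + 1) ^ k / (real N * (2 * x N + 1) ^ k)"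
      proof -
        have "(real N - 2 * n * x N) * (2 * x N + 1) ^ k / (real N * (2 * x N + 1) ^ k) = (real N - 2 * n * x N) / real N"
          by (rule mult_divide_mult_cancel_right[OF less_imp_neq[OF p, THEN not_sym]])
        thus ?thesis using elim by (simp add: diff_divide_distrib)
      qed
      also have "\<dots> \<le> w N / (real N * (2 * x N + 1) ^ k)"
        using low[of N] elim p by (intro divide_right_mono) auto
      finally show ?case .
    qed
    show "\<forall>\<^sub>F N in sequentially. w N / (real N * (2 * x N + 1) ^ k) \<le> 1"
      using ev1
    proof eventually_elim
      case (elim N)
      have p: "(2 * x N + 1) ^ k > 0" by (simp add: x_def add_nonneg_pos)
      thus ?case using up[of N] elim by (simp add: divide_le_eq)
    qed
    have "(\<lambda>N. 1 - 2 * n * (x N / real N)) \<longlonglongrightarrow> 1 - real (2 * n) * 0"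
      by (intro tendsto_intros ratio)
    thus "(\<lambda>N. 1 - 2 * n * (x N / real N)) \<longlonglongrightarrow> 1" by simp
  qed auto
  moreover have "(\<lambda>N. (1 + 1 / (2 * x N)) ^ k / real m ^ (k + 1)) \<longlonglongrightarrow> (1 + 0) ^ k / real m ^ (k + 1)"
    using m by (intro tendsto_intros inv) auto
  ultimately have "(\<lambda>N. w N / (real N * (2 * x N + 1) ^ k) * ((1 + 1 / (2 * x N)) ^ k / real m ^ (k + 1)))
      \<longlonglongrightarrow> 1 * ((1 + 0) ^ k / real m ^ (k + 1))"
    by (rule tendsto_mult)
  hence lim: "(\<lambda>N. w N / (real N * (2 * x N + 1) ^ k) * ((1 + 1 / (2 * x N)) ^ k / real m ^ (k + 1)))
      \<longlonglongrightarrow> 1 / real m ^ (k + 1)" by simp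
  have "\<forall>\<^sub>F N in sequentially. w N / (real N * (2 * x N + 1) ^ k) * ((1 + 1 / (2 * x N)) ^ k / real m ^ (k + 1)) =
      (1 / sqrt (2 * real m * x N)) ^ n * w N / (real m * real N)"
    using evb
  proof eventually_elim
    case (elim N)
    have x: "x N \<ge> 1" using elim by (simp add: x_def)
    have "(1 / sqrt (2 * real m * x N)) ^ n = 1 / (2 * real m * x N) ^ k"
      using x by (simp add: n2k power_mult power_divide)
    moreover have "1 + 1 / (2 * x N) = (2 * x N + 1) / (2 * x N)" using x by (simp add: field_simps)
    ultimately show ?case using x by (simp add: power_divide power_mult_distrib)
  qed
  from Lim_transform_eventually[OF lim this]
  show ?thesis by (simp add: w_def x_def k_def)
qed

lemma mean_moment_tendsto:
  assumes m: "1 \<le> m"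
    and small: "(\<lambda>N. real (b N)) \<in> o(\<lambda>N. real N)" and large: "filterlim b at_top sequentially"
  shows "(\<lambda>N. expectation (\<lambda>\<omega>. trace_power n (normalized_toeplitz b a m N \<omega>)) / (real m * real N))
    \<longlonglongrightarrow> limit_moment m n"
proof (cases "n = 0")
  case True
  have "\<forall>\<^sub>F N in sequentially. expectation (\<lambda>\<omega>. trace_power n (normalized_toeplitz b a m N \<omega>)) / (real m * real N) = 1"
    using eventually_ge_at_top[of 1]
  proof eventually_elim
    case (elim N)
    have "trace_power n (normalized_toeplitz b a m N \<omega>) = real m * real N" for \<omega>
      using True by (simp add: trace_power_def normalized_toeplitz_def block_toeplitz_mat_def)
    thus ?case using elim m by (simp add: prob_space)
  qed
  from tendsto_eventually[OF this] show ?thesis using True by (simp add: limit_moment_def)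
next
  case False
  hence n: "n \<ge> 1" by simp
  define c where "c N = 1 / sqrt (2 * real m * real (b N))" for N
  define w where "w \<pi> N = (\<Sum>s\<in>pairing_words n (b N) \<pi>. real (walk_count n N s))" for \<pi> N
  define K where "K = real m ^ n * (real n * moment_bound m n + card (pair_partitions n)) * 4 ^ (n\<^sup>2)"
  define r where "r = (n - 1) div 2"
  define main where "main N = (\<Sum>\<pi>\<in>pair_partitions n. real (card (pairing_solutions n m \<pi>)) *
      (c N ^ n * w \<pi> N / (real m * real N)))" for N
  define e where "e N = expectation (\<lambda>\<omega>. trace_power n (normalized_toeplitz b a m N \<omega>)) / (real m * real N)" for N
  have K0: "0 \<le> K" by (simp add: K_def moment_bound_def)
  have "main \<longlonglongrightarrow> (\<Sum>\<pi>\<in>pair_partitions n. real (card (pairing_solutions n m \<pi>)) * (1 / real m ^ (n div 2 + 1)))"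
    unfolding main_def[abs_def] c_def w_def
    by (intro tendsto_sum tendsto_mult tendsto_const pairing_weight_tendsto[OF m n _ small large])
  hence main: "main \<longlonglongrightarrow> limit_moment m n" using False by (simp add: limit_moment_def)
  have evb: "\<forall>\<^sub>F N in sequentially. b N \<ge> 1" using large by (simp add: filterlim_at_top)
  have bound: "\<forall>\<^sub>F N in sequentially. norm (e N - main N) \<le> K * 3 ^ r / sqrt (real (b N))"
    using evb eventually_ge_at_top[of 1]
  proof eventually_elim
    case (elim N)
    interpret block_toeplitz_fixed P b a m N by unfold_locales (use m elim in auto)
    define S where "S = (\<Sum>\<pi>\<in>pair_partitions n. real (card (pairing_solutions n m \<pi>)) * w \<pi> N)"
    have c: "0 \<le> c N" "c N \<le> 1 / sqrt (real (b N))"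
    proof -
      have "1 * real (b N) \<le> 2 * real m * real (b N)" using m by (intro mult_right_mono) auto
      hence "sqrt (real (b N)) \<le> sqrt (2 * real m * real (b N))" by simp
      thus "c N \<le> 1 / sqrt (real (b N))" unfolding c_def using elim by (intro divide_left_mono) auto
    qed (simp add: c_def)
    have "expectation (\<lambda>\<omega>. trace_power n (normalized_toeplitz b a m N \<omega>)) = expectation (\<lambda>\<omega>. c N ^ n * trace_variable n \<omega>)"
      unfolding c_def by (intro Bochner_Integration.integral_cong refl trace_power_normalized_toeplitz n)
    hence E: "e N = c N ^ n * expectation (trace_variable n) / (real m * real N)"
      by (simp add: e_def)
    have M: "main N = c N ^ n * S / (real m * real N)"
      by (simp add: main_def S_def sum_distrib_left sum_divide_distrib mult.left_commute)
    have "norm (e N - main N) = c N ^ n / (real m * real N) * \<bar>expectation (trace_variable n) - S\<bar>"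
      unfolding E M using c(1) by (simp add: abs_mult diff_divide_distrib[symmetric] right_diff_distrib[symmetric])
    also have "\<dots> \<le> c N ^ n / (real m * real N) * (real N * K * (2 * real (b N) + 1) ^ r)"
    proof (rule mult_left_mono)
      have "\<bar>expectation (trace_variable n) - S\<bar> \<le>
          real N * (m ^ n * (real n * moment_bound m n + card (pair_partitions n))) *
            (4 ^ (n\<^sup>2) * real (2 * b N + 1) ^ ((n - 1) div 2))"
        using expectation_trace_variable_approx[OF n] by (simp add: S_def w_def)
      also have "\<dots> = real N * K * (2 * real (b N) + 1) ^ r"
        by (simp add: K_def r_def add.commute)
      finally show "\<bar>expectation (trace_variable n) - S\<bar> \<le> real N * K * (2 * real (b N) + 1) ^ r" .
      show "0 \<le> c N ^ n / (real m * real N)" using c by simp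
    qed
    also have "\<dots> = K / real m * (c N ^ n * (2 * real (b N) + 1) ^ r)" using elim by simp
    also have "\<dots> \<le> K / real m * (3 ^ r / sqrt (real (b N)))"
      using elim c K0 n by (intro mult_left_mono scaled_odd_power_le) (auto simp: r_def)
    also have "\<dots> \<le> K * (3 ^ r / sqrt (real (b N)))"
      using m K0 by (intro mult_right_mono) (auto simp: divide_le_eq mult_le_cancel_left1)
    finally show ?case by simp
  qed
  have "(\<lambda>N. K * 3 ^ r / sqrt (real (b N))) \<longlonglongrightarrow> 0"
    by (intro tendsto_divide_0[OF tendsto_const] filterlim_at_top_imp_at_infinity
        filterlim_compose[OF sqrt_at_top] filterlim_compose[OF filterlim_real_sequentially large])
  from Lim_null_comparison[OF bound this] have "(\<lambda>N. e N - main N) \<longlonglongrightarrow> 0" .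
  from tendsto_add[OF this main] show ?thesis by (simp add: e_def)
qed

section \<open>Almost sure convergence of the empirical moments\<close>

text \<open>
  The \<open>6 n - 2\<close> free letters of \<open>expectation_centred_trace_12\<close> are two fewer than the normalisation
  \<open>b\<^sub>N ^ (6 n)\<close> allows for.
\<close>

lemma centred_moment_12_le:
  assumes m: "1 \<le> m" and n: "n \<ge> 1"
  shows "\<exists>K\<ge>0. \<forall>N. 1 \<le> N \<longrightarrow> 1 \<le> b N \<longrightarrow>
    (let Y = (\<lambda>\<omega>. trace_power n (normalized_toeplitz b a m N \<omega>) / (real m * real N)) in
      integrable P (\<lambda>\<omega>. (Y \<omega> - expectation Y) ^ 12) \<and> expectation (\<lambda>\<omega>. (Y \<omega> - expectation Y) ^ 12) \<le> K / (real (b N))\<^sup>2)"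
proof -
  define K1 where "K1 = 12 * (2 ^ 12 * (real n * moment_bound m (12 * n) + (real n * moment_bound m n) ^ 12))"
  define K where "K = K1 * 4 ^ ((12 * n)\<^sup>2) * real m ^ (12 * n) * 3 ^ (6 * n - 2)"
  have K1: "0 \<le> K1" by (simp add: K1_def moment_bound_def)
  have "0 \<le> K" using K1 by (simp add: K_def)
  moreover have "integrable P (\<lambda>\<omega>. (Y \<omega> - expectation Y) ^ 12) \<and> expectation (\<lambda>\<omega>. (Y \<omega> - expectation Y) ^ 12) \<le> K / (real (b N))\<^sup>2"
    if N: "1 \<le> N" and bN: "1 \<le> b N" and Y: "Y = (\<lambda>\<omega>. trace_power n (normalized_toeplitz b a m N \<omega>) / (real m * real N))" for N Y
  proof -
    interpret block_toeplitz_fixed P b a m N by unfold_locales (use m N in auto)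
    define c where "c = 1 / sqrt (2 * real m * real (b N))"
    define d where "d = c ^ n / (real m * real N)"
    define V where "V = trace_variable n"
    have Yd: "Y \<omega> = d * V \<omega>" if "\<omega> \<in> space P" for \<omega>
      using trace_power_normalized_toeplitz[OF n that] by (simp add: Y d_def c_def V_def)
    have "expectation Y = expectation (\<lambda>\<omega>. d * V \<omega>)" using Yd by (intro Bochner_Integration.integral_cong) auto
    hence EY: "expectation Y = d * expectation V" by simp
    have pw: "(Y \<omega> - expectation Y) ^ 12 = d ^ 12 * (V \<omega> - expectation V) ^ 12" if "\<omega> \<in> space P" for \<omega>
      unfolding Yd[OF that] EY by (simp add: right_diff_distrib[symmetric] power_mult_distrib)
    note V12 = expectation_centred_trace_12[OF n, folded V_def]
    have int: "integrable P (\<lambda>\<omega>. (Y \<omega> - expectation Y) ^ 12)"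
      using V12(2) by (subst Bochner_Integration.integrable_cong[OF refl pw]) auto
    have "expectation (\<lambda>\<omega>. (Y \<omega> - expectation Y) ^ 12) = expectation (\<lambda>\<omega>. d ^ 12 * (V \<omega> - expectation V) ^ 12)"
      using pw by (intro Bochner_Integration.integral_cong) auto
    also have "\<dots> = d ^ 12 * expectation (\<lambda>\<omega>. (V \<omega> - expectation V) ^ 12)" by simp
    also have "\<dots> \<le> d ^ 12 * (real N ^ 12 * K1 * (4 ^ ((12 * n)\<^sup>2) * real (2 * b N + 1) ^ (6 * n - 2) * real m ^ (12 * n)))"
      using V12(1) by (intro mult_left_mono) (auto simp: K1_def)
    also have "\<dots> = (c ^ 2) ^ (6 * n) / real m ^ 12 * (K1 * 4 ^ ((12 * n)\<^sup>2) * real m ^ (12 * n) * real (2 * b N + 1) ^ (6 * n - 2))"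
    proof -
      have "d ^ 12 * real N ^ 12 = (c ^ 2) ^ (6 * n) / real m ^ 12"
      proof -
        have "(c ^ n) ^ 12 = (c ^ 2) ^ (6 * n)" by (simp flip: power_mult add: mult.commute)
        thus ?thesis using N by (simp add: d_def power_divide power_mult_distrib)
      qed
      thus ?thesis by (metis (no_types, lifting) mult.assoc mult.commute)
    qed
    also have "\<dots> \<le> (1 / real (b N)) ^ (6 * n) * (K1 * 4 ^ ((12 * n)\<^sup>2) * real m ^ (12 * n) * (3 * real (b N)) ^ (6 * n - 2))"
    proof (intro mult_mono mult_nonneg_nonneg power_mono)
      have c2: "c ^ 2 = 1 / (2 * real m * real (b N))" by (simp add: c_def power_divide)
      have "1 * real (b N) \<le> 2 * real m * real (b N)" using m by (intro mult_right_mono) auto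
      hence "c ^ 2 \<le> 1 / real (b N)" unfolding c2 using bN by (intro divide_left_mono) auto
      hence "(c ^ 2) ^ (6 * n) \<le> (1 / real (b N)) ^ (6 * n)" by (intro power_mono) auto
      moreover have "(c ^ 2) ^ (6 * n) / real m ^ 12 \<le> (c ^ 2) ^ (6 * n)"
        using m by (simp add: divide_le_eq mult_le_cancel_left1)
      ultimately show "(c ^ 2) ^ (6 * n) / real m ^ 12 \<le> (1 / real (b N)) ^ (6 * n)" by linarith
    qed (use K1 bN in auto)
    also have "\<dots> = K * (real (b N) ^ (6 * n - 2) / real (b N) ^ (6 * n))"
      by (simp add: K_def power_mult_distrib power_divide)
    also have "real (b N) ^ (6 * n - 2) / real (b N) ^ (6 * n) = 1 / (real (b N))\<^sup>2"
    proof -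
      have "6 * n = (6 * n - 2) + 2" using n by simp
      hence "real (b N) ^ (6 * n) = real (b N) ^ (6 * n - 2) * (real (b N))\<^sup>2" by (metis power_add)
      thus ?thesis using bN by simp
    qed
    finally show ?thesis using int by simp
  qed
  ultimately show ?thesis by (intro exI[of _ K]) (auto simp: Let_def)
qed

text \<open>
  The sum of the variables has finite expectation, so it is almost surely finite.
\<close>

lemma AE_tendsto_0_of_summable_expectation:
  fixes Z :: "nat \<Rightarrow> 'a \<Rightarrow> real"
  assumes int: "\<And>N. integrable P (Z N)" and nonneg: "\<And>N \<omega>. 0 \<le> Z N \<omega>"
    and sum: "summable (\<lambda>N. expectation (Z N))"
  shows "AE \<omega> in P. (\<lambda>N. Z N \<omega>) \<longlonglongrightarrow> 0"
proof -
  have [measurable]: "Z N \<in> borel_measurable P" for N using int by auto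
  have "(\<integral>\<^sup>+\<omega>. (\<Sum>N. ennreal (Z N \<omega>)) \<partial>P) = (\<Sum>N. \<integral>\<^sup>+\<omega>. ennreal (Z N \<omega>) \<partial>P)"
    by (intro nn_integral_suminf) measurable
  also have "\<dots> = (\<Sum>N. ennreal (expectation (Z N)))"
    using int nonneg by (simp add: nn_integral_eq_integral)
  also have "\<dots> = ennreal (\<Sum>N. expectation (Z N))"
    using nonneg sum by (intro suminf_ennreal2) auto
  finally have "(\<integral>\<^sup>+\<omega>. (\<Sum>N. ennreal (Z N \<omega>)) \<partial>P) \<noteq> \<infinity>" by simp
  hence "AE \<omega> in P. (\<Sum>N. ennreal (Z N \<omega>)) \<noteq> \<infinity>" by (intro nn_integral_PInf_AE) measurable
  thus ?thesis
  proof eventually_elim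
    case (elim \<omega>)
    hence "summable (\<lambda>N. Z N \<omega>)" using nonneg by (intro summable_suminf_not_top) auto
    thus ?case by (rule summable_LIMSEQ_zero)
  qed
qed

text \<open>
  The twelfth central moments are bounded by a multiple of \<open>N powr (- 1 - 2 \<epsilon>)\<close>, which is summable, so the
  deviation of the empirical moment from its mean tends to zero almost surely.
\<close>

lemma empirical_moment_tendsto:
  assumes m: "1 \<le> m"
    and small: "(\<lambda>N. real (b N)) \<in> o(\<lambda>N. real N)" and large: "filterlim b at_top sequentially"
    and growth: "\<epsilon> > 0" "C > 0" "\<forall>\<^sub>F N in sequentially. real (b N) \<ge> C * real N powr (1 / 2 + \<epsilon>)"
  shows "AE \<omega> in P. (\<lambda>N. trace_power n (normalized_toeplitz b a m N \<omega>) / (real m * real N)) \<longlonglongrightarrow> limit_moment m n"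
proof (cases "n = 0")
  case True
  have t: "trace_power n (normalized_toeplitz b a m N \<omega>) = real m * real N" for N \<omega>
    using True by (simp add: trace_power_def normalized_toeplitz_def block_toeplitz_mat_def)
  have "(\<lambda>N. real m * real N / (real m * real N)) \<longlonglongrightarrow> 1"
    by (rule tendsto_eventually)
       (use eventually_ge_at_top[of "1::nat"] m in \<open>auto elim!: eventually_mono\<close>)
  hence "(\<lambda>N. trace_power n (normalized_toeplitz b a m N \<omega>) / (real m * real N)) \<longlonglongrightarrow> limit_moment m n" for \<omega>
    unfolding t limit_moment_def using True by (simp only: if_True refl)
  thus ?thesis by simp
next
  case False
  hence n: "n \<ge> 1" by simp
  define Y where "Y N = (\<lambda>\<omega>. trace_power n (normalized_toeplitz b a m N \<omega>) / (real m * real N))" for N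
  obtain K where K: "K \<ge> 0" "\<And>N. 1 \<le> N \<Longrightarrow> 1 \<le> b N \<Longrightarrow>
      integrable P (\<lambda>\<omega>. (Y N \<omega> - expectation (Y N)) ^ 12) \<and>
      expectation (\<lambda>\<omega>. (Y N \<omega> - expectation (Y N)) ^ 12) \<le> K / (real (b N))\<^sup>2"
    using centred_moment_12_le[OF m n] unfolding Let_def Y_def by blast
  have evb: "\<forall>\<^sub>F N in sequentially. b N \<ge> 1" using large by (simp add: filterlim_at_top)
  have "\<forall>\<^sub>F N in sequentially. b N \<ge> 1 \<and> real (b N) \<ge> C * real N powr (1 / 2 + \<epsilon>) \<and> 1 \<le> N"
    using evb growth(3) eventually_ge_at_top[of "1::nat"] by eventually_elim auto
  then obtain N0 where N0: "\<And>N. N \<ge> N0 \<Longrightarrow> b N \<ge> 1 \<and> real (b N) \<ge> C * real N powr (1 / 2 + \<epsilon>) \<and> 1 \<le> N"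
    by (auto simp: eventually_sequentially)
  \<comment> \<open>The bounds hold from \<open>N0\<close> on only, hence the shift.\<close>
  define Z where "Z N \<omega> = (Y (N + N0) \<omega> - expectation (Y (N + N0))) ^ 12" for N \<omega>
  have Z0: "AE \<omega> in P. (\<lambda>N. Z N \<omega>) \<longlonglongrightarrow> 0"
  proof (rule AE_tendsto_0_of_summable_expectation)
    show "integrable P (Z N)" for N unfolding Z_def[abs_def] using K(2) N0[of "N + N0"] by auto
    show "0 \<le> Z N \<omega>" for N \<omega> by (simp add: Z_def)
    show "summable (\<lambda>N. expectation (Z N))"
    proof (rule summable_comparison_test')
      have "summable (\<lambda>N. real N powr (- 1 - 2 * \<epsilon>))" using growth(1) by (simp add: summable_real_powr_iff)
      hence "summable (\<lambda>N. real (N + N0) powr (- 1 - 2 * \<epsilon>))" by (subst summable_iff_shift)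
      thus "summable (\<lambda>N. K / C\<^sup>2 * real (N + N0) powr (- 1 - 2 * \<epsilon>))" by (rule summable_mult)
      fix N :: nat
      define M where "M = N + N0"
      have M: "b M \<ge> 1" "real (b M) \<ge> C * real M powr (1 / 2 + \<epsilon>)" "1 \<le> M" using N0[of M] by (auto simp: M_def)
      have "norm (expectation (Z N)) = expectation (Z N)" by (simp add: Z_def Bochner_Integration.integral_nonneg)
      also have "\<dots> \<le> K / (real (b M))\<^sup>2" using K(2)[OF M(3,1)] by (simp add: Z_def[abs_def] M_def)
      also have "\<dots> \<le> K / (C * real M powr (1 / 2 + \<epsilon>))\<^sup>2"
        using K(1) M growth(2) by (intro divide_left_mono power_mono mult_pos_pos) auto
      also have "(C * real M powr (1 / 2 + \<epsilon>))\<^sup>2 = C\<^sup>2 * real M powr (1 + 2 * \<epsilon>)"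
        using M by (simp add: power_mult_distrib power2_eq_square powr_add[symmetric])
      also have "K / (C\<^sup>2 * real M powr (1 + 2 * \<epsilon>)) = K / C\<^sup>2 * real M powr (- 1 - 2 * \<epsilon>)"
      proof -
        have "real M powr (- 1 - 2 * \<epsilon>) = 1 / real M powr (1 + 2 * \<epsilon>)"
          using powr_minus[of "real M" "1 + 2 * \<epsilon>"] by (simp add: inverse_eq_divide)
        thus ?thesis by simp
      qed
      finally show "norm (expectation (Z N)) \<le> K / C\<^sup>2 * real (N + N0) powr (- 1 - 2 * \<epsilon>)" by (simp add: M_def)
    qed
  qed
  have EY: "(\<lambda>N. expectation (Y N)) \<longlonglongrightarrow> limit_moment m n"
    using mean_moment_tendsto[OF m small large, of n] by (simp add: Y_def)
  show ?thesis
    using Z0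
  proof eventually_elim
    case (elim \<omega>)
    have "(\<lambda>N. Y (N + N0) \<omega> - expectation (Y (N + N0))) \<longlonglongrightarrow> 0"
      using elim unfolding Z_def by (subst (asm) power_tendsto_0_iff) auto
    hence "(\<lambda>N. Y N \<omega> - expectation (Y N)) \<longlonglongrightarrow> 0" by (rule LIMSEQ_offset)
    from tendsto_add[OF this EY] show ?case by (simp add: Y_def)
  qed
qed

end

section \<open>The limit distribution\<close>

lemma limit_moment_odd:
  assumes "odd n"
  shows "limit_moment m n = 0"
proof -
  have "pair_partitions n = {}" using pair_partition_halves(4) assms by (metis dvd_triv_left equals0I)
  moreover have "n \<noteq> 0" using assms by (intro notI) simp
  ultimately show ?thesis by (simp add: limit_moment_def)
qed

lemma limit_moment_even:
  assumes "m \<ge> 1" "k \<ge> 1"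
  shows "limit_moment m (2 * k) =
    (\<Sum>\<pi>\<in>pair_partitions (2 * k). real m powi (int k - 1 - int (pairing_rank k \<pi>)))"
  using assms card_pairing_solutions[OF assms(2) _ assms(1)] by (simp add: limit_moment_def)

text \<open>
  By \<open>card_pair_partitions_le\<close> the \<open>2 k\<close>-th limit moment is at most \<open>2 ^ k k! m ^ (2 k)\<close>, and \<open>k! k!\<close> is at
  most \<open>(2 k)!\<close>, so the expression is dominated by the terms of an exponential series.
\<close>

lemma limit_moment_growth:
  assumes m: "m \<ge> 1"
  shows "(\<lambda>k. t ^ (2 * k) / fact (2 * k) * limit_moment m (2 * k)) \<longlonglongrightarrow> 0"
proof (rule Lim_null_comparison)
  define y where "y = 2 * (real m)\<^sup>2 * t\<^sup>2"
  have "summable (\<lambda>k. inverse (fact k) * y ^ k)" by (rule summable_exp)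
  thus "(\<lambda>k. inverse (fact k) * y ^ k) \<longlonglongrightarrow> 0" by (rule summable_LIMSEQ_zero)
  have "norm (t ^ (2 * k) / fact (2 * k) * limit_moment m (2 * k)) \<le> inverse (fact k) * y ^ k" if k: "k \<ge> 1" for k
  proof -
    have nn: "0 \<le> limit_moment m (2 * k)" by (simp add: limit_moment_def sum_nonneg)
    have "limit_moment m (2 * k) \<le> (\<Sum>\<pi>\<in>pair_partitions (2 * k). real m ^ (2 * k))"
    proof -
      have "real (card (pairing_solutions (2 * k) m \<pi>)) / real m ^ (k + 1) \<le> real m ^ (2 * k)" for \<pi>
      proof -
        have "real (card (pairing_solutions (2 * k) m \<pi>)) \<le> real m ^ (2 * k)"
          using card_pairing_solutions_le by (simp flip: of_nat_power)
        moreover have "real (card (pairing_solutions (2 * k) m \<pi>)) / real m ^ (k + 1) \<le> real (card (pairing_solutions (2 * k) m \<pi>))"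
          using divide_left_mono[of 1 "real m ^ (k + 1)" "real (card (pairing_solutions (2 * k) m \<pi>))"]
            one_le_power[of "real m" "k + 1"] m by simp
        ultimately show ?thesis by linarith
      qed
      thus ?thesis using k by (simp add: limit_moment_def sum_mono del: sum_constant)
    qed
    also have "\<dots> = real (card (pair_partitions (2 * k))) * real m ^ (2 * k)" by simp
    also have "real (card (pair_partitions (2 * k))) \<le> 2 ^ k * fact k"
    proof -
      have "card (pair_partitions (2 * k)) \<le> 2 ^ k * fact k"
        using card_pair_partitions_le[of "{..<2 * k}"] by (simp add: pair_partitions_def)
      hence "real (card (pair_partitions (2 * k))) \<le> real (2 ^ k * fact k)" by (simp only: of_nat_le_iff)
      thus ?thesis by simp
    qed
    finally have M: "limit_moment m (2 * k) \<le> 2 ^ k * fact k * real m ^ (2 * k)"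
      by (simp add: mult_right_mono)
    have f: "(fact k :: real) * fact k \<le> fact (2 * k)"
    proof -
      have "(fact k * fact k :: nat) dvd fact (k + k)" by (rule fact_fact_dvd_fact)
      hence "(fact k * fact k :: nat) \<le> fact (2 * k)" by (intro dvd_imp_le) (auto simp: mult_2)
      hence "real (fact k * fact k) \<le> real (fact (2 * k))" by (simp only: of_nat_le_iff)
      thus ?thesis by simp
    qed
    have "norm (t ^ (2 * k) / fact (2 * k) * limit_moment m (2 * k)) = t ^ (2 * k) / fact (2 * k) * limit_moment m (2 * k)"
      using nn by (simp add: abs_mult power_even_abs)
    also have "\<dots> \<le> t ^ (2 * k) / (fact k * fact k) * (2 ^ k * fact k * real m ^ (2 * k))"
      using M nn f by (intro mult_mono divide_left_mono) auto
    also have "\<dots> = inverse (fact k) * y ^ k"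
    proof -
      have "y ^ k = 2 ^ k * real m ^ (2 * k) * t ^ (2 * k)" by (simp add: y_def power_mult_distrib power_mult)
      thus ?thesis by (simp add: field_simps)
    qed
    finally show ?thesis .
  qed
  thus "\<forall>\<^sub>F k in sequentially. norm (t ^ (2 * k) / fact (2 * k) * limit_moment m (2 * k)) \<le> inverse (fact k) * y ^ k"
    by (rule eventually_mono[OF eventually_ge_at_top[of 1]])
qed

lemma has_limit_moments_iff:
  assumes m: "m \<ge> 1" and \<gamma>: "prob_space \<gamma>"
  shows "has_limit_moments m \<gamma> \<longleftrightarrow> (\<forall>n. integrable \<gamma> (\<lambda>x. x ^ n) \<and> (\<integral>x. x ^ n \<partial>\<gamma>) = limit_moment m n)"
proof
  assume L: "has_limit_moments m \<gamma>"
  show "\<forall>n. integrable \<gamma> (\<lambda>x. x ^ n) \<and> (\<integral>x. x ^ n \<partial>\<gamma>) = limit_moment m n"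
  proof (intro allI conjI)
    fix n
    show "integrable \<gamma> (\<lambda>x. x ^ n)" using L by (simp add: has_limit_moments_def)
    show "(\<integral>x. x ^ n \<partial>\<gamma>) = limit_moment m n"
    proof (cases "odd n")
      case True
      thus ?thesis using L limit_moment_odd by (simp add: has_limit_moments_def)
    next
      case False
      then obtain k where k: "n = 2 * k" by (auto elim: evenE)
      show ?thesis
      proof (cases "k = 0")
        case True
        thus ?thesis using k prob_space.prob_space[OF \<gamma>] by (simp add: limit_moment_def)
      next
        case False
        thus ?thesis using L k limit_moment_even[OF m, of k] by (simp add: has_limit_moments_def)
      qed
    qed
  qed
next
  assume "\<forall>n. integrable \<gamma> (\<lambda>x. x ^ n) \<and> (\<integral>x. x ^ n \<partial>\<gamma>) = limit_moment m n"
  thus "has_limit_moments m \<gamma>"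
    using limit_moment_odd limit_moment_even[OF m] by (simp add: has_limit_moments_def)
qed

lemma weak_conv_m_Suc:
  assumes "weak_conv_m (\<lambda>N. \<mu> (Suc N)) \<gamma>"
  shows "weak_conv_m \<mu> \<gamma>"
  using assms unfolding weak_conv_m_def weak_conv_def by (auto intro: LIMSEQ_imp_Suc)

theorem theorem4p3:
  fixes P :: "'a measure"
    and b :: "nat \<Rightarrow> nat"
    and a :: "nat \<Rightarrow> nat \<Rightarrow> int \<Rightarrow> nat \<Rightarrow> nat \<Rightarrow> 'a \<Rightarrow> real"
    and m :: nat
  assumes "m \<ge> 1"
    and "block_toeplitz_band_model P b a"
    and "(\<lambda>N. real (b N)) \<in> o(\<lambda>N. real N)"
    and "filterlim b at_top sequentially"
  shows "\<exists>\<gamma>. real_distribution \<gamma> \<and> has_limit_moments m \<gamma> \<and>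
           (\<forall>\<nu>. real_distribution \<nu> \<and> has_limit_moments m \<nu> \<longrightarrow> \<nu> = \<gamma>) \<and>
           weak_conv_m (\<lambda>N. mean_eigenvalue_distr P (m * N) (normalized_toeplitz b a m N)) \<gamma> \<and>
           ((\<exists>\<epsilon>\<^sub>0>0. \<exists>C>0. \<forall>\<^sub>F N in sequentially. real (b N) \<ge> C * real N powr (1 / 2 + \<epsilon>\<^sub>0)) \<longrightarrow>
             (AE \<omega> in P.
               weak_conv_m (\<lambda>N. empirical_eigenvalue_distr (normalized_toeplitz b a m N \<omega>)) \<gamma>))"
proof -
  note m = assms(1) and small = assms(3) and large = assms(4)
  interpret block_toeplitz_band_model P b a by (rule assms(2))
  define \<mu> where "\<mu> N = mean_eigenvalue_distr P (m * N) (normalized_toeplitz b a m N)" for N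
  have \<mu>: "real_distribution (\<mu> (Suc N))" "integrable (\<mu> (Suc N)) (\<lambda>x. x ^ n)"
    "(\<integral>x. x ^ n \<partial>\<mu> (Suc N)) = expectation (\<lambda>\<omega>. trace_power n (normalized_toeplitz b a m (Suc N) \<omega>)) / (real m * real (Suc N))" for N n
  proof -
    interpret fixd: block_toeplitz_fixed P b a m "Suc N" by unfold_locales (use m in auto)
    have pos: "m * Suc N > 0" using m by simp
    note md = mean_eigenvalue_distr_moments[OF prob_space_axioms pos fixd.normalized_toeplitz_carrier
        fixd.normalized_toeplitz_symmetric fixd.trace_power_normalized_integrable, folded \<mu>_def]
    show "real_distribution (\<mu> (Suc N))" "integrable (\<mu> (Suc N)) (\<lambda>x. x ^ n)" using md by blast+
    show "(\<integral>x. x ^ n \<partial>\<mu> (Suc N)) = expectation (\<lambda>\<omega>. trace_power n (normalized_toeplitz b a m (Suc N) \<omega>)) / (real m * real (Suc N))"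
    proof -
      have "(\<integral>x. x ^ n \<partial>\<mu> (Suc N)) = expectation (\<lambda>\<omega>. trace_power n (normalized_toeplitz b a m (Suc N) \<omega>)) / real (m * Suc N)"
        by (rule md(3))
      thus ?thesis by (simp only: of_nat_mult)
    qed
  qed
  have conv: "(\<lambda>N. \<integral>x. x ^ n \<partial>\<mu> (Suc N)) \<longlonglongrightarrow> limit_moment m n" for n
    unfolding \<mu>(3) using LIMSEQ_Suc[OF mean_moment_tendsto[OF m small large, of n]] .
  obtain \<gamma> where \<gamma>: "real_distribution \<gamma>" "\<And>n. integrable \<gamma> (\<lambda>x. x ^ n)" "\<And>n. (\<integral>x. x ^ n \<partial>\<gamma>) = limit_moment m n"
    using exists_distribution_with_limit_moments[OF \<mu>(1,2) conv] by blast
  have growth: "(\<lambda>k. t ^ (2 * k) / fact (2 * k) * (\<integral>x. x ^ (2 * k) \<partial>\<gamma>)) \<longlonglongrightarrow> 0" for t :: real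
    unfolding \<gamma>(3) by (rule limit_moment_growth[OF m])
  have "has_limit_moments m \<gamma>"
    using \<gamma> has_limit_moments_iff[OF m] by (simp add: real_distribution_def)
  moreover have "\<nu> = \<gamma>" if \<nu>: "real_distribution \<nu>" "has_limit_moments m \<nu>" for \<nu>
  proof -
    have "\<forall>n. integrable \<nu> (\<lambda>x. x ^ n) \<and> (\<integral>x. x ^ n \<partial>\<nu>) = limit_moment m n"
      using \<nu> has_limit_moments_iff[OF m, of \<nu>] by (simp add: real_distribution_def)
    thus ?thesis
      by (intro moments_determine_distribution[OF \<gamma>(1) \<nu>(1) \<gamma>(2) _ _ growth]) (simp_all add: \<gamma>(3))
  qed
  moreover have "weak_conv_m \<mu> \<gamma>"
    by (rule weak_conv_m_Suc, rule moment_convergence_imp_weak_conv[OF \<mu>(1) \<gamma>(1) \<mu>(2) \<gamma>(2) _ growth])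
       (simp only: \<gamma>(3) conv)
  moreover have "AE \<omega> in P. weak_conv_m (\<lambda>N. empirical_eigenvalue_distr (normalized_toeplitz b a m N \<omega>)) \<gamma>"
    if ex: "\<exists>\<epsilon>\<^sub>0>0. \<exists>C>0. \<forall>\<^sub>F N in sequentially. real (b N) \<ge> C * real N powr (1 / 2 + \<epsilon>\<^sub>0)"
  proof -
    obtain \<epsilon> C where *: "\<epsilon> > 0" "C > 0" "\<forall>\<^sub>F N in sequentially. real (b N) \<ge> C * real N powr (1 / 2 + \<epsilon>)"
      using ex by blast
    have "AE \<omega> in P. \<forall>n. (\<lambda>N. trace_power n (normalized_toeplitz b a m N \<omega>) / (real m * real N)) \<longlonglongrightarrow> limit_moment m n"
      using empirical_moment_tendsto[OF m small large *] by (simp add: AE_all_countable)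
    with AE_space show ?thesis
    proof eventually_elim
      case (elim \<omega>)
      define \<eta> where "\<eta> N = empirical_eigenvalue_distr (normalized_toeplitz b a m N \<omega>)" for N
      have \<eta>: "real_distribution (\<eta> (Suc N))" "integrable (\<eta> (Suc N)) (\<lambda>x. x ^ n)"
        "(\<integral>x. x ^ n \<partial>\<eta> (Suc N)) = trace_power n (normalized_toeplitz b a m (Suc N) \<omega>) / (real m * real (Suc N))" for N n
      proof -
        interpret fixd: block_toeplitz_fixed P b a m "Suc N" by unfold_locales (use m in auto)
        have pos: "m * Suc N > 0" using m by simp
        note ed = symmetric_eigenvalue_distr[OF fixd.normalized_toeplitz_carrier pos
            fixd.normalized_toeplitz_symmetric[OF elim(1)], folded \<eta>_def]
        show "real_distribution (\<eta> (Suc N))" "integrable (\<eta> (Suc N)) (\<lambda>x. x ^ n)" using ed(1,3) by blast+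
        show "(\<integral>x. x ^ n \<partial>\<eta> (Suc N)) = trace_power n (normalized_toeplitz b a m (Suc N) \<omega>) / (real m * real (Suc N))"
        proof -
          have "(\<integral>x. x ^ n \<partial>\<eta> (Suc N)) = trace_power n (normalized_toeplitz b a m (Suc N) \<omega>) / real (m * Suc N)"
            by (rule ed(4))
          thus ?thesis by (simp only: of_nat_mult)
        qed
      qed
      have "(\<lambda>N. \<integral>x. x ^ n \<partial>\<eta> (Suc N)) \<longlonglongrightarrow> (\<integral>x. x ^ n \<partial>\<gamma>)" for n
        unfolding \<eta>(3) \<gamma>(3) using LIMSEQ_Suc[OF spec[OF elim(2), of n]] .
      from moment_convergence_imp_weak_conv[OF \<eta>(1) \<gamma>(1) \<eta>(2) \<gamma>(2) this growth]
      have "weak_conv_m (\<lambda>N. \<eta> (Suc N)) \<gamma>" .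
      thus ?case unfolding \<eta>_def[symmetric] by (rule weak_conv_m_Suc)
    qed
  qed
  ultimately show ?thesis using \<gamma>(1) unfolding \<mu>_def by blast
qed

end
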